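(* Let $\gamma,\omega\in\mathbb R$, $\beta\in\mathbb C$ and $L\in\mathbb R$, and consider $$\partial_t u=(1+i\gamma)\partial_x^2u+\beta u-(1+i\omega)u|u|^2+L\partial_x^3u$$ for complex-valued $u$ on $\mathbb R$, $2\pi$-periodic in $x$. This equation is well-posed in every $H^s$, $s\ge0$, and its solutions satisfy the dissipative estimate $$\|u(t)\|_{H^s}\le Q_s(\|u_0\|_{H^s})e^{-\kappa t}+C_*,$$ where the monotone function $Q_s$ and positive constants $\kappa,C_*$ depend on $s$ but are independent of $L$ as $L\to\infty$. Moreover, the smoothing property $$\|u(t)\|_{H^s}\le (1+t^{-N_s})\tilde Q_s(\|u_0\|_H),\quad t>0,$$ holds with a monotone function $\tilde Q_s$ and constant $N_s$ uniform with respect to $L$ as $L\to\infty$. Finally, for any two solutions $u_1,u_2$, $$\|u_1(t)-u_2(t)\|_H\le e^{Kt}\|u_1(0)-u_2(0)\|_H,$$ where $K$ depends on the $H$-norms of $u_i(0)$ but is independent of $L$ and $t$.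
   Context: $H=L^2_{per}(-\pi,\pi)$ is the space of complex-valued $2\pi$-periodic square-integrable functions, $H^s$ the periodic Sobolev spaces with $\|v\|_{H^s}^2=\sum_n(|n|^2+1)^s|v_n|^2$ for $v=\sum_n v_ne^{inx}$ (so $\|v\|_H^2=\sum_n|v_n|^2$). *)

theory Defs
  imports "HOL-Analysis.Analysis"
begin

text \<open>A 2pi-periodic function is represented by its Fourier coefficients
  v :: int => complex, i.e. v = sum_n v n e^{inx}.\<close>

definition Hs_weight :: "real \<Rightarrow> (int \<Rightarrow> complex) \<Rightarrow> int \<Rightarrow> real" where
  "Hs_weight s v n = (real_of_int n ^ 2 + 1) powr s * (cmod (v n))\<^sup>2"

definition in_Hs :: "real \<Rightarrow> (int \<Rightarrow> complex) \<Rightarrow> bool" where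
  "in_Hs s v \<longleftrightarrow> (Hs_weight s v) summable_on UNIV"

definition Hs_norm :: "real \<Rightarrow> (int \<Rightarrow> complex) \<Rightarrow> real" where
  "Hs_norm s v = sqrt (\<Sum>\<^sub>\<infinity>n. Hs_weight s v n)"

text \<open>Fourier coefficients of u |u|^2: sum over a - b + c = n of u_a conj(u_b) u_c.\<close>
definition cubic :: "(int \<Rightarrow> complex) \<Rightarrow> int \<Rightarrow> complex" where
  "cubic v n = (\<Sum>\<^sub>\<infinity>(b, c)\<in>UNIV. v (n + b - c) * cnj (v b) * v c)"

text \<open>Symbol of the linear part (1+i gamma) d_x^2 + beta + L d_x^3, d_x = i n.\<close>
definition symb :: "real \<Rightarrow> complex \<Rightarrow> real \<Rightarrow> int \<Rightarrow> complex" where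
  "symb \<gamma> \<beta> L n = (1 + \<i> * complex_of_real \<gamma>) * (\<i> * of_int n) ^ 2 + \<beta>
                     + complex_of_real L * (\<i> * of_int n) ^ 3"

definition is_solution :: "real \<Rightarrow> real \<Rightarrow> complex \<Rightarrow> real \<Rightarrow> (real \<Rightarrow> int \<Rightarrow> complex) \<Rightarrow> bool" where
  "is_solution \<gamma> \<omega> \<beta> L U \<longleftrightarrow>
     (\<forall>t\<ge>0. in_Hs 0 (U t)) \<and>
     (\<forall>t0\<ge>0. ((\<lambda>t. Hs_norm 0 (U t - U t0)) \<longlongrightarrow> 0) (at t0 within {0..})) \<and>
     (\<forall>t>0. in_Hs 1 (U t)) \<and>
     (\<forall>T\<ge>0. (\<lambda>t. (Hs_norm 1 (U t))\<^sup>2) integrable_on {0..T}) \<and>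
     (\<forall>n. \<forall>t>0. ((\<lambda>\<tau>. U \<tau> n) has_vector_derivative
         (symb \<gamma> \<beta> L n * U t n - (1 + \<i> * complex_of_real \<omega>) * cubic (U t) n)) (at t))"

definition dissipative_est ::
  "real \<Rightarrow> real \<Rightarrow> complex \<Rightarrow> real \<Rightarrow> real \<Rightarrow> (real \<Rightarrow> real) \<Rightarrow> real \<Rightarrow> real \<Rightarrow> bool" where
  "dissipative_est \<gamma> \<omega> \<beta> L s Q \<kappa> C \<longleftrightarrow>
     (\<forall>U. is_solution \<gamma> \<omega> \<beta> L U \<and> in_Hs s (U 0) \<longrightarrow>
        (\<forall>t\<ge>0. Hs_norm s (U t) \<le> Q (Hs_norm s (U 0)) * exp (- \<kappa> * t) + C))"

definition smoothing_est ::
  "real \<Rightarrow> real \<Rightarrow> complex \<Rightarrow> real \<Rightarrow> real \<Rightarrow> (real \<Rightarrow> real) \<Rightarrow> real \<Rightarrow> bool" where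
  "smoothing_est \<gamma> \<omega> \<beta> L s Q N \<longleftrightarrow>
     (\<forall>U. is_solution \<gamma> \<omega> \<beta> L U \<longrightarrow>
        (\<forall>t>0. in_Hs s (U t) \<and> Hs_norm s (U t) \<le> (1 + t powr (- N)) * Q (Hs_norm 0 (U 0))))"

end

theory Submission
  imports Defs
begin

text \<open>
  Everything happens on the Fourier side. The third-order term and \<open>\<gamma>\<close> only enter the imaginary part of the
  symbol, so every estimate below sees \<open>Re \<lambda>\<^sub>n = Re \<beta> - n\<^sup>2\<close> alone and is automatically uniform in \<open>L\<close>.

  The cubic term is dissipative in \<open>H\<close>, since its pairing with \<open>u\<close> is \<open>\<parallel>|u|\<^sup>2\<parallel>\<^sup>2 \<ge> \<parallel>u\<parallel>\<^sup>4\<close>. This gives the absorbing ball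
  in \<open>H\<close> and the bound of \<open>\<integral>\<parallel>u\<parallel>\<^sub>1\<^sup>2\<close> over unit time intervals. Agmon's inequality
  \<open>\<parallel>u\<parallel>\<^sub>\<ell>\<^sub>1\<^sup>2 \<le> 16 \<parallel>u\<parallel>\<^sub>0 \<parallel>u\<parallel>\<^sub>1\<close> then bounds the cubic term in \<open>L\<^sup>2(0,T; H\<^sup>s)\<close> by a multiple of \<open>sup \<parallel>u\<parallel>\<^sub>s\<close>, and the heat
  semigroup turns an \<open>L\<^sup>2\<close>-in-time forcing in \<open>H\<^sup>s\<close> into a solution in \<open>H\<^sup>s\<^sup>+\<^sup>1\<close>, so regularity improves by
  one derivative per step. Differences of solutions are controlled in \<open>H\<close> by the same energy method;
  interpolation between \<open>H\<close> and the smoothing bound upgrades this to continuity in \<open>H\<^sup>s\<close>.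

  Global existence for data in \<open>H\<^sup>1\<close> needs no continuation argument: Picard iteration solves the equation with
  the cubic term multiplied by a cutoff \<open>\<theta>(t) \<in> [0,1]\<close> depending on \<open>\<parallel>u(t)\<parallel>\<^sub>\<ell>\<^sub>1\<close>. The energy estimates do not see
  \<open>\<theta>\<close>, so they show that a cutoff at a suitable time-dependent radius is never active. For data in \<open>H\<close> one
  passes to the limit along Fourier truncations of the initial value.
\<close>

section \<open>Convolution estimates\<close>

text \<open>Each Fourier mode solves an ODE for t > 0, but the H^s norm of a solution, an infinite
  sum over modes, cannot be differentiated directly. Two devices replace this. Where absolute values
  suffice, \<open>forced_weighted_bound\<close> estimates an arbitrary finite set of modes with
  constants independent of the set, and \<open>in_HsI_sq\<close> reads off membership and norm
  together. Where the sign of the cubic pairing matters, only the infinite sum has a sign, so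
  \<open>forced_energy\<close> integrates partial sums and passes to the limit by dominated
  convergence. Data in H are the main obstacle: the H^1 norm may then be unbounded as t tends to 0,
  and only the time integral of its square is controlled. The regularity estimates are therefore
  arranged so that the cubic forcing costs exactly two powers of the H^1 norm: Agmon squared bounds
  the fourth power of \<open>l1\<close> by 256 times the squares of the H and H^1 norms, and the
  remaining factor is measured in H^s. Convolution sums are estimated in \<open>ennreal\<close>,
  where summations may be exchanged freely, and carried back to \<open>infsum\<close> by the next
  lemmas.\<close>

lemma nn_integral_count_space_conv_infsum:
  fixes f :: "'a \<Rightarrow> real"
  assumes nn: "\<And>x. f x \<ge> 0"
  shows summable_on_iff_nn_integral: "f summable_on UNIV \<longleftrightarrow> (\<integral>\<^sup>+x. ennreal (f x) \<partial>count_space UNIV) < \<infinity>"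
    and nn_integral_eq_infsum: "f summable_on UNIV \<Longrightarrow> (\<integral>\<^sup>+x. ennreal (f x) \<partial>count_space UNIV) = ennreal (infsum f UNIV)"
proof -
  have nf: "(\<lambda>x. norm (f x)) = f" using nn by auto
  have eq: "f summable_on UNIV \<longleftrightarrow> integrable (count_space UNIV) f"
    using abs_summable_equivalent[of f UNIV] unfolding nf Infinite_Set_Sum.abs_summable_on_def by simp
  show "f summable_on UNIV \<longleftrightarrow> (\<integral>\<^sup>+x. ennreal (f x) \<partial>count_space UNIV) < \<infinity>"
    unfolding eq integrable_iff_bounded using nn by simp
  assume s: "f summable_on UNIV"
  have "infsum f UNIV = lebesgue_integral (count_space UNIV) f"
    using infsetsum_infsum[of f UNIV] s eq unfolding Infinite_Set_Sum.abs_summable_on_def infsetsum_def by simp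
  then show "(\<integral>\<^sup>+x. ennreal (f x) \<partial>count_space UNIV) = ennreal (infsum f UNIV)"
    using nn_integral_eq_integral[of "count_space UNIV" f] s eq nn by simp
qed

lemma nonneg_summable_infsum_leI:
  fixes f :: "'a \<Rightarrow> real"
  assumes nn: "\<And>x. f x \<ge> 0" and le: "\<And>A. finite A \<Longrightarrow> sum f A \<le> B"
  shows "f summable_on UNIV" "infsum f UNIV \<le> B"
proof -
  show s: "f summable_on UNIV"
    by (rule nonneg_bdd_above_summable_on) (use nn le in \<open>auto intro!: bdd_aboveI\<close>)
  show "infsum f UNIV \<le> B"
    by (rule infsum_le_finite_sums[OF s]) (use le in auto)
qed

lemma nonneg_sum_le_infsum:
  fixes f :: "'a \<Rightarrow> real"
  assumes "\<And>x. f x \<ge> 0" "f summable_on UNIV" "finite A"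
  shows "sum f A \<le> infsum f UNIV"
  by (rule finite_sum_le_infsum) (use assms in auto)

lemma nonneg_summable_nn_leI:
  fixes f :: "'a \<Rightarrow> real"
  assumes nn: "\<And>x. f x \<ge> 0" and le: "(\<integral>\<^sup>+x. ennreal (f x) \<partial>count_space UNIV) \<le> ennreal B" and "B \<ge> 0"
  shows "f summable_on UNIV" "infsum f UNIV \<le> B"
proof -
  show s: "f summable_on UNIV"
    unfolding summable_on_iff_nn_integral[of f, OF nn] using le by (simp add: le_less_trans)
  show "infsum f UNIV \<le> B"
    using le nn_integral_eq_infsum[of f, OF nn s] assms(3) by simp
qed

definition l1 :: "(int \<Rightarrow> complex) \<Rightarrow> real" where "l1 v = (\<Sum>\<^sub>\<infinity>n. cmod (v n))"

definition in_l1 :: "(int \<Rightarrow> complex) \<Rightarrow> bool" where "in_l1 v \<longleftrightarrow> (\<lambda>n. cmod (v n)) summable_on UNIV"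

text \<open>The polarised form of \<open>cubic\<close>, conjugate-linear in the middle slot;
  differences of cubic terms are sums of such forms.\<close>

definition tri :: "(int \<Rightarrow> complex) \<Rightarrow> (int \<Rightarrow> complex) \<Rightarrow> (int \<Rightarrow> complex) \<Rightarrow> int \<Rightarrow> complex" where
  "tri u v w n = (\<Sum>\<^sub>\<infinity>(b, c)\<in>UNIV. u (n + b - c) * cnj (v b) * w c)"

lemma cubic_eq_tri: "cubic v = tri v v v"
  by (simp add: cubic_def tri_def fun_eq_iff)

section \<open>Convolutions of nonnegative sequences\<close>

abbreviation esum :: "('a \<Rightarrow> ennreal) \<Rightarrow> ennreal" where
  "esum f \<equiv> \<integral>\<^sup>+n. f n \<partial>count_space UNIV"

text \<open>The majorant of \<open>tri\<close> by moduli. Values in \<open>ennreal\<close> let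
  Tonelli act without side conditions; finiteness is read off at the end.\<close>

definition econv :: "(int \<Rightarrow> ennreal) \<Rightarrow> (int \<Rightarrow> ennreal) \<Rightarrow> (int \<Rightarrow> ennreal) \<Rightarrow> int \<Rightarrow> ennreal" where
  "econv p q r n = esum (\<lambda>b. esum (\<lambda>c. p (n + b - c) * q b * r c))"

lemma esum_swap: "esum (\<lambda>x::int. esum (\<lambda>y::int. f x y)) = esum (\<lambda>y. esum (\<lambda>x. f x y))"
  by (rule nn_integral_count_space_nn_integral) auto

lemma esum_bij: "bij g \<Longrightarrow> esum (\<lambda>x. f (g x)) = esum f"
  by (rule nn_integral_bij_count_space) auto

lemma esum_shift: "esum (\<lambda>x::int. f (x + k)) = esum f"
  by (rule esum_bij) (rule bij_plus_right)

lemma esum_reflect: "esum (\<lambda>x::int. f (k - x)) = esum f"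
  by (rule esum_bij) (auto simp: bij_def inj_def surj_def intro: exI[of _ "k - _"])

lemma esum_cmult: "esum (\<lambda>x. c * f x) = c * esum f"
  by (rule nn_integral_cmult) simp

lemma esum_multc: "esum (\<lambda>x. f x * c) = esum f * c"
  by (rule nn_integral_multc) simp

lemma esum_econv: "esum (econv p q r) = esum p * esum q * esum r"
proof -
  have "esum (econv p q r) = esum (\<lambda>b. esum (\<lambda>n. esum (\<lambda>c. p (n + b - c) * q b * r c)))"
    unfolding econv_def by (rule esum_swap)
  also have "\<dots> = esum (\<lambda>b. esum (\<lambda>c. esum (\<lambda>n. p (n + b - c) * q b * r c)))"
    by (intro nn_integral_cong esum_swap)
  also have "\<dots> = esum (\<lambda>b. esum (\<lambda>c. esum p * q b * r c))"
  proof (intro nn_integral_cong)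
    fix b c :: int
    have "esum (\<lambda>n. p (n + b - c) * q b * r c) = esum (\<lambda>n. p (n + (b - c)) * (q b * r c))"
      by (simp add: algebra_simps)
    also have "\<dots> = esum p * (q b * r c)"
      by (simp add: esum_multc esum_shift)
    finally show "esum (\<lambda>n. p (n + b - c) * q b * r c) = esum p * q b * r c"
      by (simp add: mult.assoc)
  qed
  also have "\<dots> = esum p * esum q * esum r"
    by (simp add: esum_cmult esum_multc)
  finally show ?thesis .
qed

lemma econv_swap13: "econv p q r n = econv r q p n"
proof -
  have "esum (\<lambda>c. p (n + b - c) * q b * r c) = esum (\<lambda>c. r (n + b - c) * q b * p c)" for b
    using esum_reflect[of "\<lambda>c. r (n + b - c) * q b * p c" "n + b"]
    by (simp add: mult_ac)
  then show ?thesis unfolding econv_def by simp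
qed

text \<open>The conjugated factor carries the opposite frequency sign, so exchanging it with the
  first factor costs a reflection k to -k, which changes neither sums nor sums of squares. With
  \<open>econv_swap13\<close>, each estimate has to be proved for one position of the distinguished
  factor only.\<close>

lemma econv_swap12: "econv p q r n = econv (\<lambda>k. q (- k)) (\<lambda>k. p (- k)) r n"
proof -
  have *: "esum (\<lambda>b. p (n + b - c) * q b * r c) = esum (\<lambda>b. q (- (n + b - c)) * p (- b) * r c)" for c
    using esum_reflect[of "\<lambda>b. p (n + b - c) * q b * r c" "c - n"]
    by (simp add: algebra_simps)
  have "econv p q r n = esum (\<lambda>c. esum (\<lambda>b. p (n + b - c) * q b * r c))"
    unfolding econv_def by (rule esum_swap)
  also have "\<dots> = esum (\<lambda>c. esum (\<lambda>b. q (- (n + b - c)) * p (- b) * r c))"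
    by (simp add: *)
  also have "\<dots> = econv (\<lambda>k. q (- k)) (\<lambda>k. p (- k)) r n"
    unfolding econv_def by (rule esum_swap)
  finally show ?thesis .
qed

lemma esum_reflect0: "esum (\<lambda>x::int. f (- x)) = esum f"
  using esum_reflect[of f 0] by simp

text \<open>For fixed \<open>c\<close>, Cauchy-Schwarz in \<open>b\<close> bounds the correlation of
  \<open>p\<close> and \<open>q\<close> by the product of their l2 norms; summing against
  \<open>r\<close> gives the claim. The outer square is expanded into a double sum over
  \<open>c\<close> and \<open>d\<close> so that no square roots in \<open>ennreal\<close> are taken;
  a product of two correlations is at most the square of the larger one.\<close>

lemma econv_sup_bound3: "(econv p q r n)\<^sup>2 \<le> esum (\<lambda>k. (p k)\<^sup>2) * esum (\<lambda>k. (q k)\<^sup>2) * (esum r)\<^sup>2"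
proof -
  define S where "S = esum (\<lambda>k. (p k)\<^sup>2) * esum (\<lambda>k. (q k)\<^sup>2)"
  have e: "econv p q r n = esum (\<lambda>c. esum (\<lambda>b. p (n + b - c) * q b) * r c)"
    unfolding econv_def by (subst esum_swap) (simp add: esum_multc)
  have cs: "(esum (\<lambda>b. p (n + b - c) * q b))\<^sup>2 \<le> S" for c
  proof -
    have "(esum (\<lambda>b. p (n + b - c) * q b))\<^sup>2 \<le> esum (\<lambda>b. (p (n + b - c))\<^sup>2) * esum (\<lambda>k. (q k)\<^sup>2)"
      by (rule Cauchy_Schwarz_nn_integral) auto
    also have "esum (\<lambda>b. (p (n + b - c))\<^sup>2) = esum (\<lambda>k. (p k)\<^sup>2)"
      using esum_shift[of "\<lambda>k. (p k)\<^sup>2" "n - c"] by (simp add: algebra_simps)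
    finally show ?thesis by (simp add: S_def)
  qed
  have "(econv p q r n)\<^sup>2 \<le> S * (esum r)\<^sup>2"
  proof -
    have "(econv p q r n)\<^sup>2 = esum (\<lambda>c. esum (\<lambda>d. (esum (\<lambda>b. p (n + b - c) * q b) * r c) * (esum (\<lambda>b. p (n + b - d) * q b) * r d)))"
      unfolding e power2_eq_square by (simp add: esum_multc esum_cmult)
    also have "\<dots> \<le> esum (\<lambda>c. esum (\<lambda>d. S * (r c * r d)))"
    proof (intro nn_integral_mono)
      fix c d
      have "esum (\<lambda>b. p (n + b - c) * q b) * esum (\<lambda>b. p (n + b - d) * q b) \<le> S"
      proof (cases "esum (\<lambda>b. p (n + b - c) * q b) \<le> esum (\<lambda>b. p (n + b - d) * q b)")
        case True
        then show ?thesis using cs[of d] unfolding power2_eq_square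
          by (meson mult_right_mono order_trans zero_le)
      next
        case False
        then show ?thesis using cs[of c] unfolding power2_eq_square
          by (meson linear mult_left_mono order_trans zero_le)
      qed
      then show "(esum (\<lambda>b. p (n + b - c) * q b) * r c) * (esum (\<lambda>b. p (n + b - d) * q b) * r d) \<le> S * (r c * r d)"
        by (metis (no_types, lifting) mult.assoc mult.left_commute mult_right_mono zero_le)
    qed
    also have "\<dots> = S * (esum r)\<^sup>2"
      by (simp add: esum_cmult esum_multc power2_eq_square)
    finally show ?thesis .
  qed
  then show ?thesis by (simp add: S_def)
qed

lemma econv_sup_bound1: "(econv p q r n)\<^sup>2 \<le> (esum p)\<^sup>2 * esum (\<lambda>k. (q k)\<^sup>2) * esum (\<lambda>k. (r k)\<^sup>2)"
  using econv_sup_bound3[of r q p n] by (simp add: econv_swap13[of p q r] mult_ac)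

lemma econv_sup_bound2: "(econv p q r n)\<^sup>2 \<le> esum (\<lambda>k. (p k)\<^sup>2) * (esum q)\<^sup>2 * esum (\<lambda>k. (r k)\<^sup>2)"
  using econv_sup_bound1[of "\<lambda>k. q (- k)" "\<lambda>k. p (- k)" r n] 
  by (simp add: econv_swap12[of p q r] esum_reflect0[of q] esum_reflect0[of "\<lambda>k. (p k)\<^sup>2"] mult_ac)

lemma ennreal_power2_le_imp_le:
  fixes x y :: ennreal
  assumes "x\<^sup>2 \<le> y\<^sup>2"
  shows "x \<le> y"
proof (cases y)
  case (real b)
  then have "x \<noteq> top" using assms by (auto simp: power2_eq_square ennreal_mult[symmetric] ennreal_top_mult top_unique)
  then obtain a where a: "a \<ge> 0" "x = ennreal a" by (cases x) auto
  with assms real have "a\<^sup>2 \<le> b\<^sup>2" by (simp add: ennreal_power)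
  with a real show ?thesis using power2_le_imp_le by (auto intro!: ennreal_leI)
qed simp

text \<open>Young's inequality: convolving an l2 sequence with two l1 sequences stays in l2. The
  square is expanded into a fivefold sum and the sum over \<open>n\<close> is moved innermost, where
  Cauchy-Schwarz and translation invariance remove the dependence on the four shifts.\<close>

lemma econv_l2_bound1: "esum (\<lambda>n. (econv p q r n)\<^sup>2) \<le> esum (\<lambda>k. (p k)\<^sup>2) * (esum q)\<^sup>2 * (esum r)\<^sup>2"
proof -
  have *: "esum (\<lambda>n. p (n + b - c) * p (n + b' - c')) \<le> esum (\<lambda>k. (p k)\<^sup>2)" for b c b' c'
  proof -
    have "(esum (\<lambda>n. p (n + b - c) * p (n + b' - c')))\<^sup>2 
        \<le> esum (\<lambda>n. (p (n + b - c))\<^sup>2) * esum (\<lambda>n. (p (n + b' - c'))\<^sup>2)"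
      by (rule Cauchy_Schwarz_nn_integral) auto
    also have "\<dots> = (esum (\<lambda>k. (p k)\<^sup>2))\<^sup>2"
      using esum_shift[of "\<lambda>k. (p k)\<^sup>2" "b - c"] esum_shift[of "\<lambda>k. (p k)\<^sup>2" "b' - c'"] 
      by (simp add: algebra_simps power2_eq_square)
    finally show ?thesis by (rule ennreal_power2_le_imp_le)
  qed
  have "esum (\<lambda>n. (econv p q r n)\<^sup>2) = 
    esum (\<lambda>n. esum (\<lambda>b. esum (\<lambda>c. esum (\<lambda>b'. esum (\<lambda>c'. (p (n + b - c) * p (n + b' - c')) * (q b * r c * q b' * r c'))))))"
  proof -
    have "(p (n + b - c) * p (n + b' - c')) * (q b * r c * q b' * r c')
      = (p (n + b - c) * q b * r c) * (p (n + b' - c') * q b' * r c')" for n b c b' c'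
      by (simp add: mult_ac)
    then show ?thesis by (simp only: econv_def power2_eq_square esum_cmult esum_multc)
  qed
  also have "\<dots> = esum (\<lambda>b. esum (\<lambda>n. esum (\<lambda>c. esum (\<lambda>b'. esum (\<lambda>c'. (p (n + b - c) * p (n + b' - c')) * (q b * r c * q b' * r c'))))))"
    by (rule esum_swap)
  also have "\<dots> = esum (\<lambda>b. esum (\<lambda>c. esum (\<lambda>n. esum (\<lambda>b'. esum (\<lambda>c'. (p (n + b - c) * p (n + b' - c')) * (q b * r c * q b' * r c'))))))"
    by (intro nn_integral_cong esum_swap)
  also have "\<dots> = esum (\<lambda>b. esum (\<lambda>c. esum (\<lambda>b'. esum (\<lambda>n. esum (\<lambda>c'. (p (n + b - c) * p (n + b' - c')) * (q b * r c * q b' * r c'))))))"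
    by (intro nn_integral_cong esum_swap)
  also have "\<dots> = esum (\<lambda>b. esum (\<lambda>c. esum (\<lambda>b'. esum (\<lambda>c'. esum (\<lambda>n. (p (n + b - c) * p (n + b' - c')) * (q b * r c * q b' * r c'))))))"
    by (intro nn_integral_cong esum_swap)
  also have "\<dots> \<le> esum (\<lambda>b. esum (\<lambda>c. esum (\<lambda>b'. esum (\<lambda>c'. esum (\<lambda>k. (p k)\<^sup>2) * (q b * r c * q b' * r c')))))"
    by (intro nn_integral_mono) (simp only: esum_multc, intro mult_right_mono * zero_le)
  also have "\<dots> = esum (\<lambda>k. (p k)\<^sup>2) * (esum q)\<^sup>2 * (esum r)\<^sup>2"
    by (simp add: esum_cmult esum_multc power2_eq_square mult_ac)
  finally show ?thesis .
qed

lemma econv_l2_bound3: "esum (\<lambda>n. (econv p q r n)\<^sup>2) \<le> (esum p)\<^sup>2 * (esum q)\<^sup>2 * esum (\<lambda>k. (r k)\<^sup>2)"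
  using econv_l2_bound1[of r q p] by (simp add: econv_swap13[of p q r] mult_ac)

lemma econv_l2_bound2: "esum (\<lambda>n. (econv p q r n)\<^sup>2) \<le> (esum p)\<^sup>2 * esum (\<lambda>k. (q k)\<^sup>2) * (esum r)\<^sup>2"
  using econv_l2_bound1[of "\<lambda>k. q (- k)" "\<lambda>k. p (- k)" r] 
  by (simp add: econv_swap12[of p q r] esum_reflect0[of p] esum_reflect0[of "\<lambda>k. (q k)\<^sup>2"] mult_ac)

section \<open>Sobolev norms\<close>

text \<open>The symbol of 1 - d_x^2: the H^s weights are its powers, and the real part of
  \<open>symb\<close> is affine in it.\<close>

definition kap :: "int \<Rightarrow> real" where "kap n = (real_of_int n)\<^sup>2 + 1"

lemma kap_ge_1 [simp]: "1 \<le> kap n" and kap_pos [simp]: "0 < kap n"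
  by (auto simp: kap_def add_nonneg_pos)

lemma kap_nonneg [simp]: "0 \<le> kap n"
  by (rule less_imp_le) simp

lemma kap_nonzero [simp]: "kap n \<noteq> 0"
  using kap_pos[of n] by (metis less_irrefl)

lemma kap_powr_sq: "(kap n powr s)\<^sup>2 = kap n powr (2 * s)"
  by (simp add: power2_eq_square flip: powr_add)

lemma Hs_weight_kap: "Hs_weight s v n = kap n powr s * (cmod (v n))\<^sup>2"
  by (simp add: Hs_weight_def kap_def)

lemma Hs_weight_nonneg [simp]: "0 \<le> Hs_weight s v n"
  by (simp add: Hs_weight_def)

lemma Hs_weight_0 [simp]: "Hs_weight 0 v n = (cmod (v n))\<^sup>2"
  using kap_pos[of n] by (simp add: Hs_weight_kap del: kap_pos)

lemma Hs_weight_1: "Hs_weight 1 v n = kap n * (cmod (v n))\<^sup>2"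
  using kap_pos[of n] by (simp add: Hs_weight_kap del: kap_pos)

lemma Hs_norm_sq: "(Hs_norm s v)\<^sup>2 = infsum (Hs_weight s v) UNIV"
  unfolding Hs_norm_def by (simp add: infsum_nonneg)

lemma Hs_norm_nonneg [simp]: "0 \<le> Hs_norm s v"
  unfolding Hs_norm_def by (simp add: infsum_nonneg)

text \<open>Membership and norm bound are always obtained together, from bounds on finite sets of
  modes: a bound on \<open>Hs_norm\<close> alone says nothing, since \<open>infsum\<close> is 0 when
  the series diverges.\<close>

lemma in_HsI_sq:
  assumes "\<And>A. finite A \<Longrightarrow> sum (Hs_weight s v) A \<le> B"
  shows "in_Hs s v" "(Hs_norm s v)\<^sup>2 \<le> B"
  using nonneg_summable_infsum_leI[of "Hs_weight s v" B] assms by (auto simp: in_Hs_def Hs_norm_sq)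

lemma in_HsI:
  assumes "\<And>A. finite A \<Longrightarrow> sum (Hs_weight s v) A \<le> B\<^sup>2" "0 \<le> B"
  shows "in_Hs s v" "Hs_norm s v \<le> B"
  using in_HsI_sq[of s v "B\<^sup>2"] assms power2_le_imp_le by blast+

lemma sum_Hs_weight_le:
  assumes "in_Hs s v" "finite A"
  shows "sum (Hs_weight s v) A \<le> (Hs_norm s v)\<^sup>2"
  unfolding Hs_norm_sq using assms by (intro nonneg_sum_le_infsum) (auto simp: in_Hs_def)

lemma Hs_weight_le:
  assumes "in_Hs s v"
  shows "Hs_weight s v n \<le> (Hs_norm s v)\<^sup>2"
  using sum_Hs_weight_le[OF assms, of "{n}"] by simp

lemma in_Hs_mono:
  assumes "in_Hs s v" "r \<le> s"
  shows "in_Hs r v" "Hs_norm r v \<le> Hs_norm s v"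
proof -
  have "sum (Hs_weight r v) A \<le> (Hs_norm s v)\<^sup>2" if "finite A" for A
  proof -
    have "sum (Hs_weight r v) A \<le> sum (Hs_weight s v) A"
      unfolding Hs_weight_kap using assms by (intro sum_mono mult_right_mono powr_mono) auto
    also have "\<dots> \<le> (Hs_norm s v)\<^sup>2" by (rule sum_Hs_weight_le) fact+
    finally show ?thesis .
  qed
  then show "in_Hs r v" "Hs_norm r v \<le> Hs_norm s v" using in_HsI[of r v "Hs_norm s v"] by auto
qed

text \<open>Minkowski's inequality in domination form, so that one proof serves differences,
  telescoped differences and the reverse triangle inequality.\<close>

lemma Hs_dominated:
  assumes "in_Hs s u" "in_Hs s v" "\<And>n. cmod (w n) \<le> cmod (u n) + cmod (v n)"
  shows "in_Hs s w" "Hs_norm s w \<le> Hs_norm s u + Hs_norm s v"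
proof -
  define f where "f z n = kap n powr (s/2) * cmod (z n)" for z :: "int \<Rightarrow> complex" and n
  have fw: "Hs_weight s z n = (f z n)\<^sup>2" for z n
    by (simp add: Hs_weight_kap f_def power_mult_distrib kap_powr_sq)
  have L: "L2_set (f z) A \<le> Hs_norm s z" if "in_Hs s z" "finite A" for z A
    using sum_Hs_weight_le[OF that] unfolding L2_set_def fw by (intro real_le_lsqrt) auto
  have "sum (Hs_weight s w) A \<le> (Hs_norm s u + Hs_norm s v)\<^sup>2" if A: "finite A" for A
  proof -
    have "L2_set (f w) A \<le> L2_set (\<lambda>n. f u n + f v n) A"
    proof (rule L2_set_mono)
      fix n
      have "f w n \<le> kap n powr (s/2) * (cmod (u n) + cmod (v n))"
        unfolding f_def by (intro mult_left_mono assms) auto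
      then show "f w n \<le> f u n + f v n" by (simp add: f_def algebra_simps)
    qed (simp add: f_def)
    also have "\<dots> \<le> L2_set (f u) A + L2_set (f v) A" by (rule L2_set_triangle_ineq)
    also have "\<dots> \<le> Hs_norm s u + Hs_norm s v" using L A assms by (intro add_mono) auto
    finally have "(L2_set (f w) A)\<^sup>2 \<le> (Hs_norm s u + Hs_norm s v)\<^sup>2" by (rule power_mono) simp
    then show ?thesis by (simp add: L2_set_def fw sum_nonneg)
  qed
  then show "in_Hs s w" "Hs_norm s w \<le> Hs_norm s u + Hs_norm s v"
    using in_HsI[of s w "Hs_norm s u + Hs_norm s v"] by auto
qed

lemma Hs_diff:
  assumes "in_Hs s u" "in_Hs s v"
  shows "in_Hs s (u - v)" "Hs_norm s (u - v) \<le> Hs_norm s u + Hs_norm s v"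
  using Hs_dominated[OF assms, of "u - v"] by (auto simp: norm_triangle_ineq4)

lemma Hs_norm_diff_commute: "Hs_norm s (u - v) = Hs_norm s (v - u)"
  unfolding Hs_norm_def Hs_weight_def by (simp add: norm_minus_commute)

lemma Hs_norm_diff_triangle:
  assumes "in_Hs s (u - v)" "in_Hs s (v - w)"
  shows "Hs_norm s (u - w) \<le> Hs_norm s (u - v) + Hs_norm s (v - w)"
proof (rule Hs_dominated(2)[OF assms])
  fix n show "cmod ((u - w) n) \<le> cmod ((u - v) n) + cmod ((v - w) n)"
    using norm_triangle_ineq[of "u n - v n" "v n - w n"] by simp
qed

lemma in_Hs_diff_trans:
  assumes "in_Hs s (u - v)" "in_Hs s (v - w)"
  shows "in_Hs s (u - w)"
proof (rule Hs_dominated(1)[OF assms])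
  fix n show "cmod ((u - w) n) \<le> cmod ((u - v) n) + cmod ((v - w) n)"
    using norm_triangle_ineq[of "u n - v n" "v n - w n"] by simp
qed

lemma Hs_norm_le_diff:
  assumes "in_Hs s u" "in_Hs s v"
  shows "Hs_norm s u \<le> Hs_norm s (u - v) + Hs_norm s v"
proof (rule Hs_dominated(2)[OF Hs_diff(1)[OF assms] assms(2)])
  fix n show "cmod (u n) \<le> cmod ((u - v) n) + cmod (v n)"
    using norm_triangle_ineq[of "u n - v n" "v n"] by simp
qed

lemma cmod_le_Hs_norm: 
  assumes "in_Hs s v" "0 \<le> s"
  shows "cmod (v n) \<le> Hs_norm s v"
proof -
  have "(cmod (v n))\<^sup>2 \<le> (Hs_norm 0 v)\<^sup>2" using Hs_weight_le[of 0 v n] in_Hs_mono(1)[OF assms] by simp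
  then have "cmod (v n) \<le> Hs_norm 0 v" by (rule power2_le_imp_le) simp
  with in_Hs_mono(2)[OF assms] show ?thesis by simp
qed

text \<open>Cauchy-Schwarz between the weights of orders 0 and 2s. It upgrades convergence in H to
  convergence in H^s whenever H^(2s) norms stay bounded, as they do after smoothing.\<close>

lemma Hs_norm_interpolate:
  assumes "in_Hs (2 * s) v" "0 \<le> s"
  shows "(Hs_norm s v)\<^sup>2 \<le> Hs_norm 0 v * Hs_norm (2 * s) v"
proof (rule in_HsI_sq(2))
  fix A :: "int set" assume A: "finite A"
  have "(sum (Hs_weight s v) A)\<^sup>2 = (\<Sum>n\<in>A. cmod (v n) * (kap n powr s * cmod (v n)))\<^sup>2"
    by (simp add: Hs_weight_kap power2_eq_square mult_ac)
  also have "\<dots> \<le> (\<Sum>n\<in>A. (cmod (v n))\<^sup>2) * (\<Sum>n\<in>A. (kap n powr s * cmod (v n))\<^sup>2)"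
    by (rule Cauchy_Schwarz_ineq_sum)
  also have "\<dots> = sum (Hs_weight 0 v) A * sum (Hs_weight (2 * s) v) A"
  proof -
    have "(kap n powr s * cmod (v n))\<^sup>2 = Hs_weight (2 * s) v n" for n
      by (simp add: Hs_weight_kap power_mult_distrib kap_powr_sq)
    then show ?thesis by simp
  qed
  also have "\<dots> \<le> (Hs_norm 0 v)\<^sup>2 * (Hs_norm (2 * s) v)\<^sup>2"
    using A assms in_Hs_mono(1)[OF assms(1), of 0] by (intro mult_mono sum_Hs_weight_le) (auto intro: sum_nonneg)
  finally show "sum (Hs_weight s v) A \<le> Hs_norm 0 v * Hs_norm (2 * s) v"
    unfolding power_mult_distrib[symmetric] by (rule power2_le_imp_le) simp
qed

section \<open>Absolutely summable Fourier coefficients and Agmon's inequality\<close>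

lemma l1_nonneg [simp]: "0 \<le> l1 v"
  unfolding l1_def by (simp add: infsum_nonneg)

lemma in_l1I:
  assumes "\<And>A. finite A \<Longrightarrow> (\<Sum>n\<in>A. cmod (v n)) \<le> B"
  shows "in_l1 v" "l1 v \<le> B"
  unfolding in_l1_def l1_def
  using nonneg_summable_infsum_leI[of "\<lambda>n. cmod (v n)" B] assms by simp_all

lemma sum_cmod_le_l1:
  assumes "in_l1 v" "finite A"
  shows "(\<Sum>n\<in>A. cmod (v n)) \<le> l1 v"
  using assms unfolding in_l1_def l1_def by (intro nonneg_sum_le_infsum) auto

lemma cmod_le_l1: "in_l1 v \<Longrightarrow> cmod (v n) \<le> l1 v"
  using sum_cmod_le_l1[of v "{n}"] by simp

lemma l1_dominated:
  assumes "in_l1 u" "in_l1 v" "\<And>n. cmod (w n) \<le> cmod (u n) + cmod (v n)"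
  shows "in_l1 w" "l1 w \<le> l1 u + l1 v"
proof -
  have "(\<Sum>n\<in>A. cmod (w n)) \<le> l1 u + l1 v" if "finite A" for A
  proof -
    have "(\<Sum>n\<in>A. cmod (w n)) \<le> (\<Sum>n\<in>A. cmod (u n)) + (\<Sum>n\<in>A. cmod (v n))"
      unfolding sum.distrib[symmetric] by (intro sum_mono assms)
    also have "\<dots> \<le> l1 u + l1 v" using assms that by (intro add_mono sum_cmod_le_l1)
    finally show ?thesis .
  qed
  then show "in_l1 w" "l1 w \<le> l1 u + l1 v" by (auto intro: in_l1I)
qed

lemma l1_diff:
  assumes "in_l1 u" "in_l1 v"
  shows "in_l1 (u - v)" "l1 (u - v) \<le> l1 u + l1 v"
  using l1_dominated[OF assms, of "u - v"] by (auto simp: norm_triangle_ineq4)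

lemma l1_diff_commute: "l1 (u - v) = l1 (v - u)"
  unfolding l1_def by (simp add: norm_minus_commute)

lemma l1_le_diff:
  assumes "in_l1 u" "in_l1 v"
  shows "l1 u \<le> l1 (u - v) + l1 v"
proof (rule l1_dominated(2)[OF l1_diff(1)[OF assms] assms(2)])
  fix n show "cmod (u n) \<le> cmod ((u - v) n) + cmod (v n)"
    using norm_triangle_ineq[of "u n - v n" "v n"] by simp
qed

lemma abs_l1_diff_le:
  assumes "in_l1 u" "in_l1 v"
  shows "\<bar>l1 u - l1 v\<bar> \<le> l1 (u - v)"
  using l1_le_diff[OF assms] l1_le_diff[OF assms(2,1)] l1_diff_commute[of u v] by auto

lemma in_l1_imp_Hs0:
  assumes "in_l1 v"
  shows "in_Hs 0 v" "Hs_norm 0 v \<le> l1 v"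
proof -
  have "sum (Hs_weight 0 v) A \<le> (l1 v)\<^sup>2" if "finite A" for A
  proof -
    have "(\<Sum>n\<in>A. (cmod (v n))\<^sup>2) \<le> (\<Sum>n\<in>A. l1 v * cmod (v n))"
      unfolding power2_eq_square by (intro sum_mono mult_right_mono cmod_le_l1 assms) auto
    also have "\<dots> = l1 v * (\<Sum>n\<in>A. cmod (v n))" by (simp add: sum_distrib_left)
    also have "\<dots> \<le> l1 v * l1 v" by (intro mult_left_mono sum_cmod_le_l1 assms that) auto
    finally show ?thesis by (simp add: power2_eq_square)
  qed
  then show "in_Hs 0 v" "Hs_norm 0 v \<le> l1 v" using in_HsI[of 0 v "l1 v"] by auto
qed

text \<open>On a half line, m^2 + k^2 is at least (m+k)^2 / 2, and lowering (m+k)^2 by 1/4 makes the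
  reciprocals telescope in half-integer steps. Since 1 \<le> m, each half line contributes at most 2
  / (m - 1/2) \<le> 4 / m; counting k = 0 twice is harmless.\<close>

lemma sum_inverse_shifted_squares:
  fixes m :: real
  assumes "1 \<le> m" "finite A"
  shows "(\<Sum>n\<in>A. 1 / (m\<^sup>2 + (real_of_int n)\<^sup>2)) \<le> 8 / m"
proof -
  define f where "f n = 1 / (m\<^sup>2 + (real_of_int n)\<^sup>2)" for n
  have fnn: "0 \<le> f n" for n by (simp add: f_def)
  have f2: "f (int k) \<le> 2 * (1 / (m + real k - 1/2) - 1 / (m + real k + 1/2))" for k
  proof -
    define x where "x = m + real k"
    have x: "1 \<le> x" using assms by (simp add: x_def)
    have "x\<^sup>2 \<le> 2 * (m\<^sup>2 + (real k)\<^sup>2)"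
      unfolding x_def using sum_squares_bound[of m "real k"] by (simp add: power2_sum)
    then have x2': "x\<^sup>2 / 2 \<le> m\<^sup>2 + (real k)\<^sup>2" by simp
    have x2: "1 \<le> x\<^sup>2" using x by simp
    have "1 / (m\<^sup>2 + (real k)\<^sup>2) \<le> 1 / (x\<^sup>2 / 2)"
      by (rule divide_left_mono[OF x2' _ mult_pos_pos]) (use x2 x2' in linarith)+
    then have "f (int k) \<le> 2 / x\<^sup>2" by (simp add: f_def)
    also have "\<dots> \<le> 2 / (x\<^sup>2 - 1/4)"
      using x2 by (intro divide_left_mono mult_pos_pos) auto
    also have "\<dots> = 2 * (1 / (x - 1/2) - 1 / (x + 1/2))"
    proof -
      have e: "x\<^sup>2 - 1/4 = (x - 1/2) * (x + 1/2)" by (simp add: power2_eq_square algebra_simps)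
      have "x - 1/2 \<noteq> 0" "x + 1/2 \<noteq> 0" using x by auto
      then show ?thesis unfolding e by (simp add: diff_divide_eq_iff divide_diff_eq_iff)
    qed
    finally show ?thesis by (simp add: x_def)
  qed
  have tele: "(\<Sum>k\<le>N. f (int k)) \<le> 2 * (1 / (m - 1/2) - 1 / (m + real N + 1/2))" for N
  proof (induction N)
    case 0 then show ?case using f2[of 0] by simp
  next
    case (Suc N)
    have "(\<Sum>k\<le>Suc N. f (int k)) \<le> 2 * (1 / (m - 1/2) - 1 / (m + real N + 1/2)) + 2 * (1 / (m + real (Suc N) - 1/2) - 1 / (m + real (Suc N) + 1/2))"
      using Suc f2[of "Suc N"] by simp
    also have "m + real (Suc N) - 1/2 = m + real N + 1/2" by simp
    finally show ?case by (simp add: algebra_simps)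
  qed
  have half: "(\<Sum>k\<le>N. f (int k)) \<le> 4 / m" for N
  proof -
    have "(\<Sum>k\<le>N. f (int k)) \<le> 2 * (1 / (m - 1/2))"
    proof -
      have "0 \<le> 1 / (m + real N + 1/2)" using assms by simp
      then have "2 * (1 / (m - 1/2) - 1 / (m + real N + 1/2)) \<le> 2 * (1 / (m - 1/2))" by (intro mult_left_mono) auto
      then show ?thesis using tele[of N] by (rule order_trans[rotated])
    qed
    also have "\<dots> \<le> 4 / m" using assms by (simp add: field_simps)
    finally show ?thesis .
  qed
  obtain N :: nat where N: "\<And>n. n \<in> A \<Longrightarrow> \<bar>n\<bar> \<le> int N"
  proof
    fix n assume "n \<in> A"
    then have "\<bar>n\<bar> \<le> Max (abs ` A)" using assms(2) by (intro Max_ge) auto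
    then show "\<bar>n\<bar> \<le> int (nat (Max (abs ` A)))" by linarith
  qed
  have sub: "A \<subseteq> int ` {..N} \<union> (\<lambda>k. - int k) ` {..N}"
  proof
    fix n assume "n \<in> A"
    with N[of n] show "n \<in> int ` {..N} \<union> (\<lambda>k. - int k) ` {..N}"
      by (cases "n \<ge> 0") (auto simp: image_iff intro: bexI[of _ "nat \<bar>n\<bar>"])
  qed
  have "sum f A \<le> sum f (int ` {..N} \<union> (\<lambda>k. - int k) ` {..N})"
    by (rule sum_mono2) (use sub fnn in auto)
  also have "\<dots> \<le> sum f (int ` {..N}) + sum f ((\<lambda>k. - int k) ` {..N})"
    by (subst sum_Un) (auto intro!: sum_nonneg fnn)
  also have "\<dots> = (\<Sum>k\<le>N. f (int k)) + (\<Sum>k\<le>N. f (- int k))"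
    by (subst (1 2) sum.reindex) (auto simp: inj_on_def)
  also have "\<dots> = (\<Sum>k\<le>N. f (int k)) + (\<Sum>k\<le>N. f (int k))" by (simp add: f_def)
  also have "\<dots> \<le> 8 / m" using half[of N] by simp
  finally show ?thesis by (simp add: f_def)
qed

text \<open>Cauchy-Schwarz with the weights m^2 + n^2, where the scale m is left free until the two
  resulting terms can be balanced.\<close>

lemma agmon:
  assumes v: "in_Hs 1 v"
  shows in_Hs1_imp_l1: "in_l1 v" and l1_sq_le: "(l1 v)\<^sup>2 \<le> 16 * Hs_norm 0 v * Hs_norm 1 v"
proof -
  define a b where "a = Hs_norm 0 v" and "b = Hs_norm 1 v"
  have v0: "in_Hs 0 v" and ab: "a \<le> b" using in_Hs_mono[OF v, of 0] by (auto simp: a_def b_def)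
  have a0: "0 \<le> a" by (simp add: a_def)
  have key: "(\<Sum>n\<in>A. cmod (v n)) \<le> sqrt (16 * a * b)" if A: "finite A" for A
  proof (cases "a = 0")
    case True
    have "cmod (v n) = 0" for n using cmod_le_Hs_norm[OF v0, of n] True by (simp add: a_def)
    then show ?thesis using True by simp
  next
    case False
    \<comment> \<open>This scale makes m^2 a^2 equal to b^2, so the bound becomes (8 / m) * 2 b^2 =
      16 a b. It is at least 1 because the H norm is below the H^1 norm.\<close>
    define m where "m = b / a"
    have m1: "1 \<le> m" using False a0 ab by (simp add: m_def)
    have mp: "m\<^sup>2 + (real_of_int n)\<^sup>2 > 0" for n using m1 by (simp add: add_pos_nonneg)
    have "(\<Sum>n\<in>A. cmod (v n))\<^sup>2 = (\<Sum>n\<in>A. (1 / sqrt (m\<^sup>2 + (real_of_int n)\<^sup>2)) * (sqrt (m\<^sup>2 + (real_of_int n)\<^sup>2) * cmod (v n)))\<^sup>2"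
    proof -
      have "sqrt (m\<^sup>2 + (real_of_int n)\<^sup>2) \<noteq> 0" for n using m1 by simp
      then show ?thesis by simp
    qed
    also have "\<dots> \<le> (\<Sum>n\<in>A. (1 / sqrt (m\<^sup>2 + (real_of_int n)\<^sup>2))\<^sup>2) * (\<Sum>n\<in>A. (sqrt (m\<^sup>2 + (real_of_int n)\<^sup>2) * cmod (v n))\<^sup>2)"
      by (rule Cauchy_Schwarz_ineq_sum)
    also have "\<dots> = (\<Sum>n\<in>A. 1 / (m\<^sup>2 + (real_of_int n)\<^sup>2)) * (\<Sum>n\<in>A. (m\<^sup>2 + (real_of_int n)\<^sup>2) * (cmod (v n))\<^sup>2)"
      using mp by (simp add: power_divide power_mult_distrib less_imp_le)
    also have "\<dots> \<le> (8 / m) * (m\<^sup>2 * a\<^sup>2 + b\<^sup>2)"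
    proof (rule mult_mono)
      have "(\<Sum>n\<in>A. (m\<^sup>2 + (real_of_int n)\<^sup>2) * (cmod (v n))\<^sup>2) \<le> (\<Sum>n\<in>A. m\<^sup>2 * Hs_weight 0 v n + Hs_weight 1 v n)"
        by (intro sum_mono) (simp add: Hs_weight_1 kap_def algebra_simps)
      also have "\<dots> = m\<^sup>2 * sum (Hs_weight 0 v) A + sum (Hs_weight 1 v) A"
        by (simp add: sum.distrib sum_distrib_left)
      also have "\<dots> \<le> m\<^sup>2 * a\<^sup>2 + b\<^sup>2"
        using sum_Hs_weight_le[OF v0 A] sum_Hs_weight_le[OF v A] by (intro add_mono mult_left_mono) (auto simp: a_def b_def)
      finally show "(\<Sum>n\<in>A. (m\<^sup>2 + (real_of_int n)\<^sup>2) * (cmod (v n))\<^sup>2) \<le> m\<^sup>2 * a\<^sup>2 + b\<^sup>2" .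
    qed (use sum_inverse_shifted_squares[OF m1 A] m1 in \<open>auto intro!: sum_nonneg\<close>)
    also have "\<dots> = 16 * a * b" using False a0 ab by (simp add: m_def field_simps power2_eq_square)
    finally show ?thesis by (rule real_le_rsqrt)
  qed
  then show "in_l1 v" by (rule in_l1I)
  have "l1 v \<le> sqrt (16 * a * b)" using key by (rule in_l1I)
  then have "(l1 v)\<^sup>2 \<le> (sqrt (16 * a * b))\<^sup>2" by (rule power_mono) simp
  then show "(l1 v)\<^sup>2 \<le> 16 * Hs_norm 0 v * Hs_norm 1 v" using a0 ab by (simp add: a_def b_def)
qed

section \<open>The cubic term\<close>

abbreviation em :: "(int \<Rightarrow> complex) \<Rightarrow> int \<Rightarrow> ennreal" where
  "em u \<equiv> \<lambda>k. ennreal (cmod (u k))"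

lemma esum_em: "in_l1 u \<Longrightarrow> esum (em u) = ennreal (l1 u)"
  unfolding in_l1_def l1_def by (rule nn_integral_eq_infsum) auto

lemma esum_Hs:
  assumes "in_Hs s u"
  shows "esum (\<lambda>k. (ennreal (kap k powr (s/2) * cmod (u k)))\<^sup>2) = ennreal ((Hs_norm s u)\<^sup>2)"
proof -
  have "(ennreal (kap k powr (s/2) * cmod (u k)))\<^sup>2 = ennreal (Hs_weight s u k)" for k
    by (simp add: ennreal_power power_mult_distrib kap_powr_sq Hs_weight_kap)
  then show ?thesis using nn_integral_eq_infsum[of "Hs_weight s u"] assms
    by (simp add: in_Hs_def Hs_norm_sq)
qed

lemma esum_em_sq:
  assumes "in_Hs 0 u"
  shows "esum (\<lambda>k. (em u k)\<^sup>2) = ennreal ((Hs_norm 0 u)\<^sup>2)"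
proof -
  have "kap k powr 0 = 1" for k using kap_pos[of k] by (simp del: kap_pos)
  then show ?thesis using esum_Hs[OF assms] by simp
qed

text \<open>Absolute convergence of the double series defining \<open>tri\<close>: its majorant at a
  single \<open>n\<close> is at most the sum over all \<open>n\<close>, which factorises into three
  l1 norms.\<close>

lemma tri_econv:
  assumes "in_l1 u" "in_l1 v" "in_l1 w"
  shows tri_summable: "(\<lambda>(b, c). u (n + b - c) * cnj (v b) * w c) summable_on UNIV"
    and cmod_tri_le_econv: "ennreal (cmod (tri u v w n)) \<le> econv (em u) (em v) (em w) n"
proof -
  define f where "f = (\<lambda>(b, c). u (n + b - c) * cnj (v b) * w c)"
  have e: "esum (\<lambda>x. ennreal (cmod (f x))) = econv (em u) (em v) (em w) n"
    unfolding econv_def nn_integral_fst_count_space[symmetric]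
    by (simp add: f_def norm_mult ennreal_mult)
  also have "\<dots> \<le> esum (econv (em u) (em v) (em w))"
    by (rule nn_integral_ge_point) simp
  also have "\<dots> < \<infinity>"
    using assms by (simp add: esum_econv esum_em ennreal_mult[symmetric])
  finally have s: "(\<lambda>x. cmod (f x)) summable_on UNIV"
    by (subst summable_on_iff_nn_integral) auto
  then show "f summable_on UNIV" by (rule abs_summable_summable)
  have "cmod (infsum f UNIV) \<le> infsum (\<lambda>x. cmod (f x)) UNIV"
    by (rule norm_infsum_bound[OF s])
  then have "ennreal (cmod (infsum f UNIV)) \<le> ennreal (infsum (\<lambda>x. cmod (f x)) UNIV)"
    by (rule ennreal_leI)
  also have "\<dots> = econv (em u) (em v) (em w) n"
    using nn_integral_eq_infsum[OF _ s] e by simp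
  finally show "ennreal (cmod (tri u v w n)) \<le> econv (em u) (em v) (em w) n"
    by (simp add: tri_def f_def)
qed

lemma tri_l1:
  assumes "in_l1 u" "in_l1 v" "in_l1 w"
  shows in_l1_tri: "in_l1 (tri u v w)" and l1_tri_le: "l1 (tri u v w) \<le> l1 u * l1 v * l1 w"
proof -
  have "esum (em (tri u v w)) \<le> esum (econv (em u) (em v) (em w))"
    by (intro nn_integral_mono cmod_tri_le_econv assms)
  also have "\<dots> = ennreal (l1 u * l1 v * l1 w)"
    using assms by (simp add: esum_econv esum_em ennreal_mult)
  finally show "in_l1 (tri u v w)" "l1 (tri u v w) \<le> l1 u * l1 v * l1 w"
    unfolding in_l1_def l1_def[of "tri u v w"]
    using nonneg_summable_nn_leI[of "\<lambda>n. cmod (tri u v w n)" "l1 u * l1 v * l1 w"] by auto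
qed

lemma le_of_ennreal_sq:
  assumes "ennreal x \<le> y" "y\<^sup>2 \<le> ennreal (b\<^sup>2)" "0 \<le> b" "0 \<le> x"
  shows "x \<le> b"
proof -
  have "(ennreal x)\<^sup>2 \<le> ennreal (b\<^sup>2)"
    using power_mono[OF assms(1), of 2] assms(2) by (simp add: order_trans)
  then have "x\<^sup>2 \<le> b\<^sup>2" using assms by (simp add: ennreal_power)
  then show ?thesis using assms(3) by (rule power2_le_imp_le)
qed

text \<open>Whichever slot holds the l1 factor, the other two cost only H norms. In differences of
  cubic terms the l1 norm can thus always be put on the difference.\<close>

lemma cmod_tri_le:
  assumes "in_l1 u" "in_l1 v" "in_l1 w"
  shows cmod_tri_le1: "cmod (tri u v w n) \<le> l1 u * Hs_norm 0 v * Hs_norm 0 w"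
    and cmod_tri_le2: "cmod (tri u v w n) \<le> Hs_norm 0 u * l1 v * Hs_norm 0 w"
    and cmod_tri_le3: "cmod (tri u v w n) \<le> Hs_norm 0 u * Hs_norm 0 v * l1 w"
proof -
  note h = in_l1_imp_Hs0(1)[OF assms(1)] in_l1_imp_Hs0(1)[OF assms(2)] in_l1_imp_Hs0(1)[OF assms(3)]
  show "cmod (tri u v w n) \<le> l1 u * Hs_norm 0 v * Hs_norm 0 w"
    using econv_sup_bound1[of "em u" "em v" "em w" n]
    unfolding esum_em[OF assms(1)] esum_em[OF assms(2)] esum_em[OF assms(3)] esum_em_sq[OF h(1)] esum_em_sq[OF h(2)] esum_em_sq[OF h(3)]
    by (intro le_of_ennreal_sq[OF cmod_tri_le_econv[OF assms]])
       (simp_all add: power_mult_distrib ennreal_power ennreal_mult)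
  show "cmod (tri u v w n) \<le> Hs_norm 0 u * l1 v * Hs_norm 0 w"
    using econv_sup_bound2[of "em u" "em v" "em w" n]
    unfolding esum_em[OF assms(1)] esum_em[OF assms(2)] esum_em[OF assms(3)] esum_em_sq[OF h(1)] esum_em_sq[OF h(2)] esum_em_sq[OF h(3)]
    by (intro le_of_ennreal_sq[OF cmod_tri_le_econv[OF assms]])
       (simp_all add: power_mult_distrib ennreal_power ennreal_mult)
  show "cmod (tri u v w n) \<le> Hs_norm 0 u * Hs_norm 0 v * l1 w"
    using econv_sup_bound3[of "em u" "em v" "em w" n]
    unfolding esum_em[OF assms(1)] esum_em[OF assms(2)] esum_em[OF assms(3)] esum_em_sq[OF h(1)] esum_em_sq[OF h(2)] esum_em_sq[OF h(3)]
    by (intro le_of_ennreal_sq[OF cmod_tri_le_econv[OF assms]])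
       (simp_all add: power_mult_distrib ennreal_power ennreal_mult)
qed

lemma cubic_diff:
  assumes "in_l1 u" "in_l1 v"
  shows "cubic u n - cubic v n = tri (u - v) u u n + tri v (u - v) u n + tri v v (u - v) n"
proof -
  note s = tri_summable[of _ _ _ n]
  have d: "in_l1 (u - v)" using assms by (rule l1_diff)
  have "cubic u n = cubic v n + (tri (u - v) u u n + tri v (u - v) u n + tri v v (u - v) n)"
    unfolding cubic_eq_tri tri_def
  proof (subst infsum_add[symmetric], intro s assms d, intro s assms d,
         subst infsum_add[symmetric], intro summable_on_add s assms d, intro s assms d,
         subst infsum_add[symmetric], intro s assms d, intro summable_on_add s assms d)
  qed (auto intro!: infsum_cong simp: algebra_simps)
  then show ?thesis by simp
qed

lemma cubic_diff_l1:
  assumes "in_l1 u" "in_l1 v" "l1 u \<le> R" "l1 v \<le> R"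
  shows "in_l1 (cubic u - cubic v)" "l1 (cubic u - cubic v) \<le> 3 * R\<^sup>2 * l1 (u - v)"
proof -
  have d: "in_l1 (u - v)" using assms by (intro l1_diff)
  have R: "0 \<le> R" using assms(3) l1_nonneg[of u] by linarith
  have a: "in_l1 (\<lambda>n. tri (u - v) u u n + tri v (u - v) u n)"
    "l1 (\<lambda>n. tri (u - v) u u n + tri v (u - v) u n) \<le> l1 (tri (u - v) u u) + l1 (tri v (u - v) u)"
    using l1_dominated[OF in_l1_tri[OF d assms(1) assms(1)] in_l1_tri[OF assms(2) d assms(1)],
        of "\<lambda>n. tri (u - v) u u n + tri v (u - v) u n"] by (simp_all add: norm_triangle_ineq)
  have b: "in_l1 (cubic u - cubic v)"
    "l1 (cubic u - cubic v) \<le> l1 (\<lambda>n. tri (u - v) u u n + tri v (u - v) u n) + l1 (tri v v (u - v))"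
    using l1_dominated[OF a(1) in_l1_tri[OF assms(2) assms(2) d], of "cubic u - cubic v"] assms
    by (simp_all add: norm_triangle_ineq cubic_diff)
  show "in_l1 (cubic u - cubic v)" by fact
  have "l1 (tri (u - v) u u) \<le> l1 (u - v) * R * R"
    by (rule order_trans[OF l1_tri_le[OF d assms(1,1)]]) (intro mult_mono mult_nonneg_nonneg order_refl l1_nonneg assms R)
  moreover have "l1 (tri v (u - v) u) \<le> R * l1 (u - v) * R"
    by (rule order_trans[OF l1_tri_le[OF assms(2) d assms(1)]]) (intro mult_mono mult_nonneg_nonneg order_refl l1_nonneg assms R)
  moreover have "l1 (tri v v (u - v)) \<le> R * R * l1 (u - v)"
    by (rule order_trans[OF l1_tri_le[OF assms(2) assms(2) d]]) (intro mult_mono mult_nonneg_nonneg order_refl l1_nonneg assms R)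
  ultimately show "l1 (cubic u - cubic v) \<le> 3 * R\<^sup>2 * l1 (u - v)"
    using a(2) b(2) by (simp add: power2_eq_square algebra_simps)
qed

text \<open>The two solutions enter only through their H norms, and this is what makes the Lipschitz
  rate in H depend on H norms alone. The factor 2 generously absorbs the mixed product.\<close>

lemma cubic_diff_sup:
  assumes "in_l1 u" "in_l1 v"
  shows "cmod (cubic u n - cubic v n) \<le> 2 * ((Hs_norm 0 u)\<^sup>2 + (Hs_norm 0 v)\<^sup>2) * l1 (u - v)"
proof -
  define a b where "a = Hs_norm 0 u" and "b = Hs_norm 0 v"
  have d: "in_l1 (u - v)" using assms by (intro l1_diff)
  have "cmod (cubic u n - cubic v n) \<le> l1 (u - v) * a * a + b * l1 (u - v) * a + b * b * l1 (u - v)"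
    unfolding cubic_diff[OF assms] a_def b_def
    by (intro order_trans[OF norm_triangle_ineq] add_mono cmod_tri_le1 cmod_tri_le2 cmod_tri_le3 assms d)
  also have "\<dots> = (a\<^sup>2 + a * b + b\<^sup>2) * l1 (u - v)" by (simp add: power2_eq_square algebra_simps)
  also have "\<dots> \<le> (2 * (a\<^sup>2 + b\<^sup>2)) * l1 (u - v)"
  proof (intro mult_right_mono)
    have "0 \<le> a * b" by (simp add: a_def b_def)
    then show "a\<^sup>2 + a * b + b\<^sup>2 \<le> 2 * (a\<^sup>2 + b\<^sup>2)" using sum_squares_bound[of a b] by simp
  qed simp
  finally show ?thesis by (simp add: a_def b_def)
qed

lemma ennreal_sum3_sq: "(x + y + z :: ennreal)\<^sup>2 \<le> 3 * (x\<^sup>2 + y\<^sup>2 + z\<^sup>2)"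
proof (cases "x = top \<or> y = top \<or> z = top")
  case True
  then show ?thesis by (auto simp: power2_eq_square ennreal_mult_top ennreal_top_mult)
next
  case False
  then obtain a b c where abc: "x = ennreal a" "y = ennreal b" "z = ennreal c" "0 \<le> a" "0 \<le> b" "0 \<le> c"
    by (metis ennreal_cases)
  have "(a + b + c)\<^sup>2 \<le> 3 * (a\<^sup>2 + b\<^sup>2 + c\<^sup>2)"
    using sum_squares_bound[of a b] sum_squares_bound[of a c] sum_squares_bound[of b c]
    by (simp add: power2_eq_square algebra_simps)
  then have "ennreal ((a + b + c)\<^sup>2) \<le> ennreal (3 * (a\<^sup>2 + b\<^sup>2 + c\<^sup>2))" by (rule ennreal_leI)
  moreover have "3 * ennreal (a\<^sup>2 + b\<^sup>2 + c\<^sup>2) = ennreal (3 * (a\<^sup>2 + b\<^sup>2 + c\<^sup>2))"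
    by (subst ennreal_mult) auto
  ultimately show ?thesis using abc by (simp add: ennreal_power flip: ennreal_plus)
qed

text \<open>Comparing with the largest of the three weights treats all exponents s \<ge> 0 alike.
  The base 9 is 3 from squaring a sum of three frequencies times 3 from bounding a sum of three
  weights by the largest.\<close>

lemma kap_powr_conv:
  assumes "0 \<le> s"
  shows "kap (a - b + c) powr s \<le> 9 powr s * (kap a powr s + kap b powr s + kap c powr s)"
proof -
  define m where "m = max (kap a) (max (kap b) (kap c))"
  have "kap (a - b + c) \<le> 3 * (kap a + kap b + kap c)"
  proof -
    define x y z where "x = real_of_int a" and "y = real_of_int b" and "z = real_of_int c"
    have "(x - y + z)\<^sup>2 \<le> 3 * (x\<^sup>2 + y\<^sup>2 + z\<^sup>2)"
      using zero_le_power2[of "x + y"] zero_le_power2[of "y + z"] zero_le_power2[of "x - z"]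
      by (simp add: power2_eq_square algebra_simps)
    then show ?thesis by (simp add: kap_def x_def y_def z_def)
  qed
  also have "\<dots> \<le> 9 * m" by (simp add: m_def)
  finally have "kap (a - b + c) powr s \<le> (9 * m) powr s"
    using assms by (intro powr_mono2) (auto intro: less_imp_le)
  also have "\<dots> = 9 powr s * m powr s" by (rule powr_mult)
  also have "\<dots> \<le> 9 powr s * (kap a powr s + kap b powr s + kap c powr s)"
    by (intro mult_left_mono) (auto simp: m_def max_def)
  finally show ?thesis .
qed

text \<open>The weight, taken to the power s/2, is distributed over the three factors by
  \<open>kap_powr_conv\<close>; each resulting term is a convolution with one weighted factor in l2
  and two factors in l1. The constant is 9^s from the squared weight inequality, 3 from the square
  of a three-term sum and 3 for the number of terms.\<close>

lemma cubic_Hs: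
  assumes u: "in_l1 u" "in_Hs s u" and s: "0 \<le> s"
  shows "in_Hs s (cubic u)" 
    and "(Hs_norm s (cubic u))\<^sup>2 \<le> 9 powr (s + 1) * (l1 u) ^ 4 * (Hs_norm s u)\<^sup>2"
proof -
  define q where "q k = ennreal (kap k powr (s/2) * cmod (u k))" for k
  define K where "K = ennreal (9 powr (s/2))"
  define L where "L = (l1 u)\<^sup>2"
  define B where "B = (Hs_norm s u)\<^sup>2 * L * L"
  have pw: "ennreal (kap n powr (s/2) * cmod (cubic u n))
     \<le> K * (econv q (em u) (em u) n + econv (em u) q (em u) n + econv (em u) (em u) q n)" for n
  proof -
    have "ennreal (kap n powr (s/2) * cmod (cubic u n)) \<le> ennreal (kap n powr (s/2)) * econv (em u) (em u) (em u) n"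
      using cmod_tri_le_econv[OF u(1) u(1) u(1), of n] by (simp add: ennreal_mult cubic_eq_tri mult_left_mono)
    also have "\<dots> = esum (\<lambda>b. esum (\<lambda>c. ennreal (kap n powr (s/2)) * (em u (n + b - c) * em u b * em u c)))"
      by (simp add: econv_def esum_cmult)
    also have "\<dots> \<le> esum (\<lambda>b. esum (\<lambda>c. K * (q (n + b - c) * em u b * em u c + em u (n + b - c) * q b * em u c + em u (n + b - c) * em u b * q c)))"
    proof (intro nn_integral_mono)
      fix b c
      have "kap n powr (s/2) \<le> 9 powr (s/2) * (kap (n + b - c) powr (s/2) + kap b powr (s/2) + kap c powr (s/2))"
        using kap_powr_conv[of "s/2" "n + b - c" b c] s by simp
      then have "kap n powr (s/2) * (cmod (u (n + b - c)) * cmod (u b) * cmod (u c)) \<le> 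
         9 powr (s/2) * (kap (n + b - c) powr (s/2) + kap b powr (s/2) + kap c powr (s/2)) * (cmod (u (n + b - c)) * cmod (u b) * cmod (u c))"
        by (intro mult_right_mono) auto
      then have "ennreal (kap n powr (s/2) * (cmod (u (n + b - c)) * cmod (u b) * cmod (u c))) \<le> 
         ennreal (9 powr (s/2) * ((kap (n + b - c) powr (s/2) * cmod (u (n + b - c))) * cmod (u b) * cmod (u c) 
           + cmod (u (n + b - c)) * (kap b powr (s/2) * cmod (u b)) * cmod (u c)
           + cmod (u (n + b - c)) * cmod (u b) * (kap c powr (s/2) * cmod (u c))))"
        by (intro ennreal_leI) (simp add: algebra_simps)
      then show "ennreal (kap n powr (s/2)) * (em u (n + b - c) * em u b * em u c)
        \<le> K * (q (n + b - c) * em u b * em u c + em u (n + b - c) * q b * em u c + em u (n + b - c) * em u b * q c)"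
        by (simp add: K_def q_def ennreal_mult)
    qed
    also have "\<dots> = K * (econv q (em u) (em u) n + econv (em u) q (em u) n + econv (em u) (em u) q n)"
      by (simp add: econv_def esum_cmult nn_integral_add)
    finally show ?thesis .
  qed
  have q2: "esum (\<lambda>k. (q k)\<^sup>2) = ennreal ((Hs_norm s u)\<^sup>2)"
    using esum_Hs[OF u(2)] by (simp add: q_def)
  have em2: "(esum (em u))\<^sup>2 = ennreal L" using u by (simp add: esum_em ennreal_power L_def)
  have L0: "0 \<le> L" by (simp add: L_def)
  have b1: "esum (\<lambda>n. (econv q (em u) (em u) n)\<^sup>2) \<le> ennreal B"
    using econv_l2_bound1[of q "em u" "em u"] L0 unfolding q2 em2 by (simp add: B_def ennreal_mult)
  have b2: "esum (\<lambda>n. (econv (em u) q (em u) n)\<^sup>2) \<le> ennreal B"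
    using econv_l2_bound2[of "em u" q "em u"] L0 unfolding q2 em2 by (simp add: B_def ennreal_mult mult_ac)
  have b3: "esum (\<lambda>n. (econv (em u) (em u) q n)\<^sup>2) \<le> ennreal B"
    using econv_l2_bound3[of "em u" "em u" q] L0 unfolding q2 em2 by (simp add: B_def ennreal_mult mult_ac)
  have B0: "0 \<le> B" using L0 by (simp add: B_def)
  have "esum (\<lambda>n. ennreal (Hs_weight s (cubic u) n)) = esum (\<lambda>n. (ennreal (kap n powr (s/2) * cmod (cubic u n)))\<^sup>2)"
    by (simp add: ennreal_power power_mult_distrib kap_powr_sq Hs_weight_kap)
  also have "\<dots> \<le> esum (\<lambda>n. (K * (econv q (em u) (em u) n + econv (em u) q (em u) n + econv (em u) (em u) q n))\<^sup>2)"
    by (intro nn_integral_mono power_mono pw) auto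
  also have "\<dots> \<le> esum (\<lambda>n. K\<^sup>2 * (3 * ((econv q (em u) (em u) n)\<^sup>2 + (econv (em u) q (em u) n)\<^sup>2 + (econv (em u) (em u) q n)\<^sup>2)))"
    unfolding power_mult_distrib by (intro nn_integral_mono mult_left_mono ennreal_sum3_sq) auto
  also have "\<dots> = K\<^sup>2 * (3 * (esum (\<lambda>n. (econv q (em u) (em u) n)\<^sup>2) + esum (\<lambda>n. (econv (em u) q (em u) n)\<^sup>2) + esum (\<lambda>n. (econv (em u) (em u) q n)\<^sup>2)))"
    by (simp add: esum_cmult nn_integral_add)
  also have "\<dots> \<le> K\<^sup>2 * (3 * (ennreal B + ennreal B + ennreal B))"
    by (intro mult_left_mono add_mono b1 b2 b3) auto
  also have "\<dots> = ennreal (9 powr (s + 1) * (l1 u) ^ 4 * (Hs_norm s u)\<^sup>2)"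
  proof -
    have "(9 powr (s/2))\<^sup>2 = (9::real) powr s" unfolding power2_eq_square powr_add[symmetric] by simp
    then have "K\<^sup>2 = ennreal (9 powr s)" unfolding K_def by (simp add: ennreal_power)
    moreover have "3 * (ennreal B + ennreal B + ennreal B) = ennreal (9 * B)"
    proof -
      have "ennreal B + ennreal B + ennreal B = ennreal (3 * B)" using B0 by (simp flip: ennreal_plus)
      moreover have "3 * ennreal (3 * B) = ennreal (3 * (3 * B))" using B0 by (subst (2) ennreal_mult) auto
      ultimately show ?thesis by simp
    qed
    ultimately have "K\<^sup>2 * (3 * (ennreal B + ennreal B + ennreal B)) = ennreal (9 powr s * (9 * B))"
      using B0 by (simp add: ennreal_mult)
    also have "9 powr s * (9 * B) = 9 powr (s + 1) * (l1 u) ^ 4 * (Hs_norm s u)\<^sup>2"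
      by (simp add: B_def L_def powr_add power4_eq_xxxx power2_eq_square)
    finally show ?thesis .
  qed
  finally show "in_Hs s (cubic u)" "(Hs_norm s (cubic u))\<^sup>2 \<le> 9 powr (s + 1) * (l1 u) ^ 4 * (Hs_norm s u)\<^sup>2"
    unfolding in_Hs_def Hs_norm_sq[of s "cubic u"]
    using nonneg_summable_nn_leI[of "Hs_weight s (cubic u)" "9 powr (s + 1) * (l1 u) ^ 4 * (Hs_norm s u)\<^sup>2"] by auto
qed

lemma infsum_product_complex:
  fixes f g :: "int \<Rightarrow> complex"
  assumes "(\<lambda>(b, c). f b * g c) summable_on UNIV"
  shows "(\<Sum>\<^sub>\<infinity>(b, c)\<in>UNIV. f b * g c) = infsum f UNIV * infsum g UNIV"
proof -
  have "(\<Sum>\<^sub>\<infinity>(b, c)\<in>UNIV. f b * g c) = (\<Sum>\<^sub>\<infinity>b. \<Sum>\<^sub>\<infinity>c. f b * g c)"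
    using infsum_Sigma'_banach[of "\<lambda>b c. f b * g c" UNIV "\<lambda>_. UNIV"] assms by simp
  also have "\<dots> = infsum f UNIV * infsum g UNIV"
    by (simp add: infsum_cmult_right' infsum_cmult_left')
  finally show ?thesis .
qed

text \<open>This is the identity \<open>\<integral>|u|\<^sup>2u \<cdot> cnj u = \<parallel>|u|\<^sup>2\<parallel>\<^sup>2\<close> on the Fourier side, where \<open>A m\<close> below is the
  \<open>m\<close>-th coefficient of \<open>|u|\<^sup>2\<close>.\<close>
lemma cubic_pairing:
  assumes u: "in_l1 u"
  obtains P where "((\<lambda>n. cubic u n * cnj (u n)) has_sum complex_of_real P) UNIV" "(Hs_norm 0 u) ^ 4 \<le> P"
proof -
  define f where "f = (\<lambda>(n, b, c). u (n + b - c) * cnj (u b) * u c * cnj (u n))"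
  define A where "A m = (\<Sum>\<^sub>\<infinity>b. u (m + b) * cnj (u b))" for m
  have "esum (\<lambda>x. ennreal (cmod (f x))) = esum (\<lambda>n. esum (\<lambda>b. esum (\<lambda>c. ennreal (cmod (f (n, b, c))))))"
    unfolding nn_integral_fst_count_space[symmetric] ..
  also have "\<dots> = esum (\<lambda>n. econv (em u) (em u) (em u) n * em u n)"
    by (simp add: f_def econv_def norm_mult ennreal_mult esum_multc)
  also have "\<dots> \<le> esum (\<lambda>n. econv (em u) (em u) (em u) n * ennreal (l1 u))"
    by (intro nn_integral_mono mult_left_mono ennreal_leI cmod_le_l1 u) auto
  also have "\<dots> < \<infinity>"
    using u by (simp add: esum_multc esum_econv esum_em ennreal_mult[symmetric])
  finally have "(\<lambda>x. cmod (f x)) summable_on UNIV"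
    by (subst summable_on_iff_nn_integral) auto
  then have fs: "f summable_on UNIV" by (rule abs_summable_summable)
  have inner: "(\<Sum>\<^sub>\<infinity>y. f (n, y)) = cubic u n * cnj (u n)" for n
    unfolding f_def cubic_def by (simp add: infsum_cmult_left' case_prod_beta flip: infsum_cmult_left')
  have s1: "(\<lambda>n. cubic u n * cnj (u n)) summable_on UNIV"
    using summable_on_Sigma_banach[of "\<lambda>n y. f (n, y)" UNIV "\<lambda>_. UNIV"] fs by (simp add: inner)
  have e1: "(\<Sum>\<^sub>\<infinity>n. cubic u n * cnj (u n)) = infsum f UNIV"
    using infsum_Sigma_banach[of f UNIV "\<lambda>_. UNIV"] fs by (simp add: inner)
  \<comment> \<open>Substituting n = m + c turns the frequency n + b - c into m + b, so for fixed
    \<open>m\<close> the summand splits into a function of \<open>b\<close> times a function of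
    \<open>c\<close>, and the inner sum becomes \<open>A m * cnj (A m)\<close>.\<close>
  define g where "g = (\<lambda>(m, b, c). (m + c, b, c :: int) :: int \<times> int \<times> int)"
  have bij: "bij_betw g UNIV UNIV"
    by (rule bij_betwI[where g = "\<lambda>(n, b, c). (n - c, b, c)"]) (auto simp: g_def)
  have fg: "f (g (m, b, c)) = (u (m + b) * cnj (u b)) * cnj (u (m + c) * cnj (u c))" for m b c
    by (simp add: f_def g_def algebra_simps)
  have gs: "(\<lambda>x. f (g x)) summable_on UNIV"
    using summable_on_reindex_bij_betw[OF bij] fs by blast
  have e2: "infsum f UNIV = infsum (\<lambda>x. f (g x)) UNIV"
    by (rule infsum_reindex_bij_betw[OF bij, symmetric])
  have eta: "(\<lambda>(m, y). f (g (m, y))) = (\<lambda>x. f (g x))" by auto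
  have slice: "(\<lambda>y. f (g (m, y))) summable_on UNIV" for m
    using summable_on_SigmaD1[of "\<lambda>m y. f (g (m, y))" UNIV "\<lambda>_. UNIV" m] gs by (simp add: eta)
  have inner2: "(\<Sum>\<^sub>\<infinity>y. f (g (m, y))) = complex_of_real ((cmod (A m))\<^sup>2)" for m
  proof -
    have e: "(\<lambda>y. f (g (m, y))) = (\<lambda>(b, c). (u (m + b) * cnj (u b)) * cnj (u (m + c) * cnj (u c)))"
      by (auto simp: fg)
    have "(\<Sum>\<^sub>\<infinity>y. f (g (m, y))) = A m * cnj (A m)"
      unfolding e A_def infsum_cnj[symmetric]
      by (rule infsum_product_complex) (use slice[of m] in \<open>simp only: e\<close>)
    then show ?thesis by (simp only: complex_norm_square)
  qed
  have s2: "(\<lambda>m. complex_of_real ((cmod (A m))\<^sup>2)) summable_on UNIV"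
    using summable_on_Sigma_banach[of "\<lambda>n y. f (g (n, y))" UNIV "\<lambda>_. UNIV"] gs unfolding inner2 by (simp add: eta)
  have e3: "infsum (\<lambda>x. f (g x)) UNIV = (\<Sum>\<^sub>\<infinity>m. complex_of_real ((cmod (A m))\<^sup>2))"
    using infsum_Sigma_banach[of "\<lambda>x. f (g x)" UNIV "\<lambda>_. UNIV"] gs unfolding inner2 by simp
  define P where "P = (\<Sum>\<^sub>\<infinity>m. (cmod (A m))\<^sup>2)"
  have s3: "(\<lambda>m. (cmod (A m))\<^sup>2) summable_on UNIV"
    using summable_on_Re[OF s2] by (simp only: Re_complex_of_real)
  have e4: "(\<Sum>\<^sub>\<infinity>m. complex_of_real ((cmod (A m))\<^sup>2)) = complex_of_real P"
    unfolding P_def by (intro infsumI has_sum_of_real has_sum_infsum s3)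
  \<comment> \<open>The zeroth coefficient is the mean of |u|^2, that is the squared H norm of
    \<open>u\<close>; keeping only it in the nonnegative sum \<open>P\<close> yields the fourth
    power.\<close>
  have "A 0 = (\<Sum>\<^sub>\<infinity>b. complex_of_real ((cmod (u b))\<^sup>2))"
    unfolding A_def by (simp only: complex_norm_square add_0)
  also have "\<dots> = complex_of_real ((Hs_norm 0 u)\<^sup>2)"
  proof (intro infsumI has_sum_of_real)
    have "Hs_weight 0 u = (\<lambda>b. (cmod (u b))\<^sup>2)" by auto
    then show "((\<lambda>b. (cmod (u b))\<^sup>2) has_sum (Hs_norm 0 u)\<^sup>2) UNIV"
      using in_l1_imp_Hs0(1)[OF u] unfolding in_Hs_def Hs_norm_sq by (metis has_sum_infsum)
  qed
  finally have "(cmod (A 0))\<^sup>2 = (Hs_norm 0 u) ^ 4"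
    by (simp only: norm_of_real) simp
  moreover have "(cmod (A 0))\<^sup>2 \<le> P"
    using nonneg_sum_le_infsum[OF _ s3, of "{0}"] by (simp add: P_def)
  ultimately have "(Hs_norm 0 u) ^ 4 \<le> P" by simp
  moreover have "((\<lambda>n. cubic u n * cnj (u n)) has_sum complex_of_real P) UNIV"
    using has_sum_infsum[OF s1] unfolding e1 e2 e3 e4 .
  ultimately show ?thesis using that by blast
qed

section \<open>Energy identities for forced equations\<close>

text \<open>Replaces the net of finite subsets by a sequence, as the monotone and dominated
  convergence theorems require.\<close>

lemma sum_symmetric_tendsto_infsum:
  fixes f :: "int \<Rightarrow> 'a :: {comm_monoid_add, t2_space}"
  assumes "f summable_on UNIV"
  shows "(\<lambda>k. sum f {- int k..int k}) \<longlonglongrightarrow> infsum f UNIV"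
proof -
  have "(sum f \<longlongrightarrow> infsum f UNIV) (finite_subsets_at_top UNIV)"
    using has_sum_infsum[OF assms] by (simp add: has_sum_def)
  moreover have "filterlim (\<lambda>k. {- int k..int k}) (finite_subsets_at_top UNIV) sequentially"
    unfolding filterlim_finite_subsets_at_top
  proof (intro allI impI)
    fix X :: "int set" assume "finite X \<and> X \<subseteq> UNIV"
    then have X: "finite X" by simp
    have "X \<subseteq> {- int k..int k}" if "nat (Max (insert 0 (abs ` X))) \<le> k" for k
    proof
      fix x assume "x \<in> X"
      then have "\<bar>x\<bar> \<le> Max (insert 0 (abs ` X))" using X by (intro Max_ge) auto
      then show "x \<in> {- int k..int k}" using that by auto
    qed
    then show "\<forall>\<^sub>F k in sequentially. finite {- int k..int k} \<and> X \<subseteq> {- int k..int k} \<and> {- int k..int k} \<subseteq> UNIV"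
      unfolding eventually_sequentially by (intro exI[of _ "nat (Max (insert 0 (abs ` X)))"]) auto
  qed
  ultimately show ?thesis by (rule filterlim_compose)
qed

lemma Re_symb: "Re (symb \<gamma> \<beta> L n) = Re \<beta> + 1 - kap n"
  by (simp add: symb_def kap_def power2_eq_square power3_eq_cube)

lemma has_vector_derivative_cmod_sq:
  assumes "(z has_vector_derivative z') (at x within S)"
  shows "((\<lambda>x. (cmod (z x))\<^sup>2) has_vector_derivative 2 * Re (z' * cnj (z x))) (at x within S)"
proof -
  have d: "((\<lambda>x. Re (z x)) has_real_derivative Re z') (at x within S)"
    "((\<lambda>x. Im (z x)) has_real_derivative Im z') (at x within S)"
    using bounded_linear.has_vector_derivative[OF bounded_linear_Re assms]
      bounded_linear.has_vector_derivative[OF bounded_linear_Im assms]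
    by (simp_all add: has_real_derivative_iff_has_vector_derivative)
  have "((\<lambda>x. (Re (z x))\<^sup>2 + (Im (z x))\<^sup>2) has_real_derivative 2 * Re (z' * cnj (z x))) (at x within S)"
    using DERIV_add[OF DERIV_power[OF d(1), of 2] DERIV_power[OF d(2), of 2]] by (simp add: algebra_simps)
  then show ?thesis by (simp add: has_real_derivative_iff_has_vector_derivative cmod_power2)
qed

text \<open>The linear equation with given forcing \<open>F\<close>. Instances are solutions,
  differences of two solutions, and Picard iterates and their differences. Derivatives are asked for
  in the open interval only, since solutions are differentiable for t > 0 while \<open>a\<close> may
  be 0.\<close>

definition forced :: "real \<Rightarrow> complex \<Rightarrow> real \<Rightarrow> (real \<Rightarrow> int \<Rightarrow> complex) \<Rightarrow> (real \<Rightarrow> int \<Rightarrow> complex) \<Rightarrow> real \<Rightarrow> real \<Rightarrow> bool" where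
  "forced \<gamma> \<beta> L U F a t \<longleftrightarrow> (\<forall>n. continuous_on {a..t} (\<lambda>\<tau>. U \<tau> n)) \<and>
     (\<forall>n. \<forall>\<tau>\<in>{a<..<t}. ((\<lambda>\<tau>. U \<tau> n) has_vector_derivative (symb \<gamma> \<beta> L n * U \<tau> n + F \<tau> n)) (at \<tau>))"

lemma forced_mode_sq_deriv:
  assumes "forced \<gamma> \<beta> L U F a t" "\<tau> \<in> {a<..<t}" "(E has_real_derivative E') (at \<tau>)"
  shows "((\<lambda>\<tau>. E \<tau> * (cmod (U \<tau> n))\<^sup>2) has_vector_derivative
     E' * (cmod (U \<tau> n))\<^sup>2 + E \<tau> * (2 * (Re \<beta> + 1 - kap n) * (cmod (U \<tau> n))\<^sup>2 + 2 * Re (F \<tau> n * cnj (U \<tau> n)))) (at \<tau>)"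
proof -
  have "((\<lambda>\<tau>. (cmod (U \<tau> n))\<^sup>2) has_vector_derivative 2 * Re ((symb \<gamma> \<beta> L n * U \<tau> n + F \<tau> n) * cnj (U \<tau> n))) (at \<tau>)"
    using assms by (intro has_vector_derivative_cmod_sq) (auto simp: forced_def)
  moreover have "Re ((symb \<gamma> \<beta> L n * U \<tau> n + F \<tau> n) * cnj (U \<tau> n)) 
     = (Re \<beta> + 1 - kap n) * (cmod (U \<tau> n))\<^sup>2 + Re (F \<tau> n * cnj (U \<tau> n))"
  proof -
    have "(symb \<gamma> \<beta> L n * U \<tau> n + F \<tau> n) * cnj (U \<tau> n) 
      = symb \<gamma> \<beta> L n * complex_of_real ((cmod (U \<tau> n))\<^sup>2) + F \<tau> n * cnj (U \<tau> n)"
      unfolding complex_norm_square by (simp add: algebra_simps)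
    then show ?thesis by (simp add: Re_symb)
  qed
  ultimately have "((\<lambda>\<tau>. (cmod (U \<tau> n))\<^sup>2) has_real_derivative
      2 * (Re \<beta> + 1 - kap n) * (cmod (U \<tau> n))\<^sup>2 + 2 * Re (F \<tau> n * cnj (U \<tau> n))) (at \<tau>)"
    by (simp only: has_real_derivative_iff_has_vector_derivative distrib_left mult.assoc)
  from DERIV_mult[OF assms(3) this] show ?thesis
    by (simp add: has_real_derivative_iff_has_vector_derivative algebra_simps)
qed

text \<open>Parabolic regularity for finitely many modes. The dissipation supplies 2 *
  \<open>kap n\<close>. One half becomes the factor exp(- kap n (t - a)) on the initial value; the
  other absorbs the forcing by completing the square, leaving |F|^2 / \<open>kap n\<close>. This
  division is the gain of one derivative.\<close>

lemma forced_weighted_bound: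
  assumes fo: "forced \<gamma> \<beta> L U F a t" and at: "a \<le> t" and A: "finite A" and w: "\<And>n. 0 \<le> w n"
    and h: "h integrable_on {a..t}"
    and Fh: "\<And>\<tau>. \<tau> \<in> {a<..<t} \<Longrightarrow> (\<Sum>n\<in>A. w n / kap n * (cmod (F \<tau> n))\<^sup>2) \<le> h \<tau>"
  shows "(\<Sum>n\<in>A. w n * (cmod (U t n))\<^sup>2) \<le> exp ((2 * \<bar>Re \<beta>\<bar> + 2) * (t - a)) *
     ((\<Sum>n\<in>A. w n * exp (- kap n * (t - a)) * (cmod (U a n))\<^sup>2) + integral {a..t} h)"
proof -
  \<comment> \<open>The rate dominates the nondissipative part 2 (Re \<beta> + 1) of the growth, so
    that inside \<open>E\<close> only the dissipation remains.\<close>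
  define c where "c = 2 * \<bar>Re \<beta>\<bar> + 2"
  define E where "E n \<tau> = w n * exp (- kap n * (t - \<tau>) - c * (\<tau> - a))" for n \<tau>
  define Z where "Z \<tau> = (\<Sum>n\<in>A. E n \<tau> * (cmod (U \<tau> n))\<^sup>2)" for \<tau>
  define Z' where "Z' \<tau> = (\<Sum>n\<in>A. ((kap n - c) * E n \<tau>) * (cmod (U \<tau> n))\<^sup>2 + E n \<tau> * 
      (2 * (Re \<beta> + 1 - kap n) * (cmod (U \<tau> n))\<^sup>2 + 2 * Re (F \<tau> n * cnj (U \<tau> n))))" for \<tau>
  have E': "(E n has_real_derivative (kap n - c) * E n \<tau>) (at \<tau>)" for n \<tau>
    unfolding E_def by (auto intro!: derivative_eq_intros simp: algebra_simps)
  have "(Z' has_integral (Z t - Z a)) {a..t}"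
  proof (rule fundamental_theorem_of_calculus_interior[OF at])
    show "continuous_on {a..t} Z" unfolding Z_def E_def
      using fo unfolding forced_def by (intro continuous_intros) auto
    fix \<tau> assume "\<tau> \<in> {a<..<t}"
    then show "(Z has_vector_derivative Z' \<tau>) (at \<tau>)"
      unfolding Z_def Z'_def by (intro has_vector_derivative_sum forced_mode_sq_deriv[OF fo] E')
  qed
  then have Z'i: "(Z' has_integral (Z t - Z a)) {a<..<t}" by (simp add: has_integral_Icc_iff_Ioo)
  have hi: "(h has_integral (integral {a..t} h)) {a<..<t}"
    using integrable_integral[OF h] by (simp add: has_integral_Icc_iff_Ioo)
  have "Z t - Z a \<le> integral {a..t} h"
  proof (rule has_integral_le[OF Z'i hi])
    fix \<tau> assume \<tau>: "\<tau> \<in> {a<..<t}"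
    have "Z' \<tau> \<le> (\<Sum>n\<in>A. w n / kap n * (cmod (F \<tau> n))\<^sup>2)"
      unfolding Z'_def
    proof (rule sum_mono)
      fix n
      define x f where "x = cmod (U \<tau> n)" and "f = cmod (F \<tau> n)"
      have k: "0 < kap n" by simp
      have "(kap n - c) * x\<^sup>2 + (2 * (Re \<beta> + 1 - kap n) * x\<^sup>2 + 2 * Re (F \<tau> n * cnj (U \<tau> n)))
         \<le> - kap n * x\<^sup>2 + 2 * (f * x)"
      proof -
        have "Re (F \<tau> n * cnj (U \<tau> n)) \<le> f * x"
          using complex_Re_le_cmod[of "F \<tau> n * cnj (U \<tau> n)"] by (simp add: norm_mult f_def x_def)
        moreover have "2 * Re \<beta> * x\<^sup>2 \<le> 2 * \<bar>Re \<beta>\<bar> * x\<^sup>2" by (intro mult_right_mono) auto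
        ultimately show ?thesis by (simp add: c_def algebra_simps)
      qed
      also have "\<dots> \<le> f\<^sup>2 / kap n"
      proof -
        have "0 \<le> (kap n * x - f)\<^sup>2 / kap n" by (intro divide_nonneg_pos k) simp
        also have "\<dots> = kap n * x\<^sup>2 - 2 * (f * x) + f\<^sup>2 / kap n"
          using k by (simp add: power2_diff field_simps power2_eq_square)
        finally show ?thesis by simp
      qed
      finally have r: "(kap n - c) * x\<^sup>2 + (2 * (Re \<beta> + 1 - kap n) * x\<^sup>2 + 2 * Re (F \<tau> n * cnj (U \<tau> n))) \<le> f\<^sup>2 / kap n" .
      have "((kap n - c) * E n \<tau>) * x\<^sup>2 + E n \<tau> * (2 * (Re \<beta> + 1 - kap n) * x\<^sup>2 + 2 * Re (F \<tau> n * cnj (U \<tau> n)))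
        = E n \<tau> * ((kap n - c) * x\<^sup>2 + (2 * (Re \<beta> + 1 - kap n) * x\<^sup>2 + 2 * Re (F \<tau> n * cnj (U \<tau> n))))"
        by (simp add: algebra_simps)
      also have "\<dots> \<le> E n \<tau> * (f\<^sup>2 / kap n)" using r w by (intro mult_left_mono) (auto simp: E_def)
      also have "\<dots> \<le> w n * (f\<^sup>2 / kap n)"
      proof (rule mult_right_mono)
        have "- kap n * (t - \<tau>) - c * (\<tau> - a) \<le> 0"
        proof -
          have "0 \<le> kap n * (t - \<tau>)" "0 \<le> c * (\<tau> - a)" using \<tau> k by (auto simp: c_def)
          then show ?thesis by simp
        qed
        then show "E n \<tau> \<le> w n" unfolding E_def using w[of n] by (simp add: mult_left_le)
      qed simp
      finally show "((kap n - c) * E n \<tau>) * (cmod (U \<tau> n))\<^sup>2 + E n \<tau> * (2 * (Re \<beta> + 1 - kap n) * (cmod (U \<tau> n))\<^sup>2 + 2 * Re (F \<tau> n * cnj (U \<tau> n)))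
         \<le> w n / kap n * (cmod (F \<tau> n))\<^sup>2" by (simp add: x_def f_def)
    qed
    also have "\<dots> \<le> h \<tau>" by (rule Fh[OF \<tau>])
    finally show "Z' \<tau> \<le> h \<tau>" .
  qed
  moreover have "Z t = exp (- c * (t - a)) * (\<Sum>n\<in>A. w n * (cmod (U t n))\<^sup>2)"
    by (simp add: Z_def E_def sum_distrib_left mult_ac)
  moreover have "Z a = (\<Sum>n\<in>A. w n * exp (- kap n * (t - a)) * (cmod (U a n))\<^sup>2)"
    by (simp add: Z_def E_def)
  ultimately have "exp (- c * (t - a)) * (\<Sum>n\<in>A. w n * (cmod (U t n))\<^sup>2) \<le>
     (\<Sum>n\<in>A. w n * exp (- kap n * (t - a)) * (cmod (U a n))\<^sup>2) + integral {a..t} h" by simp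
  then have "exp (c * (t - a)) * (exp (- c * (t - a)) * (\<Sum>n\<in>A. w n * (cmod (U t n))\<^sup>2)) \<le>
     exp (c * (t - a)) * ((\<Sum>n\<in>A. w n * exp (- kap n * (t - a)) * (cmod (U a n))\<^sup>2) + integral {a..t} h)"
    by (intro mult_left_mono) auto
  moreover have "exp (c * (t - a)) * (exp (- c * (t - a)) * x) = x" for x
    by (simp add: exp_minus)
  ultimately show ?thesis unfolding c_def[symmetric] by (simp only:)
qed

text \<open>The H energy inequality with integrating factor of rate \<open>q\<close> and remainder
  \<open>g\<close>. Unlike \<open>forced_weighted_bound\<close> it keeps the real part of the full
  pairing, whose sign carries the damping. \<open>h\<close> is the time-integrable majorant for
  dominated convergence; all pointwise conditions live on the open interval because at time
  \<open>a\<close> only membership in H is known.\<close>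

lemma forced_energy:
  assumes fo: "forced \<gamma> \<beta> L U F a t" and at: "a \<le> t" 
    and Ua: "in_Hs 0 (U a)" and Ut: "in_Hs 0 (U t)"
    and H1: "\<And>\<tau>. \<tau> \<in> {a<..<t} \<Longrightarrow> in_Hs 1 (U \<tau>)"
    and FU: "\<And>\<tau>. \<tau> \<in> {a<..<t} \<Longrightarrow> (\<lambda>n. cmod (F \<tau> n * cnj (U \<tau> n))) summable_on UNIV"
    and h: "h integrable_on {a..t}"
    and hb: "\<And>\<tau>. \<tau> \<in> {a<..<t} \<Longrightarrow> (Hs_norm 1 (U \<tau>))\<^sup>2 + (\<Sum>\<^sub>\<infinity>n. cmod (F \<tau> n * cnj (U \<tau> n))) \<le> h \<tau>"
    and g: "(\<lambda>\<tau>. exp (- q * (\<tau> - a)) * g \<tau>) integrable_on {a..t}"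
    and rate: "\<And>\<tau>. \<tau> \<in> {a<..<t} \<Longrightarrow> 2 * (Re \<beta> + 1) * (Hs_norm 0 (U \<tau>))\<^sup>2 - 2 * (Hs_norm 1 (U \<tau>))\<^sup>2
       + 2 * Re (\<Sum>\<^sub>\<infinity>n. F \<tau> n * cnj (U \<tau> n)) \<le> q * (Hs_norm 0 (U \<tau>))\<^sup>2 + g \<tau>"
  shows "exp (- q * (t - a)) * (Hs_norm 0 (U t))\<^sup>2 \<le> (Hs_norm 0 (U a))\<^sup>2 + integral {a..t} (\<lambda>\<tau>. exp (- q * (\<tau> - a)) * g \<tau>)"
proof -
  define A where "A k = {- int k..int k}" for k
  define E where "E \<tau> = exp (- q * (\<tau> - a))" for \<tau>
  define S where "S k \<tau> = (\<Sum>n\<in>A k. E \<tau> * (cmod (U \<tau> n))\<^sup>2)" for k \<tau>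
  define S' where "S' k \<tau> = (\<Sum>n\<in>A k. (- q * E \<tau>) * (cmod (U \<tau> n))\<^sup>2 + E \<tau> * 
      (2 * (Re \<beta> + 1 - kap n) * (cmod (U \<tau> n))\<^sup>2 + 2 * Re (F \<tau> n * cnj (U \<tau> n))))" for k \<tau>
  define G where "G \<tau> = E \<tau> * (- q * (Hs_norm 0 (U \<tau>))\<^sup>2 + 2 * (Re \<beta> + 1) * (Hs_norm 0 (U \<tau>))\<^sup>2 - 2 * (Hs_norm 1 (U \<tau>))\<^sup>2
       + 2 * Re (\<Sum>\<^sub>\<infinity>n. F \<tau> n * cnj (U \<tau> n)))" for \<tau>
  have S'alt: "S' k \<tau> = E \<tau> * ((2 * (Re \<beta> + 1) - q) * (\<Sum>n\<in>A k. Hs_weight 0 (U \<tau>) n) - 2 * (\<Sum>n\<in>A k. Hs_weight 1 (U \<tau>) n)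
      + 2 * Re (\<Sum>n\<in>A k. F \<tau> n * cnj (U \<tau> n)))" for k \<tau>
    unfolding S'_def Hs_weight_1 Hs_weight_0
    by (simp add: sum_distrib_left sum.distrib sum_subtractf algebra_simps)
  have E': "(E has_real_derivative - q * E \<tau>) (at \<tau>)" for \<tau>
    unfolding E_def by (auto intro!: derivative_eq_intros simp: algebra_simps)
  have Sint: "(S' k has_integral (S k t - S k a)) {a<..<t}" for k
    unfolding has_integral_Icc_iff_Ioo[symmetric]
  proof (rule fundamental_theorem_of_calculus_interior[OF at])
    show "continuous_on {a..t} (S k)" unfolding S_def E_def
      using fo unfolding forced_def by (intro continuous_intros) auto
    fix \<tau> assume "\<tau> \<in> {a<..<t}"
    then show "(S k has_vector_derivative S' k \<tau>) (at \<tau>)"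
      unfolding S_def S'_def by (intro has_vector_derivative_sum forced_mode_sq_deriv[OF fo] E')
  qed
  have lim0: "(\<lambda>k. (\<Sum>n\<in>A k. Hs_weight s v n)) \<longlonglongrightarrow> (Hs_norm s v)\<^sup>2" if "in_Hs s v" for s v
    using sum_symmetric_tendsto_infsum[of "Hs_weight s v"] that by (simp add: in_Hs_def Hs_norm_sq A_def)
  have Slim: "(\<lambda>k. S k \<tau>) \<longlonglongrightarrow> E \<tau> * (Hs_norm 0 (U \<tau>))\<^sup>2" if "in_Hs 0 (U \<tau>)" for \<tau>
    using tendsto_mult_left[OF lim0[OF that], of "E \<tau>"] by (simp add: S_def sum_distrib_left)
  define M where "M = exp (\<bar>q\<bar> * (t - a))"
  \<comment> \<open>The bracket in \<open>S'alt\<close> consists of the H sum with coefficient at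
    most 2|Re \<beta>| + 2 + |q|, and of the H^1 sum and the pairing with coefficient 2 each; every
    one of the three is at most \<open>h\<close>.\<close>
  define C where "C = 2 * \<bar>Re \<beta>\<bar> + 2 + \<bar>q\<bar> + 2 + 2"
  have "(G has_integral (E t * (Hs_norm 0 (U t))\<^sup>2 - E a * (Hs_norm 0 (U a))\<^sup>2)) {a<..<t}"
  proof (rule has_integral_dominated_convergence[OF Sint])
    show "(\<lambda>\<tau>. M * C * h \<tau>) integrable_on {a<..<t}"
      using integrable_cmul[OF h, of "M * C"] by (simp add: integrable_on_Icc_iff_Ioo)
    show "(\<lambda>k. S k t - S k a) \<longlonglongrightarrow> E t * (Hs_norm 0 (U t))\<^sup>2 - E a * (Hs_norm 0 (U a))\<^sup>2"
      by (intro tendsto_diff Slim Ua Ut)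
    show "\<forall>\<tau>\<in>{a<..<t}. (\<lambda>k. S' k \<tau>) \<longlonglongrightarrow> G \<tau>"
    proof
      fix \<tau> assume \<tau>: "\<tau> \<in> {a<..<t}"
      have i0: "in_Hs 0 (U \<tau>)" using in_Hs_mono(1)[OF H1[OF \<tau>], of 0] by simp
      have s: "(\<lambda>n. F \<tau> n * cnj (U \<tau> n)) summable_on UNIV" by (rule abs_summable_summable[OF FU[OF \<tau>]])
      have "(\<lambda>k. \<Sum>n\<in>A k. F \<tau> n * cnj (U \<tau> n)) \<longlonglongrightarrow> (\<Sum>\<^sub>\<infinity>n. F \<tau> n * cnj (U \<tau> n))"
        unfolding A_def by (rule sum_symmetric_tendsto_infsum[OF s])
      then have "(\<lambda>k. S' k \<tau>) \<longlonglongrightarrow> E \<tau> * ((2 * (Re \<beta> + 1) - q) * (Hs_norm 0 (U \<tau>))\<^sup>2 - 2 * (Hs_norm 1 (U \<tau>))\<^sup>2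
         + 2 * Re (\<Sum>\<^sub>\<infinity>n. F \<tau> n * cnj (U \<tau> n)))"
        unfolding S'alt by (intro tendsto_intros lim0 i0 H1[OF \<tau>])
      then show "(\<lambda>k. S' k \<tau>) \<longlonglongrightarrow> G \<tau>" by (simp add: G_def algebra_simps)
    qed
    fix k show "\<forall>\<tau>\<in>{a<..<t}. norm (S' k \<tau>) \<le> M * C * h \<tau>"
    proof
      fix \<tau> assume \<tau>: "\<tau> \<in> {a<..<t}"
      have fin: "finite (A k)" by (simp add: A_def)
      have i0: "in_Hs 0 (U \<tau>)" using in_Hs_mono(1)[OF H1[OF \<tau>], of 0] by simp
      have x: "(\<Sum>n\<in>A k. Hs_weight 0 (U \<tau>) n) \<le> h \<tau>"
      proof -
        have "(\<Sum>n\<in>A k. Hs_weight 0 (U \<tau>) n) \<le> (Hs_norm 0 (U \<tau>))\<^sup>2" by (rule sum_Hs_weight_le[OF i0 fin])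
        also have "\<dots> \<le> (Hs_norm 1 (U \<tau>))\<^sup>2" using in_Hs_mono(2)[OF H1[OF \<tau>], of 0] by (intro power_mono) auto
        also have "\<dots> \<le> h \<tau>" using hb[OF \<tau>] infsum_nonneg[of UNIV "\<lambda>n. cmod (F \<tau> n * cnj (U \<tau> n))"] by simp
        finally show ?thesis .
      qed
      have y: "(\<Sum>n\<in>A k. Hs_weight 1 (U \<tau>) n) \<le> h \<tau>"
        using sum_Hs_weight_le[OF H1[OF \<tau>] fin] hb[OF \<tau>] infsum_nonneg[of UNIV "\<lambda>n. cmod (F \<tau> n * cnj (U \<tau> n))"] by simp
      have z: "\<bar>Re (\<Sum>n\<in>A k. F \<tau> n * cnj (U \<tau> n))\<bar> \<le> h \<tau>"
      proof -
        have "\<bar>Re (\<Sum>n\<in>A k. F \<tau> n * cnj (U \<tau> n))\<bar> \<le> (\<Sum>n\<in>A k. cmod (F \<tau> n * cnj (U \<tau> n)))"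
          by (rule order_trans[OF abs_Re_le_cmod norm_sum])
        also have "\<dots> \<le> (\<Sum>\<^sub>\<infinity>n. cmod (F \<tau> n * cnj (U \<tau> n)))"
          by (rule nonneg_sum_le_infsum[OF _ FU[OF \<tau>] fin]) simp
        also have "\<dots> \<le> h \<tau>" using hb[OF \<tau>] by (smt (verit) zero_le_power2)
        finally show ?thesis .
      qed
      have nn: "0 \<le> (\<Sum>n\<in>A k. Hs_weight 0 (U \<tau>) n)" "0 \<le> (\<Sum>n\<in>A k. Hs_weight 1 (U \<tau>) n)"
        by (intro sum_nonneg; simp)+
      have "\<bar>(2 * (Re \<beta> + 1) - q) * (\<Sum>n\<in>A k. Hs_weight 0 (U \<tau>) n)\<bar> \<le> (2 * \<bar>Re \<beta>\<bar> + 2 + \<bar>q\<bar>) * h \<tau>"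
        unfolding abs_mult using x nn by (intro mult_mono) auto
      then have "\<bar>(2 * (Re \<beta> + 1) - q) * (\<Sum>n\<in>A k. Hs_weight 0 (U \<tau>) n) - 2 * (\<Sum>n\<in>A k. Hs_weight 1 (U \<tau>) n)
        + 2 * Re (\<Sum>n\<in>A k. F \<tau> n * cnj (U \<tau> n))\<bar> \<le> (2 * \<bar>Re \<beta>\<bar> + 2 + \<bar>q\<bar>) * h \<tau> + 2 * h \<tau> + 2 * h \<tau>"
        using y z nn by linarith
      also have "\<dots> = C * h \<tau>" by (simp add: C_def algebra_simps)
      finally have b: "\<bar>(2 * (Re \<beta> + 1) - q) * (\<Sum>n\<in>A k. Hs_weight 0 (U \<tau>) n) - 2 * (\<Sum>n\<in>A k. Hs_weight 1 (U \<tau>) n)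
        + 2 * Re (\<Sum>n\<in>A k. F \<tau> n * cnj (U \<tau> n))\<bar> \<le> C * h \<tau>" .
      have "- q * (\<tau> - a) \<le> \<bar>q\<bar> * (t - a)"
      proof -
        have "- q * (\<tau> - a) \<le> \<bar>q\<bar> * (\<tau> - a)" using \<tau> by (intro mult_right_mono) auto
        also have "\<dots> \<le> \<bar>q\<bar> * (t - a)" using \<tau> by (intro mult_left_mono) auto
        finally show ?thesis .
      qed
      then have EM: "E \<tau> \<le> M" "0 \<le> E \<tau>" by (auto simp: E_def M_def)
      have "norm (S' k \<tau>) \<le> M * (C * h \<tau>)"
        unfolding S'alt real_norm_def abs_mult using EM b by (intro mult_mono) auto
      then show "norm (S' k \<tau>) \<le> M * C * h \<tau>" by simp
    qed
  qed
  moreover have "((\<lambda>\<tau>. E \<tau> * g \<tau>) has_integral (integral {a..t} (\<lambda>\<tau>. E \<tau> * g \<tau>))) {a<..<t}"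
    using integrable_integral[OF g] by (simp add: has_integral_Icc_iff_Ioo E_def)
  ultimately have "E t * (Hs_norm 0 (U t))\<^sup>2 - E a * (Hs_norm 0 (U a))\<^sup>2 \<le> integral {a..t} (\<lambda>\<tau>. E \<tau> * g \<tau>)"
  proof (rule has_integral_le)
    fix \<tau> assume "\<tau> \<in> {a<..<t}"
    from rate[OF this] show "G \<tau> \<le> E \<tau> * g \<tau>" unfolding G_def by (intro mult_left_mono) (auto simp: E_def)
  qed
  then show ?thesis by (simp add: E_def)
qed

section \<open>Dissipativity and Lipschitz dependence in H\<close>

text \<open>\<open>\<theta>\<close> is a plain function of time, even where it is later computed
  from \<open>U\<close> itself. Thus the cut-off equation and, with \<open>\<theta>\<close> equal to
  1, the original one share a single set of estimates.\<close>

definition damped_solution :: "real \<Rightarrow> real \<Rightarrow> complex \<Rightarrow> real \<Rightarrow> (real \<Rightarrow> real) \<Rightarrow> (real \<Rightarrow> int \<Rightarrow> complex) \<Rightarrow> bool" where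
  "damped_solution \<gamma> \<omega> \<beta> L \<theta> U \<longleftrightarrow>
     (\<forall>t. 0 \<le> \<theta> t \<and> \<theta> t \<le> 1) \<and>
     (\<forall>t\<ge>0. in_Hs 0 (U t)) \<and>
     (\<forall>t0\<ge>0. ((\<lambda>t. Hs_norm 0 (U t - U t0)) \<longlongrightarrow> 0) (at t0 within {0..})) \<and>
     (\<forall>t>0. in_Hs 1 (U t)) \<and>
     (\<forall>T\<ge>0. (\<lambda>t. (Hs_norm 1 (U t))\<^sup>2) integrable_on {0..T}) \<and>
     (\<forall>n. \<forall>t>0. ((\<lambda>\<tau>. U \<tau> n) has_vector_derivative
         (symb \<gamma> \<beta> L n * U t n - (1 + \<i> * complex_of_real \<omega>) * complex_of_real (\<theta> t) * cubic (U t) n)) (at t))"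

lemma is_solution_damped: "is_solution \<gamma> \<omega> \<beta> L U \<longleftrightarrow> damped_solution \<gamma> \<omega> \<beta> L (\<lambda>_. 1) U"
  by (simp add: is_solution_def damped_solution_def)

lemma H_cont_mode:
  fixes U :: "real \<Rightarrow> int \<Rightarrow> complex"
  assumes "\<And>t. 0 \<le> t \<Longrightarrow> in_Hs 0 (U t)"
    and lim: "\<And>t0. 0 \<le> t0 \<Longrightarrow> ((\<lambda>t. Hs_norm 0 (U t - U t0)) \<longlongrightarrow> 0) (at t0 within {0..})"
  shows "continuous_on {0..} (\<lambda>t. U t n)" "continuous_on {0..} (\<lambda>t. Hs_norm 0 (U t))"
proof -
  have ev: "\<forall>\<^sub>F t in at t0 within {0..}. 0 \<le> t" for t0 :: real
    by (simp add: eventually_at_filter)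
  show "continuous_on {0..} (\<lambda>t. U t n)"
    unfolding continuous_on_def
  proof
    fix t0 :: real assume t0: "t0 \<in> {0..}"
    have "((\<lambda>t. U t n - U t0 n) \<longlongrightarrow> 0) (at t0 within {0..})"
    proof (rule Lim_null_comparison[OF _ lim])
      show "\<forall>\<^sub>F t in at t0 within {0..}. norm (U t n - U t0 n) \<le> Hs_norm 0 (U t - U t0)"
        using ev by eventually_elim (use cmod_le_Hs_norm[of 0 "U _ - U t0" n] Hs_diff(1) assms(1) t0 in auto)
    qed (use t0 in auto)
    then show "((\<lambda>t. U t n) \<longlongrightarrow> U t0 n) (at t0 within {0..})" by (rule LIM_zero_cancel)
  qed
  show "continuous_on {0..} (\<lambda>t. Hs_norm 0 (U t))"
    unfolding continuous_on_def
  proof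
    fix t0 :: real assume t0: "t0 \<in> {0..}"
    have "((\<lambda>t. Hs_norm 0 (U t) - Hs_norm 0 (U t0)) \<longlongrightarrow> 0) (at t0 within {0..})"
    proof (rule Lim_null_comparison[OF _ lim])
      show "\<forall>\<^sub>F t in at t0 within {0..}. norm (Hs_norm 0 (U t) - Hs_norm 0 (U t0)) \<le> Hs_norm 0 (U t - U t0)"
        using ev
      proof eventually_elim
        case (elim t)
        then show ?case
          using Hs_norm_le_diff[of 0 "U t" "U t0"] Hs_norm_le_diff[of 0 "U t0" "U t"] assms(1) t0
          by (simp add: Hs_norm_diff_commute[of 0 "U t0" "U t"] abs_le_iff)
      qed
    qed (use t0 in auto)
    then show "((\<lambda>t. Hs_norm 0 (U t)) \<longlongrightarrow> Hs_norm 0 (U t0)) (at t0 within {0..})" by (rule LIM_zero_cancel)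
  qed
qed

lemma le_exp_multI: "exp (- x) * y \<le> z \<Longrightarrow> y \<le> exp x * z" for x y z :: real
  by (simp add: exp_minus field_simps)

definition nonlin :: "real \<Rightarrow> (real \<Rightarrow> real) \<Rightarrow> (real \<Rightarrow> int \<Rightarrow> complex) \<Rightarrow> real \<Rightarrow> int \<Rightarrow> complex" where
  "nonlin \<omega> \<theta> U \<tau> n = - ((1 + \<i> * complex_of_real \<omega>) * complex_of_real (\<theta> \<tau>) * cubic (U \<tau>) n)"

context
  fixes \<gamma> \<omega> :: real and \<beta> :: complex and L :: real and \<theta> :: "real \<Rightarrow> real" and U :: "real \<Rightarrow> int \<Rightarrow> complex"
  assumes sol: "damped_solution \<gamma> \<omega> \<beta> L \<theta> U"
begin

lemma
  shows damping_nonneg: "0 \<le> \<theta> t" and damping_le_1: "\<theta> t \<le> 1"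
    and damped_H0: "0 \<le> t \<Longrightarrow> in_Hs 0 (U t)"
    and damped_H1: "0 < t \<Longrightarrow> in_Hs 1 (U t)"
    and damped_cont0: "0 \<le> t0 \<Longrightarrow> ((\<lambda>t. Hs_norm 0 (U t - U t0)) \<longlongrightarrow> 0) (at t0 within {0..})"
  using sol by (auto simp: damped_solution_def)

lemma damped_cont_mode: "continuous_on {0..} (\<lambda>t. U t n)"
  and damped_cont_norm: "continuous_on {0..} (\<lambda>t. Hs_norm 0 (U t))"
  by (rule H_cont_mode[of U, OF damped_H0 damped_cont0]; assumption)+

lemma damped_integrable: 
  assumes "0 \<le> a"
  shows "(\<lambda>t. (Hs_norm 1 (U t))\<^sup>2) integrable_on {a..t}"
proof (cases "a \<le> t")
  case True
  then have "(\<lambda>t. (Hs_norm 1 (U t))\<^sup>2) integrable_on {0..t}"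
    using sol assms unfolding damped_solution_def by simp
  then show ?thesis by (rule integrable_subinterval_real) (use assms in simp)
qed (simp add: integrable_on_empty)

lemma damped_forced: "0 \<le> a \<Longrightarrow> forced \<gamma> \<beta> L U (nonlin \<omega> \<theta> U) a t"
  using sol unfolding forced_def damped_solution_def nonlin_def
  by (auto intro: continuous_on_subset[OF damped_cont_mode])

lemma damped_l1: "0 < t \<Longrightarrow> in_l1 (U t)"
  by (intro in_Hs1_imp_l1 damped_H1)

lemma damped_bounded: "\<exists>B\<ge>0. \<forall>\<tau>\<in>{0..t}. Hs_norm 0 (U \<tau>) \<le> B"
proof -
  have "compact ((\<lambda>t. Hs_norm 0 (U t)) ` {0..t})"
    by (intro compact_continuous_image continuous_on_subset[OF damped_cont_norm]) auto
  then obtain B where "\<forall>x\<in>(\<lambda>t. Hs_norm 0 (U t)) ` {0..t}. norm x \<le> B"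
    using compact_imp_bounded bounded_iff by blast
  then show ?thesis by (intro exI[of _ "max B 0"]) force
qed

text \<open>The absolute bound comes from using the l1 norm twice and Agmon once; it serves as the
  integrable majorant in \<open>forced_energy\<close>. The sign comes from
  \<open>cubic_pairing\<close>: the pairing of the cubic term with \<open>u\<close> is real, so
  \<open>\<omega>\<close> only contributes to the imaginary part.\<close>

lemma nonlin_pairing:
  assumes "0 < \<tau>"
  shows nonlin_pairing_summable: "(\<lambda>n. cmod (nonlin \<omega> \<theta> U \<tau> n * cnj (U \<tau> n))) summable_on UNIV"
    and nonlin_pairing_le: "(\<Sum>\<^sub>\<infinity>n. cmod (nonlin \<omega> \<theta> U \<tau> n * cnj (U \<tau> n))) 
      \<le> 16 * cmod (1 + \<i> * complex_of_real \<omega>) * (Hs_norm 0 (U \<tau>))\<^sup>2 * (Hs_norm 1 (U \<tau>))\<^sup>2"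
    and nonlin_pairing_Re: "Re (\<Sum>\<^sub>\<infinity>n. nonlin \<omega> \<theta> U \<tau> n * cnj (U \<tau> n)) \<le> - \<theta> \<tau> * (Hs_norm 0 (U \<tau>)) ^ 4"
proof -
  define c where "c = cmod (1 + \<i> * complex_of_real \<omega>)"
  define x y where "x = Hs_norm 0 (U \<tau>)" and "y = Hs_norm 1 (U \<tau>)"
  have l: "in_l1 (U \<tau>)" using assms by (rule damped_l1)
  have xy: "0 \<le> x" "x \<le> y" using in_Hs_mono(2)[OF damped_H1[OF assms], of 0] by (auto simp: x_def y_def)
  have "(\<Sum>n\<in>A. cmod (nonlin \<omega> \<theta> U \<tau> n * cnj (U \<tau> n))) \<le> 16 * c * x\<^sup>2 * y\<^sup>2" if A: "finite A" for A
  proof -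
    have "(\<Sum>n\<in>A. cmod (nonlin \<omega> \<theta> U \<tau> n * cnj (U \<tau> n))) \<le> (\<Sum>n\<in>A. c * (l1 (U \<tau>) * x * x) * cmod (U \<tau> n))"
    proof (intro sum_mono)
      fix n
      have "c * \<theta> \<tau> * cmod (cubic (U \<tau>) n) \<le> c * 1 * (l1 (U \<tau>) * x * x)"
        unfolding x_def cubic_eq_tri using damping_nonneg[of \<tau>] damping_le_1[of \<tau>]
        by (intro mult_mono cmod_tri_le1 l mult_nonneg_nonneg) (auto simp: c_def)
      then show "cmod (nonlin \<omega> \<theta> U \<tau> n * cnj (U \<tau> n)) \<le> c * (l1 (U \<tau>) * x * x) * cmod (U \<tau> n)"
        using damping_nonneg[of \<tau>] by (simp add: nonlin_def norm_mult c_def mult_right_mono)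
    qed
    also have "\<dots> = c * (l1 (U \<tau>) * x * x) * (\<Sum>n\<in>A. cmod (U \<tau> n))" by (simp add: sum_distrib_left)
    also have "\<dots> \<le> c * (l1 (U \<tau>) * x * x) * l1 (U \<tau>)"
      using xy by (intro mult_left_mono sum_cmod_le_l1 l A) (auto simp: c_def)
    also have "\<dots> = c * x\<^sup>2 * (l1 (U \<tau>))\<^sup>2" by (simp add: power2_eq_square)
    also have "\<dots> \<le> c * x\<^sup>2 * (16 * y * y)"
    proof (intro mult_left_mono)
      have "(l1 (U \<tau>))\<^sup>2 \<le> 16 * x * y" unfolding x_def y_def by (rule l1_sq_le[OF damped_H1[OF assms]])
      also have "\<dots> \<le> 16 * y * y" using xy by (intro mult_right_mono) auto
      finally show "(l1 (U \<tau>))\<^sup>2 \<le> 16 * y * y" .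
    qed (auto simp: c_def)
    finally show ?thesis by (simp add: power2_eq_square mult_ac)
  qed
  then show "(\<lambda>n. cmod (nonlin \<omega> \<theta> U \<tau> n * cnj (U \<tau> n))) summable_on UNIV"
    "(\<Sum>\<^sub>\<infinity>n. cmod (nonlin \<omega> \<theta> U \<tau> n * cnj (U \<tau> n))) 
      \<le> 16 * cmod (1 + \<i> * complex_of_real \<omega>) * (Hs_norm 0 (U \<tau>))\<^sup>2 * (Hs_norm 1 (U \<tau>))\<^sup>2"
    using nonneg_summable_infsum_leI[of "\<lambda>n. cmod (nonlin \<omega> \<theta> U \<tau> n * cnj (U \<tau> n))" "16 * c * x\<^sup>2 * y\<^sup>2"]
    by (auto simp: c_def x_def y_def)
  obtain P where P: "((\<lambda>n. cubic (U \<tau>) n * cnj (U \<tau> n)) has_sum complex_of_real P) UNIV" "(Hs_norm 0 (U \<tau>)) ^ 4 \<le> P"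
    using cubic_pairing[OF l] by blast
  have "((\<lambda>n. - ((1 + \<i> * complex_of_real \<omega>) * complex_of_real (\<theta> \<tau>)) * (cubic (U \<tau>) n * cnj (U \<tau> n))) has_sum
      - ((1 + \<i> * complex_of_real \<omega>) * complex_of_real (\<theta> \<tau>)) * complex_of_real P) UNIV"
    by (rule has_sum_cmult_right[OF P(1)])
  then have "(\<Sum>\<^sub>\<infinity>n. nonlin \<omega> \<theta> U \<tau> n * cnj (U \<tau> n)) = - ((1 + \<i> * complex_of_real \<omega>) * complex_of_real (\<theta> \<tau>)) * complex_of_real P"
    by (intro infsumI) (simp add: nonlin_def mult.assoc)
  then have "Re (\<Sum>\<^sub>\<infinity>n. nonlin \<omega> \<theta> U \<tau> n * cnj (U \<tau> n)) = - \<theta> \<tau> * P" by simp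
  then show "Re (\<Sum>\<^sub>\<infinity>n. nonlin \<omega> \<theta> U \<tau> n * cnj (U \<tau> n)) \<le> - \<theta> \<tau> * (Hs_norm 0 (U \<tau>)) ^ 4"
    using P(2) damping_nonneg[of \<tau>] by (simp add: mult_left_mono)
qed

lemma damped_energy:
  assumes a: "0 \<le> a" "a \<le> t"
    and g: "(\<lambda>\<tau>. exp (- q * (\<tau> - a)) * g \<tau>) integrable_on {a..t}"
    and rate: "\<And>\<tau>. \<tau> \<in> {a<..<t} \<Longrightarrow> 2 * (Re \<beta> + 1) * (Hs_norm 0 (U \<tau>))\<^sup>2 - 2 * (Hs_norm 1 (U \<tau>))\<^sup>2
       - 2 * \<theta> \<tau> * (Hs_norm 0 (U \<tau>)) ^ 4 \<le> q * (Hs_norm 0 (U \<tau>))\<^sup>2 + g \<tau>"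
  shows "exp (- q * (t - a)) * (Hs_norm 0 (U t))\<^sup>2 \<le> (Hs_norm 0 (U a))\<^sup>2 + integral {a..t} (\<lambda>\<tau>. exp (- q * (\<tau> - a)) * g \<tau>)"
proof -
  obtain B where B: "0 \<le> B" "\<And>\<tau>. \<tau> \<in> {0..t} \<Longrightarrow> Hs_norm 0 (U \<tau>) \<le> B" using damped_bounded[of t] by blast
  define K where "K = 1 + 16 * cmod (1 + \<i> * complex_of_real \<omega>) * B\<^sup>2"
  show ?thesis
  proof (rule forced_energy[OF damped_forced[OF a(1)] a(2), where h = "\<lambda>\<tau>. K * (Hs_norm 1 (U \<tau>))\<^sup>2"])
    show "in_Hs 0 (U a)" "in_Hs 0 (U t)" using a damped_H0 by auto
    show "(\<lambda>\<tau>. K * (Hs_norm 1 (U \<tau>))\<^sup>2) integrable_on {a..t}"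
      using integrable_cmul[OF damped_integrable[OF a(1)], of K] by simp
    show "(\<lambda>\<tau>. exp (- q * (\<tau> - a)) * g \<tau>) integrable_on {a..t}" by (rule g)
    fix \<tau> assume \<tau>: "\<tau> \<in> {a<..<t}"
    then have p: "0 < \<tau>" using a by auto
    show "in_Hs 1 (U \<tau>)" using damped_H1[OF p] .
    show "(\<lambda>n. cmod (nonlin \<omega> \<theta> U \<tau> n * cnj (U \<tau> n))) summable_on UNIV" by (rule nonlin_pairing_summable[OF p])
    have "16 * cmod (1 + \<i> * complex_of_real \<omega>) * (Hs_norm 0 (U \<tau>))\<^sup>2 * (Hs_norm 1 (U \<tau>))\<^sup>2 
       \<le> 16 * cmod (1 + \<i> * complex_of_real \<omega>) * B\<^sup>2 * (Hs_norm 1 (U \<tau>))\<^sup>2"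
      using B(2)[of \<tau>] \<tau> p by (intro mult_right_mono mult_left_mono power_mono) auto
    then show "(Hs_norm 1 (U \<tau>))\<^sup>2 + (\<Sum>\<^sub>\<infinity>n. cmod (nonlin \<omega> \<theta> U \<tau> n * cnj (U \<tau> n))) \<le> K * (Hs_norm 1 (U \<tau>))\<^sup>2"
      using nonlin_pairing_le[OF p] by (simp add: K_def algebra_simps)
    show "2 * (Re \<beta> + 1) * (Hs_norm 0 (U \<tau>))\<^sup>2 - 2 * (Hs_norm 1 (U \<tau>))\<^sup>2
       + 2 * Re (\<Sum>\<^sub>\<infinity>n. nonlin \<omega> \<theta> U \<tau> n * cnj (U \<tau> n)) \<le> q * (Hs_norm 0 (U \<tau>))\<^sup>2 + g \<tau>"
      using rate[OF \<tau>] nonlin_pairing_Re[OF p] by simp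
  qed
qed

lemma damped_norm0_sq_le_norm1_sq: "0 < \<tau> \<Longrightarrow> (Hs_norm 0 (U \<tau>))\<^sup>2 \<le> (Hs_norm 1 (U \<tau>))\<^sup>2"
  using in_Hs_mono(2)[OF damped_H1, of \<tau> 0] by (intro power_mono) auto

text \<open>The cubic damping is dropped, so the bound holds for every \<open>\<theta>\<close>; the
  price is exponential growth, which is acceptable on bounded time intervals.\<close>

lemma damped_H_bound:
  assumes a: "0 \<le> a" "a \<le> t"
  shows "(Hs_norm 0 (U t))\<^sup>2 \<le> exp (2 * \<bar>Re \<beta>\<bar> * (t - a)) * (Hs_norm 0 (U a))\<^sup>2"
proof -
  have "exp (- (2 * \<bar>Re \<beta>\<bar>) * (t - a)) * (Hs_norm 0 (U t))\<^sup>2 \<le> (Hs_norm 0 (U a))\<^sup>2 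
     + integral {a..t} (\<lambda>\<tau>. exp (- (2 * \<bar>Re \<beta>\<bar>) * (\<tau> - a)) * 0)"
  proof (rule damped_energy[OF a])
    fix \<tau> assume \<tau>: "\<tau> \<in> {a<..<t}"
    define x y where "x = (Hs_norm 0 (U \<tau>))\<^sup>2" and "y = (Hs_norm 1 (U \<tau>))\<^sup>2"
    have "x \<le> y" using damped_norm0_sq_le_norm1_sq[of \<tau>] \<tau> a by (simp add: x_def y_def)
    moreover have "2 * Re \<beta> * x \<le> 2 * \<bar>Re \<beta>\<bar> * x" by (intro mult_right_mono) (auto simp: x_def)
    moreover have "0 \<le> \<theta> \<tau> * (Hs_norm 0 (U \<tau>)) ^ 4" using damping_nonneg by simp
    ultimately show "2 * (Re \<beta> + 1) * (Hs_norm 0 (U \<tau>))\<^sup>2 - 2 * (Hs_norm 1 (U \<tau>))\<^sup>2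
       - 2 * \<theta> \<tau> * (Hs_norm 0 (U \<tau>)) ^ 4 \<le> 2 * \<bar>Re \<beta>\<bar> * (Hs_norm 0 (U \<tau>))\<^sup>2 + 0"
      unfolding x_def[symmetric] y_def[symmetric] by (simp add: algebra_simps)
  qed (simp add: integrable_0)
  then show ?thesis by (intro le_exp_multI) simp
qed

lemma damped_H1_integral:
  assumes a: "0 \<le> a" "a \<le> t"
  shows "integral {a..t} (\<lambda>\<tau>. (Hs_norm 1 (U \<tau>))\<^sup>2) \<le>
     (1 + 2 * (\<bar>Re \<beta>\<bar> + 1) * exp (2 * \<bar>Re \<beta>\<bar> * (t - a)) * (t - a)) * (Hs_norm 0 (U a))\<^sup>2"
proof -
  define M where "M = exp (2 * \<bar>Re \<beta>\<bar> * (t - a)) * (Hs_norm 0 (U a))\<^sup>2"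
  \<comment> \<open>With q = 0, half of the dissipation is kept inside \<open>g\<close>; it
    reappears in the conclusion as the time integral to be bounded.\<close>
  define g where "g = (\<lambda>\<tau>. 2 * (\<bar>Re \<beta>\<bar> + 1) * M - (Hs_norm 1 (U \<tau>))\<^sup>2)"
  have gi: "g integrable_on {a..t}"
    unfolding g_def by (intro integrable_diff damped_integrable a) auto
  have "exp (- 0 * (t - a)) * (Hs_norm 0 (U t))\<^sup>2 \<le> (Hs_norm 0 (U a))\<^sup>2 
     + integral {a..t} (\<lambda>\<tau>. exp (- 0 * (\<tau> - a)) * g \<tau>)" 
  proof (rule damped_energy[OF a])
    fix \<tau> assume \<tau>: "\<tau> \<in> {a<..<t}"
    have "(Hs_norm 0 (U \<tau>))\<^sup>2 \<le> M"
    proof -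
      have "(Hs_norm 0 (U \<tau>))\<^sup>2 \<le> exp (2 * \<bar>Re \<beta>\<bar> * (\<tau> - a)) * (Hs_norm 0 (U a))\<^sup>2"
        using \<tau> a by (intro damped_H_bound) auto
      also have "\<dots> \<le> M" unfolding M_def using \<tau> by (intro mult_right_mono) (auto intro!: mult_left_mono)
      finally show ?thesis .
    qed
    then have "2 * (\<bar>Re \<beta>\<bar> + 1) * (Hs_norm 0 (U \<tau>))\<^sup>2 \<le> 2 * (\<bar>Re \<beta>\<bar> + 1) * M"
      by (intro mult_left_mono) auto
    moreover have "2 * (Re \<beta> + 1) * (Hs_norm 0 (U \<tau>))\<^sup>2 \<le> 2 * (\<bar>Re \<beta>\<bar> + 1) * (Hs_norm 0 (U \<tau>))\<^sup>2"
      by (intro mult_right_mono) auto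
    moreover have "0 \<le> \<theta> \<tau> * (Hs_norm 0 (U \<tau>)) ^ 4" using damping_nonneg by simp
    moreover have "0 \<le> (Hs_norm 1 (U \<tau>))\<^sup>2" by simp
    ultimately show "2 * (Re \<beta> + 1) * (Hs_norm 0 (U \<tau>))\<^sup>2 - 2 * (Hs_norm 1 (U \<tau>))\<^sup>2
       - 2 * \<theta> \<tau> * (Hs_norm 0 (U \<tau>)) ^ 4 \<le> 0 * (Hs_norm 0 (U \<tau>))\<^sup>2 + g \<tau>"
      unfolding g_def by linarith
  qed (use gi in simp)
  then have "(Hs_norm 0 (U t))\<^sup>2 \<le> (Hs_norm 0 (U a))\<^sup>2 + integral {a..t} g" by simp
  moreover have "integral {a..t} g = 2 * (\<bar>Re \<beta>\<bar> + 1) * M * (t - a) - integral {a..t} (\<lambda>\<tau>. (Hs_norm 1 (U \<tau>))\<^sup>2)"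
    unfolding g_def using a by (subst integral_diff) (auto intro!: damped_integrable)
  moreover have "0 \<le> (Hs_norm 0 (U t))\<^sup>2" by simp
  ultimately have "integral {a..t} (\<lambda>\<tau>. (Hs_norm 1 (U \<tau>))\<^sup>2) \<le> (Hs_norm 0 (U a))\<^sup>2 + 2 * (\<bar>Re \<beta>\<bar> + 1) * M * (t - a)"
    by linarith
  also have "\<dots> = (1 + 2 * (\<bar>Re \<beta>\<bar> + 1) * exp (2 * \<bar>Re \<beta>\<bar> * (t - a)) * (t - a)) * (Hs_norm 0 (U a))\<^sup>2"
    unfolding M_def distrib_right[of 1] by (simp only: mult_1 mult_ac)
  finally show ?thesis .
qed

end

text \<open>The maximum over x of (2 Re \<beta> + 1) x - 2 x^2, where x stands for the squared H
  norm.\<close>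

definition absorb :: "complex \<Rightarrow> real" where "absorb \<beta> = (2 * Re \<beta> + 1)\<^sup>2 / 8"

lemma absorb_nonneg: "0 \<le> absorb \<beta>" by (simp add: absorb_def)

text \<open>The energy inequality with rate q = -1. Asking the squared norm x to decay at rate 1
  adds x to its growth 2 (Re \<beta>) x, and the quartic damping - 2 x^2 keeps the total below
  \<open>absorb \<beta>\<close>.\<close>

lemma solution_H_dissipative:
  assumes sol: "is_solution \<gamma> \<omega> \<beta> L U" and a: "0 \<le> a" "a \<le> t"
  shows "(Hs_norm 0 (U t))\<^sup>2 \<le> exp (- (t - a)) * (Hs_norm 0 (U a))\<^sup>2 + absorb \<beta>"
proof -
  note sol' = sol[unfolded is_solution_damped]
  have g: "((\<lambda>\<tau>. exp (\<tau> - a) * absorb \<beta>) has_integral (exp (t - a) * absorb \<beta> - exp (a - a) * absorb \<beta>)) {a..t}"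
    by (rule fundamental_theorem_of_calculus[OF a(2)])
       (auto intro!: derivative_eq_intros simp flip: has_real_derivative_iff_has_vector_derivative)
  have "exp (- (- 1) * (t - a)) * (Hs_norm 0 (U t))\<^sup>2 \<le> (Hs_norm 0 (U a))\<^sup>2 
     + integral {a..t} (\<lambda>\<tau>. exp (- (- 1) * (\<tau> - a)) * absorb \<beta>)"
  proof (rule damped_energy[OF sol' a])
    show "(\<lambda>\<tau>. exp (- (- 1) * (\<tau> - a)) * absorb \<beta>) integrable_on {a..t}" using g by auto
    fix \<tau> assume \<tau>: "\<tau> \<in> {a<..<t}"
    define x y where "x = (Hs_norm 0 (U \<tau>))\<^sup>2" and "y = (Hs_norm 1 (U \<tau>))\<^sup>2"
    have "x \<le> y" using damped_norm0_sq_le_norm1_sq[OF sol', of \<tau>] \<tau> a by (simp add: x_def y_def)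
    moreover have "(2 * Re \<beta> + 1) * x - 2 * x\<^sup>2 \<le> absorb \<beta>"
      using zero_le_power2[of "2 * Re \<beta> + 1 - 4 * x"] by (simp add: absorb_def power2_eq_square algebra_simps)
    moreover have "(Hs_norm 0 (U \<tau>)) ^ 4 = x\<^sup>2" by (simp add: x_def)
    ultimately show "2 * (Re \<beta> + 1) * (Hs_norm 0 (U \<tau>))\<^sup>2 - 2 * (Hs_norm 1 (U \<tau>))\<^sup>2
       - 2 * 1 * (Hs_norm 0 (U \<tau>)) ^ 4 \<le> - 1 * (Hs_norm 0 (U \<tau>))\<^sup>2 + absorb \<beta>"
      by (simp add: x_def[symmetric] y_def[symmetric] algebra_simps)
  qed
  then have "exp (t - a) * (Hs_norm 0 (U t))\<^sup>2 \<le> (Hs_norm 0 (U a))\<^sup>2 + (exp (t - a) * absorb \<beta> - absorb \<beta>)"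
    using integral_unique[OF g] by simp
  also have "\<dots> \<le> (Hs_norm 0 (U a))\<^sup>2 + exp (t - a) * absorb \<beta>" using absorb_nonneg[of \<beta>] by simp
  finally have "(Hs_norm 0 (U t))\<^sup>2 \<le> exp (- (t - a)) * ((Hs_norm 0 (U a))\<^sup>2 + exp (t - a) * absorb \<beta>)"
    by (intro le_exp_multI) simp
  moreover have "exp (- (t - a)) * (exp (t - a) * absorb \<beta>) = absorb \<beta>"
    unfolding mult.assoc[symmetric] exp_add[symmetric] by simp
  ultimately show ?thesis by (simp only: distrib_left)
qed

lemma solution_H_bound:
  assumes "is_solution \<gamma> \<omega> \<beta> L U" "0 \<le> a" "a \<le> t"
  shows "(Hs_norm 0 (U t))\<^sup>2 \<le> (Hs_norm 0 (U a))\<^sup>2 + absorb \<beta>"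
proof -
  have "exp (- (t - a)) * (Hs_norm 0 (U a))\<^sup>2 \<le> 1 * (Hs_norm 0 (U a))\<^sup>2"
    using assms by (intro mult_right_mono) auto
  then show ?thesis using solution_H_dissipative[OF assms] by simp
qed

section \<open>Lipschitz dependence in H\<close>

definition lip_rate :: "real \<Rightarrow> complex \<Rightarrow> real \<Rightarrow> real" where
  "lip_rate \<omega> \<beta> M = 2 * (\<bar>Re \<beta>\<bar> + 1) + (64 * cmod (1 + \<i> * complex_of_real \<omega>) * M)\<^sup>2 / 2"

text \<open>In the pairing of the difference W with the difference of the cubic terms, the l1 norm
  of W appears twice, once from \<open>cubic_diff_sup\<close> and once from summing |W_n|. Agmon
  turns its square into D times the H norm times the H^1 norm of W, and completing the square spends
  the dissipation on the H^1 factor; the rest, D^2 / 2, is the last term of \<open>lip_rate\<close>.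
  That rate governs the squared norm, hence the division by 2.\<close>

lemma solution_lipschitz:
  assumes U: "is_solution \<gamma> \<omega> \<beta> L U" and V: "is_solution \<gamma> \<omega> \<beta> L V" and t: "0 \<le> t"
    and M: "\<And>\<tau>. \<tau> \<in> {0..t} \<Longrightarrow> (Hs_norm 0 (U \<tau>))\<^sup>2 \<le> M" "\<And>\<tau>. \<tau> \<in> {0..t} \<Longrightarrow> (Hs_norm 0 (V \<tau>))\<^sup>2 \<le> M"
  shows "Hs_norm 0 (U t - V t) \<le> exp (lip_rate \<omega> \<beta> M / 2 * t) * Hs_norm 0 (U 0 - V 0)"
proof -
  note U' = U[unfolded is_solution_damped] and V' = V[unfolded is_solution_damped]
  define c where "c = cmod (1 + \<i> * complex_of_real \<omega>)"
  define W where "W \<tau> = U \<tau> - V \<tau>" for \<tau>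
  define F where "F \<tau> n = nonlin \<omega> (\<lambda>_. 1) U \<tau> n - nonlin \<omega> (\<lambda>_. 1) V \<tau> n" for \<tau> n
  define q where "q = lip_rate \<omega> \<beta> M"
  \<comment> \<open>A factor 4 \<open>M\<close> from \<open>cubic_diff_sup\<close> with both squared
    norms at most \<open>M\<close>, and 16 from Agmon.\<close>
  define D where "D = 64 * c * M"
  have M0: "0 \<le> M" using M(1)[of t] t by (smt (verit) atLeastAtMost_iff zero_le_power2)
  have D0: "0 \<le> D" using M0 by (simp add: D_def c_def)
  have fo: "forced \<gamma> \<beta> L W F 0 t"
    using damped_forced[OF U', of 0 t] damped_forced[OF V', of 0 t] unfolding forced_def W_def F_def
    by (auto intro!: continuous_intros derivative_eq_intros simp: algebra_simps)
  have W0: "in_Hs 0 (W \<tau>)" if "0 \<le> \<tau>" for \<tau>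
    unfolding W_def using that by (intro Hs_diff damped_H0[OF U'] damped_H0[OF V'])
  have W1: "in_Hs 1 (W \<tau>)" if "0 < \<tau>" for \<tau>
    unfolding W_def using that by (intro Hs_diff damped_H1[OF U'] damped_H1[OF V'])
  have FW: "(\<lambda>n. cmod (F \<tau> n * cnj (W \<tau> n))) summable_on UNIV"
    "(\<Sum>\<^sub>\<infinity>n. cmod (F \<tau> n * cnj (W \<tau> n))) \<le> D * Hs_norm 0 (W \<tau>) * Hs_norm 1 (W \<tau>)" if \<tau>: "\<tau> \<in> {0<..<t}" for \<tau>
  proof -
    have l: "in_l1 (U \<tau>)" "in_l1 (V \<tau>)" using \<tau> damped_l1[OF U'] damped_l1[OF V'] by auto
    have lW: "in_l1 (W \<tau>)" unfolding W_def by (rule l1_diff(1)[OF l])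
    have "(\<Sum>n\<in>A. cmod (F \<tau> n * cnj (W \<tau> n))) \<le> D * Hs_norm 0 (W \<tau>) * Hs_norm 1 (W \<tau>)" if A: "finite A" for A
    proof -
      have "(\<Sum>n\<in>A. cmod (F \<tau> n * cnj (W \<tau> n))) \<le> (\<Sum>n\<in>A. c * (4 * M * l1 (W \<tau>)) * cmod (W \<tau> n))"
      proof (intro sum_mono)
        fix n
        have "cmod (cubic (U \<tau>) n - cubic (V \<tau>) n) \<le> 2 * ((Hs_norm 0 (U \<tau>))\<^sup>2 + (Hs_norm 0 (V \<tau>))\<^sup>2) * l1 (W \<tau>)"
          unfolding W_def by (rule cubic_diff_sup[OF l])
        also have "\<dots> \<le> 2 * (M + M) * l1 (W \<tau>)"
          using M(1)[of \<tau>] M(2)[of \<tau>] \<tau> by (intro mult_right_mono mult_left_mono add_mono) auto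
        finally have "cmod (cubic (U \<tau>) n - cubic (V \<tau>) n) \<le> 4 * M * l1 (W \<tau>)" by simp
        moreover have "F \<tau> n = - ((1 + \<i> * complex_of_real \<omega>) * (cubic (U \<tau>) n - cubic (V \<tau>) n))"
          by (simp add: F_def nonlin_def algebra_simps)
        ultimately show "cmod (F \<tau> n * cnj (W \<tau> n)) \<le> c * (4 * M * l1 (W \<tau>)) * cmod (W \<tau> n)"
          by (simp add: norm_mult c_def mult_left_mono mult_right_mono)
      qed
      also have "\<dots> = c * (4 * M * l1 (W \<tau>)) * (\<Sum>n\<in>A. cmod (W \<tau> n))" by (simp add: sum_distrib_left)
      also have "\<dots> \<le> c * (4 * M * l1 (W \<tau>)) * l1 (W \<tau>)"
        using M0 by (intro mult_left_mono sum_cmod_le_l1 lW A) (auto simp: c_def)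
      also have "\<dots> = 4 * c * M * (l1 (W \<tau>))\<^sup>2" by (simp add: power2_eq_square)
      also have "\<dots> \<le> 4 * c * M * (16 * Hs_norm 0 (W \<tau>) * Hs_norm 1 (W \<tau>))"
        using M0 \<tau> by (intro mult_left_mono l1_sq_le W1) (auto simp: c_def)
      finally show ?thesis by (simp add: D_def)
    qed
    then show "(\<lambda>n. cmod (F \<tau> n * cnj (W \<tau> n))) summable_on UNIV"
      "(\<Sum>\<^sub>\<infinity>n. cmod (F \<tau> n * cnj (W \<tau> n))) \<le> D * Hs_norm 0 (W \<tau>) * Hs_norm 1 (W \<tau>)"
      using nonneg_summable_infsum_leI[of "\<lambda>n. cmod (F \<tau> n * cnj (W \<tau> n))" "D * Hs_norm 0 (W \<tau>) * Hs_norm 1 (W \<tau>)"] by auto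
  qed
  have "exp (- q * (t - 0)) * (Hs_norm 0 (W t))\<^sup>2 \<le> (Hs_norm 0 (W 0))\<^sup>2 + integral {0..t} (\<lambda>\<tau>. exp (- q * (\<tau> - 0)) * 0)"
  proof (rule forced_energy[OF fo t W0 W0 _ FW(1), where h = "\<lambda>\<tau>. (1 + D) * (2 * (Hs_norm 1 (U \<tau>))\<^sup>2 + 2 * (Hs_norm 1 (V \<tau>))\<^sup>2)"])
    have "(\<lambda>\<tau>. (1 + D) *\<^sub>R (2 *\<^sub>R (Hs_norm 1 (U \<tau>))\<^sup>2 + 2 *\<^sub>R (Hs_norm 1 (V \<tau>))\<^sup>2)) integrable_on {0..t}"
      by (intro integrable_cmul integrable_add damped_integrable[OF U'] damped_integrable[OF V']) auto
    then show "(\<lambda>\<tau>. (1 + D) * (2 * (Hs_norm 1 (U \<tau>))\<^sup>2 + 2 * (Hs_norm 1 (V \<tau>))\<^sup>2)) integrable_on {0..t}"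
      by simp
    fix \<tau> assume \<tau>: "\<tau> \<in> {0<..<t}"
    then have p: "0 < \<tau>" by simp
    define x y where "x = Hs_norm 0 (W \<tau>)" and "y = Hs_norm 1 (W \<tau>)"
    have xy: "0 \<le> x" "x \<le> y" using in_Hs_mono(2)[OF W1[OF p], of 0] by (auto simp: x_def y_def)
    show "in_Hs 1 (W \<tau>)" by (rule W1[OF p])
    have "y\<^sup>2 \<le> 2 * (Hs_norm 1 (U \<tau>))\<^sup>2 + 2 * (Hs_norm 1 (V \<tau>))\<^sup>2"
    proof -
      have "y \<le> Hs_norm 1 (U \<tau>) + Hs_norm 1 (V \<tau>)"
        unfolding y_def W_def using p by (intro Hs_diff damped_H1[OF U'] damped_H1[OF V'])
      then have "y\<^sup>2 \<le> (Hs_norm 1 (U \<tau>) + Hs_norm 1 (V \<tau>))\<^sup>2" using xy by (intro power_mono) auto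
      also have "\<dots> \<le> 2 * (Hs_norm 1 (U \<tau>))\<^sup>2 + 2 * (Hs_norm 1 (V \<tau>))\<^sup>2"
        using sum_squares_bound[of "Hs_norm 1 (U \<tau>)" "Hs_norm 1 (V \<tau>)"] by (simp add: power2_sum)
      finally show ?thesis .
    qed
    then have "(1 + D) * y\<^sup>2 \<le> (1 + D) * (2 * (Hs_norm 1 (U \<tau>))\<^sup>2 + 2 * (Hs_norm 1 (V \<tau>))\<^sup>2)"
      using D0 by (intro mult_left_mono) auto
    moreover have "D * x * y \<le> D * y * y" using xy D0 by (intro mult_right_mono mult_left_mono) auto
    ultimately show "(Hs_norm 1 (W \<tau>))\<^sup>2 + (\<Sum>\<^sub>\<infinity>n. cmod (F \<tau> n * cnj (W \<tau> n)))
        \<le> (1 + D) * (2 * (Hs_norm 1 (U \<tau>))\<^sup>2 + 2 * (Hs_norm 1 (V \<tau>))\<^sup>2)"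
      using FW(2)[OF \<tau>] by (simp add: x_def y_def algebra_simps power2_eq_square)
    have "Re (\<Sum>\<^sub>\<infinity>n. F \<tau> n * cnj (W \<tau> n)) \<le> D * x * y"
    proof -
      have "Re (\<Sum>\<^sub>\<infinity>n. F \<tau> n * cnj (W \<tau> n)) \<le> cmod (\<Sum>\<^sub>\<infinity>n. F \<tau> n * cnj (W \<tau> n))" by (rule complex_Re_le_cmod)
      also have "\<dots> \<le> (\<Sum>\<^sub>\<infinity>n. cmod (F \<tau> n * cnj (W \<tau> n)))" by (rule norm_infsum_bound[OF FW(1)[OF \<tau>]])
      also have "\<dots> \<le> D * x * y" using FW(2)[OF \<tau>] by (simp add: x_def y_def)
      finally show ?thesis .
    qed
    moreover have "2 * (D * x * y) \<le> 2 * y\<^sup>2 + D\<^sup>2 / 2 * x\<^sup>2"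
      using zero_le_power2[of "2 * y - D * x"] by (simp add: power2_eq_square algebra_simps)
    moreover have "2 * (Re \<beta> + 1) * x\<^sup>2 \<le> 2 * (\<bar>Re \<beta>\<bar> + 1) * x\<^sup>2" by (intro mult_right_mono) auto
    moreover have "q * x\<^sup>2 = 2 * (\<bar>Re \<beta>\<bar> + 1) * x\<^sup>2 + D\<^sup>2 / 2 * x\<^sup>2"
      by (simp add: q_def lip_rate_def D_def c_def distrib_right)
    ultimately show "2 * (Re \<beta> + 1) * (Hs_norm 0 (W \<tau>))\<^sup>2 - 2 * (Hs_norm 1 (W \<tau>))\<^sup>2
       + 2 * Re (\<Sum>\<^sub>\<infinity>n. F \<tau> n * cnj (W \<tau> n)) \<le> q * (Hs_norm 0 (W \<tau>))\<^sup>2 + 0"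
      unfolding x_def[symmetric] y_def[symmetric] by linarith
  qed (use t in auto)
  then have "exp (- q * t) * (Hs_norm 0 (W t))\<^sup>2 \<le> (Hs_norm 0 (W 0))\<^sup>2" by simp
  then have "(Hs_norm 0 (W t))\<^sup>2 \<le> exp (q * t) * (Hs_norm 0 (W 0))\<^sup>2"
    by (intro le_exp_multI) simp
  also have "\<dots> = (exp (q / 2 * t) * Hs_norm 0 (W 0))\<^sup>2"
    by (simp add: power_mult_distrib power2_eq_square flip: exp_add)
  finally have "Hs_norm 0 (W t) \<le> exp (q / 2 * t) * Hs_norm 0 (W 0)"
    by (rule power2_le_imp_le) simp
  then show ?thesis by (simp add: W_def q_def)
qed

section \<open>Regularity and smoothing\<close>

text \<open>The factor 256 is the square of Agmon's 16; the power of 9 is the constant of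
  \<open>cubic_Hs\<close> in the space of order max (s - 1) 0.\<close>

definition reg_const :: "real \<Rightarrow> real \<Rightarrow> real" where
  "reg_const \<omega> s = 256 * (cmod (1 + \<i> * complex_of_real \<omega>))\<^sup>2 * 9 powr (max (s - 1) 0 + 1)"

lemma reg_const_nonneg: "0 \<le> reg_const \<omega> s"
  by (simp add: reg_const_def)

text \<open>To reach H^s the forcing is needed only in H^(s-1); the order is cut off at 0, where
  \<open>cubic_Hs\<close> applies. The exponential on the initial value is kept: discarding it gives
  persistence of regularity, trading it for a power of time gives smoothing.\<close>

lemma damped_regularity:
  assumes sol: "damped_solution \<gamma> \<omega> \<beta> L \<theta> U" and a: "0 \<le> a" "a \<le> t" and A: "finite A"
    and B: "\<And>\<tau>. \<tau> \<in> {a<..<t} \<Longrightarrow> in_Hs (max (s - 1) 0) (U \<tau>)"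
      "\<And>\<tau>. \<tau> \<in> {a<..<t} \<Longrightarrow> (Hs_norm (max (s - 1) 0) (U \<tau>))\<^sup>2 \<le> B"
    and M: "\<And>\<tau>. \<tau> \<in> {a<..<t} \<Longrightarrow> (Hs_norm 0 (U \<tau>))\<^sup>2 \<le> M"
  shows "sum (Hs_weight s (U t)) A \<le> exp ((2 * \<bar>Re \<beta>\<bar> + 2) * (t - a)) *
     ((\<Sum>n\<in>A. exp (- kap n * (t - a)) * Hs_weight s (U a) n) 
      + reg_const \<omega> s * M * B * integral {a..t} (\<lambda>\<tau>. (Hs_norm 1 (U \<tau>))\<^sup>2))"
proof -
  define m where "m = max (s - 1) 0"
  define c where "c = cmod (1 + \<i> * complex_of_real \<omega>)"
  have "(\<Sum>n\<in>A. kap n powr s * (cmod (U t n))\<^sup>2) \<le> exp ((2 * \<bar>Re \<beta>\<bar> + 2) * (t - a)) *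
     ((\<Sum>n\<in>A. kap n powr s * exp (- kap n * (t - a)) * (cmod (U a n))\<^sup>2) 
      + integral {a..t} (\<lambda>\<tau>. (reg_const \<omega> s * M * B) *\<^sub>R (Hs_norm 1 (U \<tau>))\<^sup>2))"
  proof (rule forced_weighted_bound[OF damped_forced[OF sol a(1)] a(2) A])
    show "(\<lambda>\<tau>. (reg_const \<omega> s * M * B) *\<^sub>R (Hs_norm 1 (U \<tau>))\<^sup>2) integrable_on {a..t}"
      by (intro integrable_cmul damped_integrable[OF sol] a)
    fix \<tau> assume \<tau>: "\<tau> \<in> {a<..<t}"
    then have p: "0 < \<tau>" using a by simp
    define x y b where "x = Hs_norm 0 (U \<tau>)" and "y = Hs_norm 1 (U \<tau>)" and "b = (Hs_norm m (U \<tau>))\<^sup>2"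
    have l: "in_l1 (U \<tau>)" by (rule damped_l1[OF sol p])
    have m: "in_Hs m (U \<tau>)" "0 \<le> m" using B(1)[OF \<tau>] by (auto simp: m_def)
    note cb = cubic_Hs[OF l m]
    have "(\<Sum>n\<in>A. kap n powr s / kap n * (cmod (nonlin \<omega> \<theta> U \<tau> n))\<^sup>2) \<le> (\<Sum>n\<in>A. c\<^sup>2 * Hs_weight m (cubic (U \<tau>)) n)"
    proof (rule sum_mono)
      fix n
      have "kap n powr s / kap n = kap n powr (s - 1)" by (simp add: powr_diff)
      also have "\<dots> \<le> kap n powr m" by (intro powr_mono) (auto simp: m_def)
      finally have 1: "kap n powr s / kap n \<le> kap n powr m" .
      have "cmod (nonlin \<omega> \<theta> U \<tau> n) \<le> c * 1 * cmod (cubic (U \<tau>) n)"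
        using damping_nonneg[OF sol, of \<tau>] damping_le_1[OF sol, of \<tau>]
        unfolding nonlin_def norm_minus_cancel norm_mult c_def by (intro mult_right_mono mult_left_mono) auto
      then have 2: "(cmod (nonlin \<omega> \<theta> U \<tau> n))\<^sup>2 \<le> (c * cmod (cubic (U \<tau>) n))\<^sup>2" by (intro power_mono) auto
      have "kap n powr s / kap n * (cmod (nonlin \<omega> \<theta> U \<tau> n))\<^sup>2 \<le> kap n powr m * (c * cmod (cubic (U \<tau>) n))\<^sup>2"
        by (intro mult_mono 1 2) auto
      then show "kap n powr s / kap n * (cmod (nonlin \<omega> \<theta> U \<tau> n))\<^sup>2 \<le> c\<^sup>2 * Hs_weight m (cubic (U \<tau>)) n"
        by (simp add: Hs_weight_kap power_mult_distrib mult_ac)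
    qed
    also have "\<dots> = c\<^sup>2 * sum (Hs_weight m (cubic (U \<tau>))) A" by (simp add: sum_distrib_left)
    also have "\<dots> \<le> c\<^sup>2 * (9 powr (m + 1) * (l1 (U \<tau>)) ^ 4 * b)"
      unfolding b_def by (intro mult_left_mono order_trans[OF sum_Hs_weight_le[OF cb(1) A] cb(2)]) auto
    also have "\<dots> \<le> c\<^sup>2 * (9 powr (m + 1) * (256 * M * y\<^sup>2) * B)"
    proof (intro mult_left_mono mult_mono)
      have "(l1 (U \<tau>)) ^ 4 = ((l1 (U \<tau>))\<^sup>2)\<^sup>2" by simp
      also have "\<dots> \<le> (16 * x * y)\<^sup>2"
        unfolding x_def y_def by (intro power_mono l1_sq_le damped_H1[OF sol p]) auto
      also have "\<dots> = 256 * x\<^sup>2 * y\<^sup>2" by (simp add: power_mult_distrib)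
      also have "\<dots> \<le> 256 * M * y\<^sup>2" using M[OF \<tau>] by (intro mult_right_mono) (auto simp: x_def)
      finally show "(l1 (U \<tau>)) ^ 4 \<le> 256 * M * y\<^sup>2" .
      show "b \<le> B" using B(2)[OF \<tau>] by (simp add: b_def m_def)
      show "0 \<le> 9 powr (m + 1) * (256 * M * y\<^sup>2)"
        using order_trans[OF zero_le_power2 M[OF \<tau>]] by simp
    qed (auto simp: b_def)
    also have "\<dots> = (reg_const \<omega> s * M * B) *\<^sub>R (Hs_norm 1 (U \<tau>))\<^sup>2"
      by (simp add: reg_const_def c_def y_def m_def)
    finally show "(\<Sum>n\<in>A. kap n powr s / kap n * (cmod (nonlin \<omega> \<theta> U \<tau> n))\<^sup>2) \<le> (reg_const \<omega> s * M * B) *\<^sub>R (Hs_norm 1 (U \<tau>))\<^sup>2" .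
  qed simp
  then show ?thesis by (simp add: Hs_weight_kap mult_ac)
qed

text \<open>The version for finite \<open>A\<close> retains the initial mass on the same set of
  modes. For sets of high frequencies it shows that tails stay small for short times, which yields
  continuity at time 0.\<close>

lemma damped_persistence:
  assumes sol: "damped_solution \<gamma> \<omega> \<beta> L \<theta> U" and a: "0 \<le> a" "a \<le> t"
    and B: "\<And>\<tau>. \<tau> \<in> {a<..<t} \<Longrightarrow> in_Hs (max (s - 1) 0) (U \<tau>)"
      "\<And>\<tau>. \<tau> \<in> {a<..<t} \<Longrightarrow> (Hs_norm (max (s - 1) 0) (U \<tau>))\<^sup>2 \<le> B"
    and M: "\<And>\<tau>. \<tau> \<in> {a<..<t} \<Longrightarrow> (Hs_norm 0 (U \<tau>))\<^sup>2 \<le> M"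
  shows "finite A \<Longrightarrow> sum (Hs_weight s (U t)) A \<le> exp ((2 * \<bar>Re \<beta>\<bar> + 2) * (t - a)) *
     (sum (Hs_weight s (U a)) A + reg_const \<omega> s * M * B * integral {a..t} (\<lambda>\<tau>. (Hs_norm 1 (U \<tau>))\<^sup>2))"
    and "in_Hs s (U a) \<Longrightarrow> in_Hs s (U t)"
    and "in_Hs s (U a) \<Longrightarrow> (Hs_norm s (U t))\<^sup>2 \<le> exp ((2 * \<bar>Re \<beta>\<bar> + 2) * (t - a)) *
     ((Hs_norm s (U a))\<^sup>2 + reg_const \<omega> s * M * B * integral {a..t} (\<lambda>\<tau>. (Hs_norm 1 (U \<tau>))\<^sup>2))"
proof -
  let ?I = "reg_const \<omega> s * M * B * integral {a..t} (\<lambda>\<tau>. (Hs_norm 1 (U \<tau>))\<^sup>2)"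
  show *: "sum (Hs_weight s (U t)) A \<le> exp ((2 * \<bar>Re \<beta>\<bar> + 2) * (t - a)) * (sum (Hs_weight s (U a)) A + ?I)"
    if A: "finite A" for A
  proof -
    have "(\<Sum>n\<in>A. exp (- kap n * (t - a)) * Hs_weight s (U a) n) \<le> sum (Hs_weight s (U a)) A"
      using a by (intro sum_mono) (auto intro!: mult_left_le_one_le)
    then show ?thesis
      by (intro order_trans[OF damped_regularity[OF sol a A B M]] mult_left_mono add_right_mono) auto
  qed
  assume Ha: "in_Hs s (U a)"
  have "sum (Hs_weight s (U t)) A \<le> exp ((2 * \<bar>Re \<beta>\<bar> + 2) * (t - a)) * ((Hs_norm s (U a))\<^sup>2 + ?I)" if A: "finite A" for A
    by (intro order_trans[OF *[OF A]] mult_left_mono add_right_mono sum_Hs_weight_le Ha A) auto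
  then show "in_Hs s (U t)" "(Hs_norm s (U t))\<^sup>2 \<le> exp ((2 * \<bar>Re \<beta>\<bar> + 2) * (t - a)) * ((Hs_norm s (U a))\<^sup>2 + ?I)"
    using in_HsI_sq by blast+
qed

text \<open>Since d exp(-d) \<le> 1 for d = \<open>kap n * (t - a)\<close>, the exponential pays for
  one power of \<open>kap n\<close> at the price 1 / (t - a).\<close>

lemma damped_smoothing_step:
  assumes sol: "damped_solution \<gamma> \<omega> \<beta> L \<theta> U" and a: "0 \<le> a" "a < t" and s: "1 \<le> s"
    and B: "\<And>\<tau>. \<tau> \<in> {a..<t} \<Longrightarrow> in_Hs (s - 1) (U \<tau>)"
      "\<And>\<tau>. \<tau> \<in> {a..<t} \<Longrightarrow> (Hs_norm (s - 1) (U \<tau>))\<^sup>2 \<le> B"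
    and M: "\<And>\<tau>. \<tau> \<in> {a<..<t} \<Longrightarrow> (Hs_norm 0 (U \<tau>))\<^sup>2 \<le> M"
  shows "in_Hs s (U t)"
    and "(Hs_norm s (U t))\<^sup>2 \<le> exp ((2 * \<bar>Re \<beta>\<bar> + 2) * (t - a)) *
     (B / (t - a) + reg_const \<omega> s * M * B * integral {a..t} (\<lambda>\<tau>. (Hs_norm 1 (U \<tau>))\<^sup>2))"
proof -
  let ?I = "reg_const \<omega> s * M * B * integral {a..t} (\<lambda>\<tau>. (Hs_norm 1 (U \<tau>))\<^sup>2)"
  have ms: "max (s - 1) 0 = s - 1" using s by simp
  have "sum (Hs_weight s (U t)) A \<le> exp ((2 * \<bar>Re \<beta>\<bar> + 2) * (t - a)) * (B / (t - a) + ?I)" if A: "finite A" for A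
  proof -
    have "(\<Sum>n\<in>A. exp (- kap n * (t - a)) * Hs_weight s (U a) n) \<le> (\<Sum>n\<in>A. Hs_weight (s - 1) (U a) n / (t - a))"
    proof (rule sum_mono)
      fix n
      define d where "d = kap n * (t - a)"
      have d: "0 < d" using a by (simp add: d_def)
      have "d \<le> exp d" using exp_ge_add_one_self[of d] by linarith
      then have "d * exp (- d) \<le> 1" by (simp add: exp_minus field_simps)
      then have "exp (- d) * kap n \<le> 1 / (t - a)" using a by (simp add: d_def field_simps)
      then have "exp (- d) * kap n * (kap n powr (s - 1) * (cmod (U a n))\<^sup>2) \<le> 1 / (t - a) * (kap n powr (s - 1) * (cmod (U a n))\<^sup>2)"
        by (intro mult_right_mono) auto
      moreover have "kap n powr s = kap n * kap n powr (s - 1)" by (simp add: powr_diff)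
      ultimately show "exp (- kap n * (t - a)) * Hs_weight s (U a) n \<le> Hs_weight (s - 1) (U a) n / (t - a)"
        by (simp add: Hs_weight_kap d_def mult_ac)
    qed
    also have "\<dots> = sum (Hs_weight (s - 1) (U a)) A / (t - a)" by (simp add: sum_divide_distrib)
    also have "\<dots> \<le> B / (t - a)"
      using a by (intro divide_right_mono order_trans[OF sum_Hs_weight_le[OF B(1) A] B(2)]) auto
    finally have "(\<Sum>n\<in>A. exp (- kap n * (t - a)) * Hs_weight s (U a) n) \<le> B / (t - a)" .
    then show ?thesis
      using a B M by (intro order_trans[OF damped_regularity[OF sol _ _ A, where M = M and B = B]] mult_left_mono add_right_mono) (auto simp: ms)
  qed
  then show "in_Hs s (U t)" "(Hs_norm s (U t))\<^sup>2 \<le> exp ((2 * \<bar>Re \<beta>\<bar> + 2) * (t - a)) * (B / (t - a) + ?I)"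
    using in_HsI_sq by blast+
qed

lemma solution_H1_integral:
  assumes sol: "is_solution \<gamma> \<omega> \<beta> L U" and a: "0 \<le> a" "a \<le> t" "t \<le> a + 1" and M: "(Hs_norm 0 (U a))\<^sup>2 \<le> M"
  shows "integral {a..t} (\<lambda>\<tau>. (Hs_norm 1 (U \<tau>))\<^sup>2) \<le> (1 + 2 * (\<bar>Re \<beta>\<bar> + 1) * exp (2 * \<bar>Re \<beta>\<bar>)) * M"
proof -
  have "integral {a..t} (\<lambda>\<tau>. (Hs_norm 1 (U \<tau>))\<^sup>2) \<le>
     (1 + 2 * (\<bar>Re \<beta>\<bar> + 1) * exp (2 * \<bar>Re \<beta>\<bar> * (t - a)) * (t - a)) * (Hs_norm 0 (U a))\<^sup>2"
    using damped_H1_integral[OF sol[unfolded is_solution_damped] a(1,2)] .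
  also have "\<dots> \<le> (1 + 2 * (\<bar>Re \<beta>\<bar> + 1) * exp (2 * \<bar>Re \<beta>\<bar> * 1) * 1) * M"
    using a M by (intro mult_mono add_left_mono mult_left_mono) (auto intro!: mult_left_le add_nonneg_nonneg mult_nonneg_nonneg)
  finally show ?thesis by simp
qed

text \<open>One derivative per induction step: the bound of order \<open>k\<close> is applied on the
  second half of the interval, where at least half of the elapsed time is available, and
  \<open>damped_smoothing_step\<close> starts from the midpoint. \<open>B\<close> is chosen before
  \<open>L\<close>, the solution and the times.\<close>

lemma solution_smoothing_unit:
  "\<exists>B\<ge>0. \<forall>L U a t. is_solution \<gamma> \<omega> \<beta> L U \<and> 0 \<le> a \<and> a < t \<and> t \<le> a + 1 \<and> Hs_norm 0 (U a) \<le> R \<longrightarrow>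
     in_Hs (real k) (U t) \<and> (Hs_norm (real k) (U t))\<^sup>2 \<le> B * (1 / (t - a)) ^ k"
proof (induction k)
  case 0
  show ?case
  proof (intro exI[of _ "R\<^sup>2 + absorb \<beta>"] conjI allI impI)
    fix L U a t assume *: "is_solution \<gamma> \<omega> \<beta> L U \<and> 0 \<le> a \<and> a < t \<and> t \<le> a + 1 \<and> Hs_norm 0 (U a) \<le> R"
    then show "in_Hs (real 0) (U t)" by (auto simp: is_solution_def)
    have "(Hs_norm 0 (U t))\<^sup>2 \<le> (Hs_norm 0 (U a))\<^sup>2 + absorb \<beta>" using * by (intro solution_H_bound) auto
    also have "\<dots> \<le> R\<^sup>2 + absorb \<beta>" using * by (intro add_right_mono power_mono) auto
    finally show "(Hs_norm (real 0) (U t))\<^sup>2 \<le> (R\<^sup>2 + absorb \<beta>) * (1 / (t - a)) ^ 0" by simp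
  qed (simp add: absorb_nonneg)
next
  case (Suc k)
  then obtain B where B: "0 \<le> B" "\<And>L U a t. is_solution \<gamma> \<omega> \<beta> L U \<Longrightarrow> 0 \<le> a \<Longrightarrow> a < t \<Longrightarrow> t \<le> a + 1 \<Longrightarrow> Hs_norm 0 (U a) \<le> R \<Longrightarrow>
     in_Hs (real k) (U t) \<and> (Hs_norm (real k) (U t))\<^sup>2 \<le> B * (1 / (t - a)) ^ k" by blast
  define M where "M = R\<^sup>2 + absorb \<beta>"
  define I where "I = (1 + 2 * (\<bar>Re \<beta>\<bar> + 1) * exp (2 * \<bar>Re \<beta>\<bar>)) * M"
  define K where "K = reg_const \<omega> (real (Suc k)) * M"
  have M0: "0 \<le> M" by (simp add: M_def absorb_nonneg)
  have I0: "0 \<le> I" using M0 by (auto simp: I_def intro!: mult_nonneg_nonneg add_nonneg_nonneg)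
  have K0: "0 \<le> K" using M0 by (simp add: K_def reg_const_nonneg)
  \<comment> \<open>The power of 2 comes from evaluating the induction hypothesis after half the
    time, the summand 2 from 1 / (t - b) = 2 / d, and \<open>K * I\<close> from the cubic
    forcing.\<close>
  define C where "C = exp (2 * \<bar>Re \<beta>\<bar> + 2) * (B * 2 ^ k * (2 + K * I))"
  show ?case
  proof (intro exI[of _ C] conjI allI impI)
    show "0 \<le> C" using B(1) K0 I0 by (simp add: C_def)
    fix L U a t assume *: "is_solution \<gamma> \<omega> \<beta> L U \<and> 0 \<le> a \<and> a < t \<and> t \<le> a + 1 \<and> Hs_norm 0 (U a) \<le> R"
    then have sol: "is_solution \<gamma> \<omega> \<beta> L U" and a: "0 \<le> a" "a < t" "t \<le> a + 1" and R: "Hs_norm 0 (U a) \<le> R" by auto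
    define d b where "d = t - a" and "b = (a + t) / 2"
    have d: "0 < d" "d \<le> 1" and tb: "t - b = d / 2" and b: "0 \<le> b" "a < b" "b < t" using a by (auto simp: d_def b_def field_simps)
    define B' where "B' = B * (2 / d) ^ k"
    have B'0: "0 \<le> B'" using B(1) d by (simp add: B'_def)
    have Mb: "(Hs_norm 0 (U \<tau>))\<^sup>2 \<le> M" if "a \<le> \<tau>" for \<tau>
    proof -
      have "(Hs_norm 0 (U a))\<^sup>2 \<le> R\<^sup>2" using R by (intro power_mono) auto
      then show ?thesis using solution_H_bound[OF sol a(1) that] by (simp add: M_def)
    qed
    have Bk: "in_Hs (real k) (U \<tau>) \<and> (Hs_norm (real k) (U \<tau>))\<^sup>2 \<le> B'" if \<tau>: "\<tau> \<in> {b..<t}" for \<tau>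
    proof -
      have "in_Hs (real k) (U \<tau>) \<and> (Hs_norm (real k) (U \<tau>))\<^sup>2 \<le> B * (1 / (\<tau> - a)) ^ k"
        using \<tau> a b R by (intro B(2)[OF sol]) auto
      moreover have "B * (1 / (\<tau> - a)) ^ k \<le> B * (2 / d) ^ k"
      proof (intro mult_left_mono power_mono B)
        have "d / 2 \<le> \<tau> - a" using \<tau> by (auto simp: d_def b_def field_simps)
        then have "1 / (\<tau> - a) \<le> 1 / (d / 2)" using d by (intro divide_left_mono) auto
        then show "1 / (\<tau> - a) \<le> 2 / d" by simp
      qed (use \<tau> b in auto)
      ultimately show ?thesis by (auto simp: B'_def)
    qed
    have sk: "real (Suc k) - 1 = real k" by simp
    note step = damped_smoothing_step[OF sol[unfolded is_solution_damped] b(1,3), of "real (Suc k)" B' M, unfolded sk]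
    show "in_Hs (real (Suc k)) (U t)" using Bk Mb b by (intro step(1)) auto
    have "(Hs_norm (real (Suc k)) (U t))\<^sup>2 \<le> exp ((2 * \<bar>Re \<beta>\<bar> + 2) * (t - b)) *
     (B' / (t - b) + K * B' * integral {b..t} (\<lambda>\<tau>. (Hs_norm 1 (U \<tau>))\<^sup>2))"
      unfolding K_def using Bk Mb b by (intro step(2)) auto
    also have "\<dots> \<le> exp (2 * \<bar>Re \<beta>\<bar> + 2) * (B' * (2 / d) + K * B' * (I / d))"
    proof (intro mult_mono add_mono)
      show "exp ((2 * \<bar>Re \<beta>\<bar> + 2) * (t - b)) \<le> exp (2 * \<bar>Re \<beta>\<bar> + 2)" using tb d by (auto intro!: mult_left_le)
      have "integral {b..t} (\<lambda>\<tau>. (Hs_norm 1 (U \<tau>))\<^sup>2) \<le> I"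
        unfolding I_def using b a by (intro solution_H1_integral[OF sol] Mb) auto
      \<comment> \<open>Weakened, as d \<le> 1, so that both summands carry the same power of 1 /
        d.\<close>
      also have "\<dots> \<le> I / d" using I0 d by (simp add: pos_le_divide_eq mult_left_le)
      finally show "integral {b..t} (\<lambda>\<tau>. (Hs_norm 1 (U \<tau>))\<^sup>2) \<le> I / d" .
      show "0 \<le> integral {b..t} (\<lambda>\<tau>. (Hs_norm 1 (U \<tau>))\<^sup>2)"
        by (intro integral_nonneg damped_integrable[OF sol[unfolded is_solution_damped]] b) auto
      then show "0 \<le> B' / (t - b) + K * B' * integral {b..t} (\<lambda>\<tau>. (Hs_norm 1 (U \<tau>))\<^sup>2)"
        using B'0 K0 b by simp
      show "B' / (t - b) \<le> B' * (2 / d)" unfolding tb by simp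
    qed (use B'0 K0 d in auto)
    also have "\<dots> = C * (1 / d) ^ Suc k"
      using d by (simp add: C_def B'_def power_divide field_simps)
    finally show "(Hs_norm (real (Suc k)) (U t))\<^sup>2 \<le> C * (1 / (t - a)) ^ Suc k" by (simp add: d_def)
  qed
qed

text \<open>For longer times the unit estimate is restarted at t - 1, where the dissipative bound
  still controls the H norm by \<open>R\<close>; this keeps the constant independent of the elapsed
  time.\<close>

lemma solution_smoothing:
  "\<exists>B\<ge>0. \<forall>L U a t. is_solution \<gamma> \<omega> \<beta> L U \<and> 0 \<le> a \<and> a < t \<and> Hs_norm 0 (U a) \<le> R \<longrightarrow>
     in_Hs (real k) (U t) \<and> (Hs_norm (real k) (U t))\<^sup>2 \<le> B * (1 + (1 / (t - a)) ^ k)"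
proof -
  obtain B1 where B1: "0 \<le> B1" "\<And>L U a t. is_solution \<gamma> \<omega> \<beta> L U \<Longrightarrow> 0 \<le> a \<Longrightarrow> a < t \<Longrightarrow> t \<le> a + 1 \<Longrightarrow> Hs_norm 0 (U a) \<le> R \<Longrightarrow>
     in_Hs (real k) (U t) \<and> (Hs_norm (real k) (U t))\<^sup>2 \<le> B1 * (1 / (t - a)) ^ k"
    using solution_smoothing_unit[of \<gamma> \<omega> \<beta> R k] by blast
  obtain B2 where B2: "0 \<le> B2" "\<And>L U a t. is_solution \<gamma> \<omega> \<beta> L U \<Longrightarrow> 0 \<le> a \<Longrightarrow> a < t \<Longrightarrow> t \<le> a + 1 \<Longrightarrow> Hs_norm 0 (U a) \<le> sqrt (R\<^sup>2 + absorb \<beta>) \<Longrightarrow>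
     in_Hs (real k) (U t) \<and> (Hs_norm (real k) (U t))\<^sup>2 \<le> B2 * (1 / (t - a)) ^ k"
    using solution_smoothing_unit[of \<gamma> \<omega> \<beta> "sqrt (R\<^sup>2 + absorb \<beta>)" k] by blast
  show ?thesis
  proof (intro exI[of _ "B1 + B2"] conjI allI impI)
    show "0 \<le> B1 + B2" using B1 B2 by simp
    fix L U a t assume *: "is_solution \<gamma> \<omega> \<beta> L U \<and> 0 \<le> a \<and> a < t \<and> Hs_norm 0 (U a) \<le> R"
    define z where "z = (1 / (t - a)) ^ k"
    have z: "0 \<le> z" using * by (simp add: z_def)
    have "in_Hs (real k) (U t) \<and> (Hs_norm (real k) (U t))\<^sup>2 \<le> (B1 + B2) * (1 + z)"
    proof (cases "t \<le> a + 1")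
      case True
      then have "in_Hs (real k) (U t) \<and> (Hs_norm (real k) (U t))\<^sup>2 \<le> B1 * z"
        unfolding z_def using * by (intro B1(2)[of L]) auto
      moreover have "B1 * z \<le> (B1 + B2) * (1 + z)" using B1 B2 z by (intro mult_mono) auto
      ultimately show ?thesis by linarith
    next
      case False
      have "(Hs_norm 0 (U (t - 1)))\<^sup>2 \<le> (Hs_norm 0 (U a))\<^sup>2 + absorb \<beta>"
        using * False by (intro solution_H_bound) auto
      also have "\<dots> \<le> R\<^sup>2 + absorb \<beta>" using * by (intro add_right_mono power_mono) auto
      finally have "Hs_norm 0 (U (t - 1)) \<le> sqrt (R\<^sup>2 + absorb \<beta>)" by (rule real_le_rsqrt)
      then have "in_Hs (real k) (U t) \<and> (Hs_norm (real k) (U t))\<^sup>2 \<le> B2 * (1 / (t - (t - 1))) ^ k"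
        using * False by (intro B2(2)[of L]) auto
      moreover have "B2 * 1 \<le> (B1 + B2) * (1 + z)" using B1 B2 z by (intro mult_mono) auto
      ultimately show ?thesis by simp
    qed
    then show "in_Hs (real k) (U t)" "(Hs_norm (real k) (U t))\<^sup>2 \<le> (B1 + B2) * (1 + (1 / (t - a)) ^ k)"
      by (auto simp: z_def)
  qed
qed

text \<open>The order \<open>s\<close> is real, so the induction runs over a natural upper bound:
  each step lowers the order to max (s - 1) 0 and reaches H, where the energy bound applies.\<close>

lemma solution_persistence_aux:
  "0 \<le> s \<Longrightarrow> s \<le> real k \<Longrightarrow> \<exists>B\<ge>0. \<forall>L U a t. is_solution \<gamma> \<omega> \<beta> L U \<and> 0 \<le> a \<and> a \<le> t \<and> t \<le> a + 1 \<and> in_Hs s (U a) \<and> Hs_norm s (U a) \<le> R \<longrightarrow>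
     in_Hs s (U t) \<and> (Hs_norm s (U t))\<^sup>2 \<le> B"
proof (induction k arbitrary: s)
  case 0
  then have s: "s = 0" by simp
  show ?case unfolding s
  proof (intro exI[of _ "R\<^sup>2 + absorb \<beta>"] conjI allI impI)
    fix L U a t assume *: "is_solution \<gamma> \<omega> \<beta> L U \<and> 0 \<le> a \<and> a \<le> t \<and> t \<le> a + 1 \<and> in_Hs 0 (U a) \<and> Hs_norm 0 (U a) \<le> R"
    then show "in_Hs 0 (U t)" by (auto simp: is_solution_def)
    have "(Hs_norm 0 (U t))\<^sup>2 \<le> (Hs_norm 0 (U a))\<^sup>2 + absorb \<beta>" using * by (intro solution_H_bound) auto
    also have "\<dots> \<le> R\<^sup>2 + absorb \<beta>" using * by (intro add_right_mono power_mono) auto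
    finally show "(Hs_norm 0 (U t))\<^sup>2 \<le> R\<^sup>2 + absorb \<beta>" .
  qed (simp add: absorb_nonneg)
next
  case (Suc k)
  define m where "m = max (s - 1) 0"
  have m: "0 \<le> m" "m \<le> real k" "m \<le> s" using Suc.prems by (auto simp: m_def)
  obtain B where B: "0 \<le> B" "\<And>L U a t. is_solution \<gamma> \<omega> \<beta> L U \<Longrightarrow> 0 \<le> a \<Longrightarrow> a \<le> t \<Longrightarrow> t \<le> a + 1 \<Longrightarrow> in_Hs m (U a) \<Longrightarrow> Hs_norm m (U a) \<le> R \<Longrightarrow>
     in_Hs m (U t) \<and> (Hs_norm m (U t))\<^sup>2 \<le> B" using Suc.IH[OF m(1,2)] by blast
  define M where "M = R\<^sup>2 + absorb \<beta>"
  define I where "I = (1 + 2 * (\<bar>Re \<beta>\<bar> + 1) * exp (2 * \<bar>Re \<beta>\<bar>)) * M"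
  have M0: "0 \<le> M" by (simp add: M_def absorb_nonneg)
  have I0: "0 \<le> I" using M0 by (auto simp: I_def intro!: mult_nonneg_nonneg add_nonneg_nonneg)
  define K where "K = reg_const \<omega> s * M * B"
  have K0: "0 \<le> K" using M0 B by (simp add: K_def reg_const_nonneg)
  define C where "C = exp (2 * \<bar>Re \<beta>\<bar> + 2) * (R\<^sup>2 + K * I)"
  show ?case
  proof (intro exI[of _ C] conjI allI impI)
    show "0 \<le> C" using K0 I0 by (simp add: C_def)
    fix L U a t assume *: "is_solution \<gamma> \<omega> \<beta> L U \<and> 0 \<le> a \<and> a \<le> t \<and> t \<le> a + 1 \<and> in_Hs s (U a) \<and> Hs_norm s (U a) \<le> R"
    then have sol: "is_solution \<gamma> \<omega> \<beta> L U" and a: "0 \<le> a" "a \<le> t" "t \<le> a + 1" and R: "in_Hs s (U a)" "Hs_norm s (U a) \<le> R" by auto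
    have R0: "Hs_norm 0 (U a) \<le> R" using in_Hs_mono(2)[OF R(1) Suc.prems(1)] R(2) by simp
    have Mb: "(Hs_norm 0 (U \<tau>))\<^sup>2 \<le> M" if "a \<le> \<tau>" for \<tau>
    proof -
      have "(Hs_norm 0 (U a))\<^sup>2 \<le> R\<^sup>2" using R0 by (intro power_mono) auto
      then show ?thesis using solution_H_bound[OF sol a(1) that] by (simp add: M_def)
    qed
    have Bm: "in_Hs m (U \<tau>) \<and> (Hs_norm m (U \<tau>))\<^sup>2 \<le> B" if "\<tau> \<in> {a<..<t}" for \<tau>
      using that a in_Hs_mono[OF R(1) m(3)] R(2) by (intro B(2)[OF sol]) auto
    note p = damped_persistence[OF sol[unfolded is_solution_damped] a(1,2), of s B M, folded m_def K_def]
    show "in_Hs s (U t)" using Bm Mb R by (intro p(2)) auto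
    have "(Hs_norm s (U t))\<^sup>2 \<le> exp ((2 * \<bar>Re \<beta>\<bar> + 2) * (t - a)) * ((Hs_norm s (U a))\<^sup>2 + K * integral {a..t} (\<lambda>\<tau>. (Hs_norm 1 (U \<tau>))\<^sup>2))"
      using Bm Mb R by (intro p(3)) auto
    also have "\<dots> \<le> exp (2 * \<bar>Re \<beta>\<bar> + 2) * (R\<^sup>2 + K * I)"
    proof (intro mult_mono add_mono mult_left_mono power_mono)
      show "exp ((2 * \<bar>Re \<beta>\<bar> + 2) * (t - a)) \<le> exp (2 * \<bar>Re \<beta>\<bar> + 2)" using a by (auto intro!: mult_left_le)
      show "integral {a..t} (\<lambda>\<tau>. (Hs_norm 1 (U \<tau>))\<^sup>2) \<le> I"
        unfolding I_def using a by (intro solution_H1_integral[OF sol] Mb) auto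
      show "0 \<le> integral {a..t} (\<lambda>\<tau>. (Hs_norm 1 (U \<tau>))\<^sup>2)"
        by (intro integral_nonneg damped_integrable[OF sol[unfolded is_solution_damped]] a) auto
      then show "0 \<le> (Hs_norm s (U a))\<^sup>2 + K * integral {a..t} (\<lambda>\<tau>. (Hs_norm 1 (U \<tau>))\<^sup>2)" using K0 by simp
    qed (use K0 R in auto)
    finally show "(Hs_norm s (U t))\<^sup>2 \<le> C" by (simp add: C_def)
  qed
qed

lemma solution_persistence:
  assumes "0 \<le> s"
  shows "\<exists>B\<ge>0. \<forall>L U a t. is_solution \<gamma> \<omega> \<beta> L U \<and> 0 \<le> a \<and> a \<le> t \<and> t \<le> a + 1 \<and> in_Hs s (U a) \<and> Hs_norm s (U a) \<le> R \<longrightarrow>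
     in_Hs s (U t) \<and> (Hs_norm s (U t))\<^sup>2 \<le> B"
  by (rule solution_persistence_aux[OF assms real_nat_ceiling_ge])

section \<open>Uniform estimates in Sobolev spaces\<close>

text \<open>Modewise convergence plus uniformly small tails. Tails are expressed through finite sets
  avoiding \<open>A0\<close>, the form in which the finite-mode estimates deliver them.\<close>

lemma Hs_tendsto_0I:
  assumes modes: "\<And>n. ((\<lambda>x. V x n) \<longlongrightarrow> v n) F"
    and tails: "\<And>e. 0 < e \<Longrightarrow> \<exists>A0. finite A0 \<and> (\<forall>\<^sub>F x in F. \<forall>A. finite A \<and> A \<inter> A0 = {} \<longrightarrow> sum (Hs_weight s (V x - v)) A \<le> e)"
  shows "((\<lambda>x. Hs_norm s (V x - v)) \<longlongrightarrow> 0) F"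
proof -
  have "((\<lambda>x. (Hs_norm s (V x - v))\<^sup>2) \<longlongrightarrow> 0) F"
  proof (rule order_tendstoI)
    fix e :: real assume e: "0 < e"
    then obtain A0 where A0: "finite A0" "\<forall>\<^sub>F x in F. \<forall>A. finite A \<and> A \<inter> A0 = {} \<longrightarrow> sum (Hs_weight s (V x - v)) A \<le> e / 3"
      using tails[of "e / 3"] by auto
    have "((\<lambda>x. \<Sum>n\<in>A0. kap n powr s * (cmod (V x n - v n))\<^sup>2) \<longlongrightarrow> (\<Sum>n\<in>A0. kap n powr s * (cmod (v n - v n))\<^sup>2)) F"
      by (intro tendsto_intros modes)
    then have "((\<lambda>x. sum (Hs_weight s (V x - v)) A0) \<longlongrightarrow> 0) F"
      by (simp add: Hs_weight_kap)
    then have "\<forall>\<^sub>F x in F. sum (Hs_weight s (V x - v)) A0 < e / 3"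
      using e by (intro order_tendstoD(2)) auto
    with A0(2) show "\<forall>\<^sub>F x in F. (Hs_norm s (V x - v))\<^sup>2 < e"
    proof eventually_elim
      case (elim x)
      have "(Hs_norm s (V x - v))\<^sup>2 \<le> e / 3 + e / 3"
      proof (rule in_HsI_sq(2))
        fix A :: "int set" assume A: "finite A"
        have "sum (Hs_weight s (V x - v)) A = sum (Hs_weight s (V x - v)) (A \<inter> A0) + sum (Hs_weight s (V x - v)) (A - A0)"
          using A by (simp add: sum.Int_Diff)
        also have "sum (Hs_weight s (V x - v)) (A \<inter> A0) \<le> sum (Hs_weight s (V x - v)) A0"
          using A0(1) by (intro sum_mono2) auto
        also have "\<dots> \<le> e / 3" using elim by simp
        also have "sum (Hs_weight s (V x - v)) (A - A0) \<le> e / 3"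
          by (rule elim(1)[rule_format]) (use A in auto)
        finally show "sum (Hs_weight s (V x - v)) A \<le> e / 3 + e / 3" by simp
      qed
      then show ?case using e by linarith
    qed
  next
    fix e :: real assume "e < 0"
    then show "\<forall>\<^sub>F x in F. e < (Hs_norm s (V x - v))\<^sup>2" 
      by (intro always_eventually allI) (rule less_le_trans[OF _ zero_le_power2])
  qed
  from tendsto_real_sqrt[OF this] show ?thesis by simp
qed

lemma Hs_tendsto_0_interpolate:
  assumes lim: "((\<lambda>x. Hs_norm 0 (V x)) \<longlongrightarrow> 0) F" and s: "0 \<le> s"
    and ev: "\<forall>\<^sub>F x in F. in_Hs (2 * s) (V x) \<and> Hs_norm (2 * s) (V x) \<le> C"
  shows "((\<lambda>x. Hs_norm s (V x)) \<longlongrightarrow> 0) F"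
proof (rule Lim_null_comparison)
  have "((\<lambda>x. sqrt (Hs_norm 0 (V x) * C)) \<longlongrightarrow> sqrt (0 * C)) F" by (intro tendsto_intros lim)
  then show "((\<lambda>x. sqrt (Hs_norm 0 (V x) * C)) \<longlongrightarrow> 0) F" by simp
  show "\<forall>\<^sub>F x in F. norm (Hs_norm s (V x)) \<le> sqrt (Hs_norm 0 (V x) * C)"
    using ev
  proof eventually_elim
    case (elim x)
    have "(Hs_norm s (V x))\<^sup>2 \<le> Hs_norm 0 (V x) * Hs_norm (2 * s) (V x)"
      using elim s by (intro Hs_norm_interpolate) auto
    also have "\<dots> \<le> Hs_norm 0 (V x) * C" using elim by (intro mult_left_mono) auto
    finally show ?case by (simp add: real_le_rsqrt)
  qed
qed

lemma solution_smoothing_real: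
  assumes "0 \<le> s"
  obtains B where "0 \<le> B" "\<And>L U a t. is_solution \<gamma> \<omega> \<beta> L U \<Longrightarrow> 0 \<le> a \<Longrightarrow> a < t \<Longrightarrow> Hs_norm 0 (U a) \<le> R \<Longrightarrow>
     in_Hs s (U t) \<and> (Hs_norm s (U t))\<^sup>2 \<le> B * (1 + (1 / (t - a)) ^ nat \<lceil>s\<rceil>)"
proof -
  define k where "k = nat \<lceil>s\<rceil>"
  have sk: "s \<le> real k" by (simp add: k_def real_nat_ceiling_ge)
  obtain B where B: "0 \<le> B" "\<And>L U a t. is_solution \<gamma> \<omega> \<beta> L U \<Longrightarrow> 0 \<le> a \<Longrightarrow> a < t \<Longrightarrow> Hs_norm 0 (U a) \<le> R \<Longrightarrow>
     in_Hs (real k) (U t) \<and> (Hs_norm (real k) (U t))\<^sup>2 \<le> B * (1 + (1 / (t - a)) ^ k)"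
    using solution_smoothing[of \<gamma> \<omega> \<beta> R k] by blast
  have "in_Hs s (U t) \<and> (Hs_norm s (U t))\<^sup>2 \<le> B * (1 + (1 / (t - a)) ^ k)"
    if "is_solution \<gamma> \<omega> \<beta> L U" "0 \<le> a" "a < t" "Hs_norm 0 (U a) \<le> R" for L U a t
  proof -
    note b = B(2)[OF that]
    have "(Hs_norm s (U t))\<^sup>2 \<le> (Hs_norm (real k) (U t))\<^sup>2"
      using in_Hs_mono(2)[of "real k" "U t" s] b sk by (intro power_mono) auto
    then show ?thesis using b in_Hs_mono(1)[of "real k" "U t" s] sk by (meson order_trans)
  qed
  then show ?thesis using that B(1) unfolding k_def by blast
qed

lemma solution_in_Hs:
  assumes "is_solution \<gamma> \<omega> \<beta> L U" "0 < t" "0 \<le> s"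
  shows "in_Hs s (U t)"
  using solution_smoothing_real[OF assms(3), of \<gamma> \<omega> \<beta> "Hs_norm 0 (U 0)"] assms(1,2) by (metis order_refl)

lemma solution_Hs_continuous:
  assumes sol: "is_solution \<gamma> \<omega> \<beta> L U" and s: "0 \<le> s" and U0: "in_Hs s (U 0)" and t0: "0 \<le> t0"
  shows "((\<lambda>t. Hs_norm s (U t - U t0)) \<longlongrightarrow> 0) (at t0 within {0..})"
proof (cases "t0 = 0")
  case False
  then have p: "0 < t0" using t0 by simp
  define k where "k = nat \<lceil>2 * s\<rceil>"
  define R where "R = Hs_norm 0 (U 0)"
  have s2: "0 \<le> 2 * s" using s by simp
  obtain B where B: "0 \<le> B" "\<And>L U a t. is_solution \<gamma> \<omega> \<beta> L U \<Longrightarrow> 0 \<le> a \<Longrightarrow> a < t \<Longrightarrow> Hs_norm 0 (U a) \<le> R \<Longrightarrow>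
     in_Hs (2 * s) (U t) \<and> (Hs_norm (2 * s) (U t))\<^sup>2 \<le> B * (1 + (1 / (t - a)) ^ k)"
    using solution_smoothing_real[OF s2, of \<gamma> \<omega> \<beta> R] unfolding k_def by metis
  define D where "D = sqrt (B * (1 + (2 / t0) ^ k))"
  have bd: "in_Hs (2 * s) (U t) \<and> Hs_norm (2 * s) (U t) \<le> D" if "t0 / 2 < t" for t
  proof -
    have tp: "0 < t" using that p by linarith
    have b: "in_Hs (2 * s) (U t)" "(Hs_norm (2 * s) (U t))\<^sup>2 \<le> B * (1 + (1 / (t - 0)) ^ k)"
      using B(2)[OF sol, of 0 t] tp by (auto simp: R_def)
    have "1 / t \<le> 2 / t0" using that p tp by (simp add: field_simps)
    then have "(1 / t) ^ k \<le> (2 / t0) ^ k" using tp by (intro power_mono) auto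
    then have "B * (1 + (1 / (t - 0)) ^ k) \<le> B * (1 + (2 / t0) ^ k)" using B(1) by (intro mult_left_mono) auto
    with b show ?thesis unfolding D_def by (auto intro: real_le_rsqrt)
  qed
  show ?thesis
  proof (rule Hs_tendsto_0_interpolate[OF _ s, where C = "D + D"])
    show "((\<lambda>t. Hs_norm 0 (U t - U t0)) \<longlongrightarrow> 0) (at t0 within {0..})"
      using sol t0 by (simp add: is_solution_def)
    have "\<forall>\<^sub>F t in at t0 within {0..}. t0 / 2 < t"
      using p order_tendstoD(1)[OF tendsto_ident_at, of "t0 / 2" t0 "{0..}"] by simp
    then show "\<forall>\<^sub>F t in at t0 within {0..}. in_Hs (2 * s) (U t - U t0) \<and> Hs_norm (2 * s) (U t - U t0) \<le> D + D"
    proof eventually_elim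
      case (elim t)
      note 1 = bd[OF elim] and 2 = bd[of t0]
      show ?case using 1 2 p Hs_diff[of "2 * s" "U t" "U t0"] by fastforce
    qed
  qed
next
  case True
  define F where "F = at (0::real) within {0..}"
  define m where "m = max (s - 1) 0"
  define R where "R = Hs_norm s (U 0)"
  have m: "0 \<le> m" "m \<le> s" using s by (auto simp: m_def)
  obtain B where B: "0 \<le> B" "\<And>L U a t. is_solution \<gamma> \<omega> \<beta> L U \<Longrightarrow> 0 \<le> a \<Longrightarrow> a \<le> t \<Longrightarrow> t \<le> a + 1 \<Longrightarrow> in_Hs m (U a) \<Longrightarrow> Hs_norm m (U a) \<le> R \<Longrightarrow>
     in_Hs m (U t) \<and> (Hs_norm m (U t))\<^sup>2 \<le> B" using solution_persistence[OF m(1), of \<gamma> \<omega> \<beta> R] by blast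
  define M where "M = (Hs_norm 0 (U 0))\<^sup>2 + absorb \<beta>"
  define K where "K = reg_const \<omega> s * M * B"
  have K0: "0 \<le> K" using B absorb_nonneg[of \<beta>] by (simp add: K_def M_def reg_const_nonneg)
  define I where "I t = integral {0..t} (\<lambda>\<tau>. (Hs_norm 1 (U \<tau>))\<^sup>2)" for t
  define E where "E = exp (2 * \<bar>Re \<beta>\<bar> + 2)"
  have E1: "1 \<le> E" by (simp add: E_def)
  have tail: "sum (Hs_weight s (U t)) A \<le> E * (sum (Hs_weight s (U 0)) A + K * I t)" if t: "0 \<le> t" "t \<le> 1" and A: "finite A" for t A
  proof -
    have "sum (Hs_weight s (U t)) A \<le> exp ((2 * \<bar>Re \<beta>\<bar> + 2) * (t - 0)) *
     (sum (Hs_weight s (U 0)) A + reg_const \<omega> s * M * B * integral {0..t} (\<lambda>\<tau>. (Hs_norm 1 (U \<tau>))\<^sup>2))"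
    proof (rule damped_persistence(1)[OF sol[unfolded is_solution_damped] order_refl t(1) _ _ _ A])
      fix \<tau> assume \<tau>: "\<tau> \<in> {0<..<t}"
      have "in_Hs m (U \<tau>) \<and> (Hs_norm m (U \<tau>))\<^sup>2 \<le> B"
        using \<tau> t in_Hs_mono[OF U0 m(2)] by (intro B(2)[OF sol, of 0]) (auto simp: R_def)
      then show "in_Hs (max (s - 1) 0) (U \<tau>)" "(Hs_norm (max (s - 1) 0) (U \<tau>))\<^sup>2 \<le> B" by (auto simp: m_def)
      show "(Hs_norm 0 (U \<tau>))\<^sup>2 \<le> M" unfolding M_def using \<tau> by (intro solution_H_bound[OF sol]) auto
    qed
    also have "\<dots> = exp ((2 * \<bar>Re \<beta>\<bar> + 2) * t) * (sum (Hs_weight s (U 0)) A + K * I t)"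
      by (simp add: K_def I_def)
    also have "\<dots> \<le> E * (sum (Hs_weight s (U 0)) A + K * I t)"
    proof (rule mult_right_mono)
      show "exp ((2 * \<bar>Re \<beta>\<bar> + 2) * t) \<le> E" using t by (auto simp: E_def intro!: mult_left_le)
      have "0 \<le> I t" unfolding I_def
        by (intro integral_nonneg damped_integrable[OF sol[unfolded is_solution_damped]]) auto
      then show "0 \<le> sum (Hs_weight s (U 0)) A + K * I t" using K0 by (simp add: sum_nonneg)
    qed
    finally show ?thesis .
  qed
  have Ilim: "(I \<longlongrightarrow> 0) F"
  proof -
    have "continuous_on {0..1} I" unfolding I_def
      by (intro indefinite_integral_continuous_1 damped_integrable[OF sol[unfolded is_solution_damped]]) auto
    then have "(I \<longlongrightarrow> I 0) (at 0 within {0..1})" unfolding continuous_on_def by (metis atLeastAtMost_iff order_refl zero_le_one)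
    moreover have "at (0::real) within {0..1} = F" by (simp add: F_def at_within_Icc_at_right at_within_Ici_at_right)
    moreover have "I 0 = 0" by (simp add: I_def)
    ultimately show ?thesis by simp
  qed
  have unit: "\<forall>\<^sub>F t in F. 0 \<le> t \<and> t \<le> 1"
  proof -
    have "\<forall>\<^sub>F t in F. t < 1" unfolding F_def using order_tendstoD(2)[OF tendsto_ident_at, of "0::real" 1 "{0..}"] by simp
    moreover have "\<forall>\<^sub>F t in F. 0 \<le> t" unfolding F_def by (simp add: eventually_at_filter)
    ultimately show ?thesis by eventually_elim auto
  qed
  have "((\<lambda>t. Hs_norm s (U t - U 0)) \<longlongrightarrow> 0) F"
  proof (rule Hs_tendsto_0I)
    fix n
    have "continuous_on {0..} (\<lambda>t. U t n)" by (rule damped_cont_mode[OF sol[unfolded is_solution_damped]])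
    then show "((\<lambda>t. U t n) \<longlongrightarrow> U 0 n) F" unfolding continuous_on_def F_def by (metis atLeast_iff order_refl)
  next
    fix e :: real assume e: "0 < e"
    define d where "d = e / (8 * E)"
    have d: "0 < d" using e E1 by (simp add: d_def)
    have "(\<lambda>k. sum (Hs_weight s (U 0)) {- int k..int k}) \<longlonglongrightarrow> (Hs_norm s (U 0))\<^sup>2"
      using sum_symmetric_tendsto_infsum[of "Hs_weight s (U 0)"] U0 by (simp add: in_Hs_def Hs_norm_sq)
    then have "\<forall>\<^sub>F k in sequentially. (Hs_norm s (U 0))\<^sup>2 - d < sum (Hs_weight s (U 0)) {- int k..int k}"
      using d by (intro order_tendstoD) auto
    then obtain k where k: "(Hs_norm s (U 0))\<^sup>2 - d < sum (Hs_weight s (U 0)) {- int k..int k}"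
      using eventually_happens'[OF sequentially_bot] by blast
    define A0 where "A0 = {- int k..int k}"
    have A0t: "sum (Hs_weight s (U 0)) A \<le> d" if "finite A" "A \<inter> A0 = {}" for A
    proof -
      have "sum (Hs_weight s (U 0)) A + sum (Hs_weight s (U 0)) A0 = sum (Hs_weight s (U 0)) (A \<union> A0)"
        using that by (simp add: sum.union_disjoint A0_def)
      also have "\<dots> \<le> (Hs_norm s (U 0))\<^sup>2" using that by (intro sum_Hs_weight_le U0) (simp add: A0_def)
      finally show ?thesis using k by (simp add: A0_def)
    qed
    have "((\<lambda>t. K * I t) \<longlongrightarrow> K * 0) F" by (intro tendsto_intros Ilim)
    then have "\<forall>\<^sub>F t in F. K * I t < d" using d by (auto dest: order_tendstoD)
    then have "\<forall>\<^sub>F t in F. \<forall>A. finite A \<and> A \<inter> A0 = {} \<longrightarrow> sum (Hs_weight s (U t - U 0)) A \<le> e"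
      using unit
    proof eventually_elim
      case (elim t)
      show ?case
      proof (intro allI impI)
        fix A assume A: "finite A \<and> A \<inter> A0 = {}"
        have "sum (Hs_weight s (U t - U 0)) A \<le> (\<Sum>n\<in>A. 2 * Hs_weight s (U t) n + 2 * Hs_weight s (U 0) n)"
        proof (rule sum_mono)
          fix n
          have "(cmod (U t n - U 0 n))\<^sup>2 \<le> (cmod (U t n) + cmod (U 0 n))\<^sup>2"
            by (intro power_mono norm_triangle_ineq4) auto
          also have "\<dots> \<le> 2 * (cmod (U t n))\<^sup>2 + 2 * (cmod (U 0 n))\<^sup>2"
            using sum_squares_bound[of "cmod (U t n)" "cmod (U 0 n)"] by (simp add: power2_sum)
          finally have "kap n powr s * (cmod (U t n - U 0 n))\<^sup>2 \<le> kap n powr s * (2 * (cmod (U t n))\<^sup>2 + 2 * (cmod (U 0 n))\<^sup>2)"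
            by (intro mult_left_mono) auto
          then show "Hs_weight s (U t - U 0) n \<le> 2 * Hs_weight s (U t) n + 2 * Hs_weight s (U 0) n"
            by (simp add: Hs_weight_kap algebra_simps)
        qed
        also have "\<dots> = 2 * sum (Hs_weight s (U t)) A + 2 * sum (Hs_weight s (U 0)) A"
          by (simp add: sum.distrib sum_distrib_left)
        also have "\<dots> \<le> 2 * (E * (d + d)) + 2 * d"
        proof -
          have "sum (Hs_weight s (U t)) A \<le> E * (sum (Hs_weight s (U 0)) A + K * I t)"
            using elim A by (intro tail) auto
          also have "\<dots> \<le> E * (d + d)" using A0t[of A] A elim E1 by (intro mult_left_mono add_mono) auto
          finally show ?thesis using A0t[of A] A by simp
        qed
        also have "\<dots> = e / 2 + e / (4 * E)" using E1 by (simp add: d_def field_simps)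
        also have "e / (4 * E) \<le> e / 2" using e E1 by (intro divide_left_mono) auto
        finally show "sum (Hs_weight s (U t - U 0)) A \<le> e" by simp
      qed
    qed
    then show "\<exists>A0. finite A0 \<and> (\<forall>\<^sub>F t in F. \<forall>A. finite A \<and> A \<inter> A0 = {} \<longrightarrow> sum (Hs_weight s (U t - U 0)) A \<le> e)"
      by (intro exI[of _ A0]) (simp add: A0_def)
  qed
  then show ?thesis using True by (simp add: F_def)
qed

text \<open>Turns a bound for each radius into one monotone function. Choosing bounds radius by
  radius gives no monotonicity, so \<open>Q\<close> adds up the moduli of the bounds at all natural
  radii up to the ceiling of \<open>r\<close>.\<close>

lemma mono_majorant:
  fixes x y :: "'i \<Rightarrow> real"
  assumes "\<And>R. \<exists>B. \<forall>i. P i \<and> x i \<le> R \<longrightarrow> y i \<le> B"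
  obtains Q where "mono Q" "\<And>r. 0 \<le> Q r" "\<And>i. P i \<Longrightarrow> y i \<le> Q (x i)"
proof -
  obtain B where B: "\<And>R i. P i \<Longrightarrow> x i \<le> R \<Longrightarrow> y i \<le> B R" using assms by metis
  define Q where "Q r = (\<Sum>k\<le>nat \<lceil>r\<rceil>. \<bar>B (real k)\<bar>)" for r :: real
  have "mono Q"
  proof (rule monoI)
    fix r r' :: real assume "r \<le> r'"
    then have "nat \<lceil>r\<rceil> \<le> nat \<lceil>r'\<rceil>" by (intro nat_mono ceiling_mono)
    then show "Q r \<le> Q r'" unfolding Q_def by (intro sum_mono2) auto
  qed
  moreover have "0 \<le> Q r" for r by (simp add: Q_def sum_nonneg)
  moreover have "y i \<le> Q (x i)" if "P i" for i
  proof -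
    have "y i \<le> B (real (nat \<lceil>x i\<rceil>))" by (rule B[OF that real_nat_ceiling_ge])
    also have "\<dots> \<le> \<bar>B (real (nat \<lceil>x i\<rceil>))\<bar>" by simp
    also have "\<dots> \<le> Q (x i)" unfolding Q_def
      by (rule member_le_sum[of _ _ "\<lambda>k. \<bar>B (real k)\<bar>"]) auto
    finally show ?thesis .
  qed
  ultimately show ?thesis using that by blast
qed

lemma uniform_smoothing:
  assumes s: "0 \<le> s"
  shows "\<exists>Q N. mono Q \<and> (\<forall>L. smoothing_est \<gamma> \<omega> \<beta> L s Q N)"
proof -
  define k where "k = nat \<lceil>s\<rceil>"
  \<comment> \<open>Half the exponent, because \<open>solution_smoothing_real\<close> bounds the
    squared norm.\<close>
  define N where "N = real k / 2"
  \<comment> \<open>\<open>L\<close> is part of the index, hence the function obtained from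
    \<open>mono_majorant\<close> is the same for all \<open>L\<close>.\<close>
  define P where "P = (\<lambda>(L, U, t::real). is_solution \<gamma> \<omega> \<beta> L U \<and> 0 < t)"
  define x where "x = (\<lambda>(L::real, U::real \<Rightarrow> int \<Rightarrow> complex, t::real). Hs_norm 0 (U 0))"
  define y where "y = (\<lambda>(L::real, U::real \<Rightarrow> int \<Rightarrow> complex, t::real). Hs_norm s (U t) / (1 + t powr (- N)))"
  obtain Q where Q: "mono Q" "\<And>i. P i \<Longrightarrow> y i \<le> Q (x i)"
  proof (rule mono_majorant[of P x y])
    fix R
    obtain B where B: "0 \<le> B" "\<And>L U a t. is_solution \<gamma> \<omega> \<beta> L U \<Longrightarrow> 0 \<le> a \<Longrightarrow> a < t \<Longrightarrow> Hs_norm 0 (U a) \<le> R \<Longrightarrow>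
      in_Hs s (U t) \<and> (Hs_norm s (U t))\<^sup>2 \<le> B * (1 + (1 / (t - a)) ^ k)"
      using solution_smoothing_real[OF s, of \<gamma> \<omega> \<beta> R] unfolding k_def by metis
    have "y (L, U, t) \<le> sqrt B" if sol: "is_solution \<gamma> \<omega> \<beta> L U" and t: "0 < t" and R: "Hs_norm 0 (U 0) \<le> R" for L U t
    proof -
      define z where "z = t powr (- N)"
      have z: "0 \<le> z" by (simp add: z_def)
      have zz: "z\<^sup>2 = (1 / t) ^ k"
      proof -
        have "z\<^sup>2 = t powr (- real k)" unfolding z_def power2_eq_square powr_add[symmetric] by (simp add: N_def)
        also have "\<dots> = (1 / t) ^ k" using t by (simp add: powr_minus powr_realpow power_divide divide_inverse power_inverse)
        finally show ?thesis .
      qed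
      have "(Hs_norm s (U t))\<^sup>2 \<le> B * (1 + z\<^sup>2)" using B(2)[OF sol, of 0 t] t R by (simp add: zz)
      also have "\<dots> \<le> B * (1 + z)\<^sup>2" using B(1) z by (intro mult_left_mono) (auto simp: power2_sum)
      also have "\<dots> = (sqrt B * (1 + z))\<^sup>2" using B(1) by (simp add: power_mult_distrib)
      finally have "Hs_norm s (U t) \<le> sqrt B * (1 + z)" by (rule power2_le_imp_le) (use z B(1) in simp)
      then show ?thesis using z by (simp add: y_def z_def[symmetric] divide_le_eq add_pos_nonneg)
    qed
    then show "\<exists>B. \<forall>i. P i \<and> x i \<le> R \<longrightarrow> y i \<le> B"
      by (intro exI[of _ "sqrt B"]) (auto simp: P_def x_def)
  qed blast
  have "smoothing_est \<gamma> \<omega> \<beta> L s Q N" for L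
    unfolding smoothing_est_def
  proof (intro allI impI conjI)
    fix U and t :: real assume sol: "is_solution \<gamma> \<omega> \<beta> L U" and t: "0 < t"
    show "in_Hs s (U t)" by (rule solution_in_Hs[OF sol t s])
    have "y (L, U, t) \<le> Q (x (L, U, t))" using sol t by (intro Q(2)) (simp add: P_def)
    moreover have "0 < 1 + t powr (- N)" by (simp add: add_pos_nonneg)
    ultimately show "Hs_norm s (U t) \<le> (1 + t powr (- N)) * Q (Hs_norm 0 (U 0))"
      by (simp add: x_def y_def pos_divide_le_eq mult.commute)
  qed
  then show ?thesis using Q(1) by blast
qed

text \<open>Only the H norm is known to decay. Once the decaying part of its square at time t - 1 is
  at most 1, one unit of smoothing bounds the H^s norm by a constant independent of the data. Before
  that, exp(-t) is still at least of the order of 1 / (1 + r^2), so the crude global bound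
  \<open>Q\<close> can be multiplied by this exponential and a compensating factor.\<close>

lemma uniform_dissipative:
  assumes s: "0 \<le> s"
  shows "\<exists>Q \<kappa> C. mono Q \<and> \<kappa> > 0 \<and> C > 0 \<and> (\<forall>L. dissipative_est \<gamma> \<omega> \<beta> L s Q \<kappa> C)"
proof -
  define k where "k = nat \<lceil>s\<rceil>"
  define P where "P = (\<lambda>(L, U, t::real). is_solution \<gamma> \<omega> \<beta> L U \<and> in_Hs s (U 0) \<and> 0 \<le> t)"
  define x where "x = (\<lambda>(L::real, U::real \<Rightarrow> int \<Rightarrow> complex, t::real). Hs_norm s (U 0))"
  define y where "y = (\<lambda>(L::real, U::real \<Rightarrow> int \<Rightarrow> complex, t::real). Hs_norm s (U t))"
  obtain Q where Q: "mono Q" "\<And>r. 0 \<le> Q r" "\<And>i. P i \<Longrightarrow> y i \<le> Q (x i)"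
  proof (rule mono_majorant[of P x y])
    fix R
    obtain B1 where B1: "0 \<le> B1" "\<And>L U a t. is_solution \<gamma> \<omega> \<beta> L U \<Longrightarrow> 0 \<le> a \<Longrightarrow> a < t \<Longrightarrow> Hs_norm 0 (U a) \<le> R \<Longrightarrow>
      in_Hs s (U t) \<and> (Hs_norm s (U t))\<^sup>2 \<le> B1 * (1 + (1 / (t - a)) ^ k)"
      using solution_smoothing_real[OF s, of \<gamma> \<omega> \<beta> R] unfolding k_def by metis
    obtain B2 where B2: "0 \<le> B2" "\<And>L U a t. is_solution \<gamma> \<omega> \<beta> L U \<Longrightarrow> 0 \<le> a \<Longrightarrow> a \<le> t \<Longrightarrow> t \<le> a + 1 \<Longrightarrow> in_Hs s (U a) \<Longrightarrow> Hs_norm s (U a) \<le> R \<Longrightarrow>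
      in_Hs s (U t) \<and> (Hs_norm s (U t))\<^sup>2 \<le> B2" using solution_persistence[OF s, of \<gamma> \<omega> \<beta> R] by blast
    have "y (L, U, t) \<le> sqrt (2 * B1 + B2)" 
      if sol: "is_solution \<gamma> \<omega> \<beta> L U" and U0: "in_Hs s (U 0)" and t: "0 \<le> t" and R: "Hs_norm s (U 0) \<le> R" for L U t
    proof (cases "t \<le> 1")
      case True
      then have "(Hs_norm s (U t))\<^sup>2 \<le> B2" using B2(2)[OF sol, of 0 t] t U0 R by auto
      then show ?thesis using B1(1) by (auto simp: y_def intro!: real_le_rsqrt)
    next
      case False
      then have "(Hs_norm s (U t))\<^sup>2 \<le> B1 * (1 + (1 / (t - 0)) ^ k)"
        using B1(2)[OF sol, of 0 t] in_Hs_mono(2)[OF U0 s] R by auto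
      also have "\<dots> \<le> B1 * (1 + 1)"
        using False B1(1) by (intro mult_left_mono add_left_mono power_le_one) auto
      finally show ?thesis using B2(1) by (auto simp: y_def intro!: real_le_rsqrt)
    qed
    then show "\<exists>B. \<forall>i. P i \<and> x i \<le> R \<longrightarrow> y i \<le> B"
      by (intro exI[of _ "sqrt (2 * B1 + B2)"]) (auto simp: P_def x_def)
  qed blast
  obtain B where B: "0 \<le> B" "\<And>L U a t. is_solution \<gamma> \<omega> \<beta> L U \<Longrightarrow> 0 \<le> a \<Longrightarrow> a < t \<Longrightarrow> Hs_norm 0 (U a) \<le> sqrt (1 + absorb \<beta>) \<Longrightarrow>
      in_Hs s (U t) \<and> (Hs_norm s (U t))\<^sup>2 \<le> B * (1 + (1 / (t - a)) ^ k)"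
    using solution_smoothing_real[OF s, of \<gamma> \<omega> \<beta> "sqrt (1 + absorb \<beta>)"] unfolding k_def by metis
  \<comment> \<open>Smoothing over exactly one time unit gives B * (1 + 1); the summand 1 makes
    \<open>C\<close> positive.\<close>
  define C where "C = sqrt (2 * B) + 1"
  have C: "0 < C" using B(1) by (simp add: C_def add_nonneg_pos)
  \<comment> \<open>The truncation at 0 keeps the quadratic factor monotone on negative arguments;
    on norms it changes nothing.\<close>
  define Q' where "Q' r = Q r * (exp 1 * (1 + (max r 0)\<^sup>2))" for r
  have mQ: "mono Q'"
  proof (rule monoI)
    fix r r' :: real assume "r \<le> r'"
    then show "Q' r \<le> Q' r'" unfolding Q'_def using Q(2)[of r] Q(2)[of r'] monoD[OF Q(1)]
      by (intro mult_mono add_left_mono power_mono) auto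
  qed
  have "dissipative_est \<gamma> \<omega> \<beta> L s Q' 1 C" for L
    unfolding dissipative_est_def
  proof (intro allI impI, elim conjE)
    fix U and t :: real assume sol: "is_solution \<gamma> \<omega> \<beta> L U" and U0: "in_Hs s (U 0)" and t: "0 \<le> t"
    define r r0 where "r = Hs_norm s (U 0)" and "r0 = Hs_norm 0 (U 0)"
    have r: "0 \<le> r0" "r0 \<le> r" using in_Hs_mono(2)[OF U0 s] by (auto simp: r_def r0_def)
    show "Hs_norm s (U t) \<le> Q' (Hs_norm s (U 0)) * exp (- 1 * t) + C"
    proof (cases "1 \<le> t \<and> exp (- (t - 1)) * r0\<^sup>2 \<le> 1")
      case True
      have "(Hs_norm 0 (U (t - 1)))\<^sup>2 \<le> exp (- (t - 1 - 0)) * r0\<^sup>2 + absorb \<beta>"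
        unfolding r0_def using True by (intro solution_H_dissipative[OF sol]) auto
      also have "\<dots> \<le> 1 + absorb \<beta>" using True by simp
      finally have "Hs_norm 0 (U (t - 1)) \<le> sqrt (1 + absorb \<beta>)" by (rule real_le_rsqrt)
      then have "(Hs_norm s (U t))\<^sup>2 \<le> B * (1 + (1 / (t - (t - 1))) ^ k)"
        using B(2)[OF sol, of "t - 1" t] True by auto
      then have "Hs_norm s (U t) \<le> sqrt (2 * B)" by (auto intro: real_le_rsqrt)
      moreover have "0 \<le> Q' (Hs_norm s (U 0)) * exp (- 1 * t)" using Q(2) by (simp add: Q'_def)
      ultimately show ?thesis unfolding C_def by linarith
    next
      case False
      have "1 \<le> exp 1 * (1 + r\<^sup>2) * exp (- t)"
      proof (cases "1 \<le> t")
        case True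
        then have "1 \<le> exp (- (t - 1)) * r0\<^sup>2" using False by auto
        also have "\<dots> = exp 1 * r0\<^sup>2 * exp (- t)" by (simp add: exp_diff exp_minus field_simps)
        also have "\<dots> \<le> exp 1 * (1 + r\<^sup>2) * exp (- t)"
        proof -
          have "r0\<^sup>2 \<le> r\<^sup>2" using r by (intro power_mono) auto
          then show ?thesis by (intro mult_right_mono mult_left_mono) auto
        qed
        finally show ?thesis .
      next
        case False
        have "1 \<le> exp (1 - t)" using False by simp
        also have "\<dots> = exp 1 * 1 * exp (- t)" by (simp add: exp_diff exp_minus field_simps)
        also have "\<dots> \<le> exp 1 * (1 + r\<^sup>2) * exp (- t)" by (intro mult_right_mono mult_left_mono) auto
        finally show ?thesis .
      qed
      then have "Q r * 1 \<le> Q r * (exp 1 * (1 + r\<^sup>2) * exp (- t))" using Q(2) by (intro mult_left_mono) auto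
      also have "\<dots> = Q' r * exp (- t)" using r by (simp add: Q'_def)
      finally have "Q r \<le> Q' r * exp (- t)" by simp
      moreover have "Hs_norm s (U t) \<le> Q r"
        using Q(3)[of "(L, U, t)"] sol U0 t by (simp add: P_def x_def y_def r_def)
      ultimately show ?thesis using C by (simp add: r_def)
    qed
  qed
  then show ?thesis using mQ C by (intro exI[of _ Q'] exI[of _ 1] exI[of _ C]) auto
qed

section \<open>Uniqueness and continuous dependence on the data\<close>

lemma solution_lipschitz_uniform:
  assumes U: "is_solution \<gamma> \<omega> \<beta> L U" and V: "is_solution \<gamma> \<omega> \<beta> L V" and t: "0 \<le> t"
    and R: "(Hs_norm 0 (U 0))\<^sup>2 \<le> R" "(Hs_norm 0 (V 0))\<^sup>2 \<le> R"
  shows "Hs_norm 0 (U t - V t) \<le> exp (lip_rate \<omega> \<beta> (R + absorb \<beta>) / 2 * t) * Hs_norm 0 (U 0 - V 0)"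
proof (rule solution_lipschitz[OF U V t])
  fix \<tau> assume "\<tau> \<in> {0..t}"
  then show "(Hs_norm 0 (U \<tau>))\<^sup>2 \<le> R + absorb \<beta>" "(Hs_norm 0 (V \<tau>))\<^sup>2 \<le> R + absorb \<beta>"
    using solution_H_bound[OF U, of 0 \<tau>] solution_H_bound[OF V, of 0 \<tau>] R by auto
qed

lemma solution_unique:
  assumes U: "is_solution \<gamma> \<omega> \<beta> L U" and V: "is_solution \<gamma> \<omega> \<beta> L V" and "U 0 = V 0" and t: "0 \<le> t"
  shows "U t = V t"
proof -
  have "Hs_norm 0 (U 0 - V 0) = 0" using assms(3) by (simp add: Hs_norm_def)
  then have "Hs_norm 0 (U t - V t) \<le> 0"
    using solution_lipschitz_uniform[OF U V t, of "(Hs_norm 0 (U 0))\<^sup>2 + (Hs_norm 0 (V 0))\<^sup>2"] by simp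
  moreover have "in_Hs 0 (U t - V t)" using U V t by (intro Hs_diff) (auto simp: is_solution_def)
  ultimately have "cmod ((U t - V t) n) \<le> 0" for n
    using cmod_le_Hs_norm[of 0 "U t - V t" n] by linarith
  then show ?thesis by (auto simp: fun_eq_iff)
qed

text \<open>For t > 0 the Lipschitz estimate gives convergence in H, smoothing bounds the H^(2s)
  norms at time t uniformly in \<open>k\<close>, and interpolation yields H^s.\<close>

lemma solution_continuous_dependence:
  assumes s: "0 \<le> s" and U: "is_solution \<gamma> \<omega> \<beta> L U" "in_Hs s (U 0)"
    and W: "\<And>k. is_solution \<gamma> \<omega> \<beta> L (W k)" "\<And>k. in_Hs s (W k 0)"
    and lim: "(\<lambda>k. Hs_norm s (W k 0 - U 0)) \<longlonglongrightarrow> 0" and t: "0 \<le> t"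
  shows "(\<lambda>k. Hs_norm s (W k t - U t)) \<longlonglongrightarrow> 0"
proof (cases "t = 0")
  case False
  then have tp: "0 < t" using t by simp
  define R where "R = 1 + Hs_norm s (U 0)"
  have ev: "\<forall>\<^sub>F k in sequentially. Hs_norm 0 (W k 0) \<le> R"
    using order_tendstoD(2)[OF lim zero_less_one]
  proof eventually_elim
    case (elim k)
    have "Hs_norm 0 (W k 0) \<le> Hs_norm s (W k 0)" by (rule in_Hs_mono(2)[OF W(2) s])
    also have "\<dots> \<le> Hs_norm s (W k 0 - U 0) + Hs_norm s (U 0)" by (rule Hs_norm_le_diff[OF W(2) U(2)])
    finally show ?case using elim by (simp add: R_def)
  qed
  have UR: "Hs_norm 0 (U 0) \<le> R" using in_Hs_mono(2)[OF U(2) s] by (simp add: R_def)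
  define m where "m = nat \<lceil>2 * s\<rceil>"
  have s2: "0 \<le> 2 * s" using s by simp
  obtain B where B: "0 \<le> B" "\<And>L U a t. is_solution \<gamma> \<omega> \<beta> L U \<Longrightarrow> 0 \<le> a \<Longrightarrow> a < t \<Longrightarrow> Hs_norm 0 (U a) \<le> R \<Longrightarrow>
     in_Hs (2 * s) (U t) \<and> (Hs_norm (2 * s) (U t))\<^sup>2 \<le> B * (1 + (1 / (t - a)) ^ m)"
    using solution_smoothing_real[OF s2, of \<gamma> \<omega> \<beta> R] unfolding m_def by metis
  define D where "D = sqrt (B * (1 + (1 / (t - 0)) ^ m))"
  define K where "K = exp (lip_rate \<omega> \<beta> (R\<^sup>2 + absorb \<beta>) / 2 * t)"
  show ?thesis
  proof (rule Hs_tendsto_0_interpolate[OF _ s, where C = "D + D"])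
    show "\<forall>\<^sub>F k in sequentially. in_Hs (2 * s) (W k t - U t) \<and> Hs_norm (2 * s) (W k t - U t) \<le> D + D"
      using ev
    proof eventually_elim
      case (elim k)
      have 1: "in_Hs (2 * s) (W k t)" "Hs_norm (2 * s) (W k t) \<le> D"
        using B(2)[OF W(1), of 0 t k] elim tp by (auto simp: D_def intro: real_le_rsqrt)
      have 2: "in_Hs (2 * s) (U t)" "Hs_norm (2 * s) (U t) \<le> D"
        using B(2)[OF U(1), of 0 t] UR tp by (auto simp: D_def intro: real_le_rsqrt)
      show ?case using Hs_diff[OF 1(1) 2(1)] 1(2) 2(2) by simp
    qed
    show "(\<lambda>k. Hs_norm 0 (W k t - U t)) \<longlonglongrightarrow> 0"
    proof (rule Lim_null_comparison)
      have "(\<lambda>k. K * Hs_norm s (W k 0 - U 0)) \<longlonglongrightarrow> K * 0" by (intro tendsto_intros lim)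
      then show "(\<lambda>k. K * Hs_norm s (W k 0 - U 0)) \<longlonglongrightarrow> 0" by simp
      show "\<forall>\<^sub>F k in sequentially. norm (Hs_norm 0 (W k t - U t)) \<le> K * Hs_norm s (W k 0 - U 0)"
        using ev
      proof eventually_elim
        case (elim k)
        have "Hs_norm 0 (W k t - U t) \<le> K * Hs_norm 0 (W k 0 - U 0)"
          unfolding K_def using elim UR by (intro solution_lipschitz_uniform[OF W(1) U(1) t] power_mono) auto
        also have "\<dots> \<le> K * Hs_norm s (W k 0 - U 0)"
          by (intro mult_left_mono in_Hs_mono(2)[OF Hs_diff(1)[OF W(2) U(2)] s]) (simp add: K_def)
        finally show ?case by simp
      qed
    qed
  qed
qed (use lim in simp)

section \<open>Picard iteration with cutoff\<close>

text \<open>Lower semicontinuity of the norm under modewise convergence, tested on finite sets of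
  modes.\<close>

lemma Hs_norm_limit_le:
  assumes lim: "\<And>n. (\<lambda>m. W m n) \<longlonglongrightarrow> w n" and B: "0 \<le> B"
    and ev: "\<forall>\<^sub>F m in sequentially. in_Hs s (W m) \<and> Hs_norm s (W m) \<le> B"
  shows "in_Hs s w" "Hs_norm s w \<le> B"
proof -
  have "sum (Hs_weight s w) A \<le> B\<^sup>2" if A: "finite A" for A
  proof (rule tendsto_le[OF sequentially_bot tendsto_const])
    show "(\<lambda>m. sum (Hs_weight s (W m)) A) \<longlonglongrightarrow> sum (Hs_weight s w) A"
      unfolding Hs_weight_def by (intro tendsto_intros lim)
    show "\<forall>\<^sub>F m in sequentially. sum (Hs_weight s (W m)) A \<le> B\<^sup>2"
      using ev
    proof eventually_elim
      case (elim m)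
      then show ?case by (intro order_trans[OF sum_Hs_weight_le[OF _ A]] power_mono) auto
    qed
  qed
  then show "in_Hs s w" "Hs_norm s w \<le> B" using in_HsI[OF _ B, of s w] by auto
qed

lemma l1_le_Hs1:
  assumes "in_Hs 1 v"
  shows "l1 v \<le> 4 * Hs_norm 1 v"
proof (rule power2_le_imp_le)
  have "(l1 v)\<^sup>2 \<le> 16 * Hs_norm 0 v * Hs_norm 1 v" by (rule l1_sq_le[OF assms])
  also have "\<dots> \<le> 16 * Hs_norm 1 v * Hs_norm 1 v"
    using in_Hs_mono(2)[OF assms, of 0] by (intro mult_right_mono mult_left_mono) auto
  finally show "(l1 v)\<^sup>2 \<le> (4 * Hs_norm 1 v)\<^sup>2" by (simp add: power2_eq_square)
qed simp

text \<open>The weighted bound with weight \<open>kap\<close>: the gained factor 1 /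
  \<open>kap n\<close> cancels it, so forcing in H suffices for H^1.\<close>

lemma forced_H1_bound:
  assumes fo: "forced \<gamma> \<beta> L U F 0 t" and t: "0 \<le> t" and U0: "in_Hs 1 (U 0)"
    and h: "h integrable_on {0..t}"
    and F: "\<And>\<tau>. \<tau> \<in> {0<..<t} \<Longrightarrow> in_Hs 0 (F \<tau>) \<and> (Hs_norm 0 (F \<tau>))\<^sup>2 \<le> h \<tau>"
  shows "in_Hs 1 (U t)" "(Hs_norm 1 (U t))\<^sup>2 \<le> exp ((2 * \<bar>Re \<beta>\<bar> + 2) * t) * ((Hs_norm 1 (U 0))\<^sup>2 + integral {0..t} h)"
proof -
  have "sum (Hs_weight 1 (U t)) A \<le> exp ((2 * \<bar>Re \<beta>\<bar> + 2) * t) * ((Hs_norm 1 (U 0))\<^sup>2 + integral {0..t} h)" if A: "finite A" for A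
  proof -
    have "(\<Sum>n\<in>A. kap n * (cmod (U t n))\<^sup>2) \<le> exp ((2 * \<bar>Re \<beta>\<bar> + 2) * (t - 0)) *
     ((\<Sum>n\<in>A. kap n * exp (- kap n * (t - 0)) * (cmod (U 0 n))\<^sup>2) + integral {0..t} h)"
    proof (rule forced_weighted_bound[OF fo t A _ h])
      fix \<tau> assume \<tau>: "\<tau> \<in> {0<..<t}"
      have "(\<Sum>n\<in>A. kap n / kap n * (cmod (F \<tau> n))\<^sup>2) = sum (Hs_weight 0 (F \<tau>)) A" by simp
      also have "\<dots> \<le> (Hs_norm 0 (F \<tau>))\<^sup>2" using F[OF \<tau>] by (intro sum_Hs_weight_le A) auto
      also have "\<dots> \<le> h \<tau>" using F[OF \<tau>] by simp
      finally show "(\<Sum>n\<in>A. kap n / kap n * (cmod (F \<tau> n))\<^sup>2) \<le> h \<tau>" .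
    qed simp
    also have "\<dots> \<le> exp ((2 * \<bar>Re \<beta>\<bar> + 2) * (t - 0)) * ((Hs_norm 1 (U 0))\<^sup>2 + integral {0..t} h)"
    proof (intro mult_left_mono add_right_mono)
      have "(\<Sum>n\<in>A. kap n * exp (- kap n * (t - 0)) * (cmod (U 0 n))\<^sup>2) \<le> sum (Hs_weight 1 (U 0)) A"
        unfolding Hs_weight_1 using t by (intro sum_mono mult_right_mono) (auto intro!: mult_left_le)
      also have "\<dots> \<le> (Hs_norm 1 (U 0))\<^sup>2" by (rule sum_Hs_weight_le[OF U0 A])
      finally show "(\<Sum>n\<in>A. kap n * exp (- kap n * (t - 0)) * (cmod (U 0 n))\<^sup>2) \<le> (Hs_norm 1 (U 0))\<^sup>2" .
    qed simp
    finally show ?thesis by (simp add: Hs_weight_1)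
  qed
  then show "in_Hs 1 (U t)" "(Hs_norm 1 (U t))\<^sup>2 \<le> exp ((2 * \<bar>Re \<beta>\<bar> + 2) * t) * ((Hs_norm 1 (U 0))\<^sup>2 + integral {0..t} h)"
    using in_HsI_sq by blast+
qed

text \<open>A bound in H^1 makes the H tails uniformly small, since outside |n| \<le> k the weight
  exceeds k. Agmon then passes from H to l1.\<close>

lemma H1_bounded_imp_continuous:
  fixes U :: "real \<Rightarrow> int \<Rightarrow> complex"
  assumes modes: "\<And>n. continuous_on {0..} (\<lambda>t. U t n)"
    and H1: "\<And>t. 0 \<le> t \<Longrightarrow> in_Hs 1 (U t)" and bd: "\<And>T. \<exists>B. \<forall>t\<in>{0..T}. Hs_norm 1 (U t) \<le> B"
    and t0: "0 \<le> t0"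
  shows "((\<lambda>t. Hs_norm 0 (U t - U t0)) \<longlongrightarrow> 0) (at t0 within {0..})"
    and "((\<lambda>t. l1 (U t - U t0)) \<longlongrightarrow> 0) (at t0 within {0..})"
proof -
  define F where "F = at t0 within {0..}"
  obtain B where B: "\<And>t. t \<in> {0..t0 + 1} \<Longrightarrow> Hs_norm 1 (U t) \<le> B" using bd[of "t0 + 1"] by blast
  have ev: "\<forall>\<^sub>F t in F. t \<in> {0..t0 + 1}"
  proof -
    have "\<forall>\<^sub>F t in F. t < t0 + 1" unfolding F_def using order_tendstoD(2)[OF tendsto_ident_at, of t0 "t0 + 1" "{0..}"] by simp
    moreover have "\<forall>\<^sub>F t in F. 0 \<le> t" unfolding F_def by (simp add: eventually_at_filter)
    ultimately show ?thesis by eventually_elim auto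
  qed
  have d: "in_Hs 1 (U t - U t0)" "Hs_norm 1 (U t - U t0) \<le> 2 * B" if "t \<in> {0..t0 + 1}" for t
    using Hs_diff[OF H1[of t] H1[OF t0]] B[OF that] B[of t0] that t0 by auto
  show lim: "((\<lambda>t. Hs_norm 0 (U t - U t0)) \<longlongrightarrow> 0) (at t0 within {0..})"
    unfolding F_def[symmetric]
  proof (rule Hs_tendsto_0I)
    show "((\<lambda>t. U t n) \<longlongrightarrow> U t0 n) F" for n
      using modes[of n] t0 by (simp add: continuous_on_def F_def)
    fix e :: real assume e: "0 < e"
    \<comment> \<open>The number 4 B^2 is the squared H^1 bound 2 B of the difference; dividing by
      the weight outside \<open>A0\<close> leaves at most e.\<close>
    obtain k :: nat where k: "4 * B\<^sup>2 / e \<le> real k" using real_arch_simple by blast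
    define A0 where "A0 = {- int k..int k}"
    have "\<forall>\<^sub>F t in F. \<forall>A. finite A \<and> A \<inter> A0 = {} \<longrightarrow> sum (Hs_weight 0 (U t - U t0)) A \<le> e"
      using ev
    proof eventually_elim
      case (elim t)
      show ?case
      proof (intro allI impI)
        fix A assume A: "finite A \<and> A \<inter> A0 = {}"
        have k1: "0 < real k + 1" by simp
        have "(real k + 1) * sum (Hs_weight 0 (U t - U t0)) A \<le> sum (Hs_weight 1 (U t - U t0)) A"
          unfolding sum_distrib_left
        proof (rule sum_mono)
          fix n assume "n \<in> A"
          then have "n \<notin> A0" using A by auto
          then have "real k \<le> \<bar>real_of_int n\<bar>" by (auto simp: A0_def)
          moreover have "\<bar>real_of_int n\<bar> \<le> (real_of_int n)\<^sup>2"
          proof (cases "n = 0")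
            case False
            then have "1 \<le> \<bar>real_of_int n\<bar>" by linarith
            then show ?thesis using mult_left_mono[of 1 "\<bar>real_of_int n\<bar>" "\<bar>real_of_int n\<bar>"] by (simp add: power2_eq_square)
          qed simp
          ultimately have "real k + 1 \<le> kap n" by (simp add: kap_def)
          then show "(real k + 1) * Hs_weight 0 (U t - U t0) n \<le> Hs_weight 1 (U t - U t0) n"
            unfolding Hs_weight_1 Hs_weight_0 by (intro mult_right_mono) auto
        qed
        also have "\<dots> \<le> (Hs_norm 1 (U t - U t0))\<^sup>2" using A by (intro sum_Hs_weight_le d elim) auto
        also have "\<dots> \<le> (2 * B)\<^sup>2" using d(2)[OF elim] by (intro power_mono) auto
        also have "\<dots> \<le> (real k + 1) * e" using k e by (simp add: field_simps power2_eq_square)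
        finally show "sum (Hs_weight 0 (U t - U t0)) A \<le> e" using mult_le_cancel_left_pos[OF k1] by blast
      qed
    qed
    then show "\<exists>A0. finite A0 \<and> (\<forall>\<^sub>F t in F. \<forall>A. finite A \<and> A \<inter> A0 = {} \<longrightarrow> sum (Hs_weight 0 (U t - U t0)) A \<le> e)"
      by (intro exI[of _ A0]) (simp add: A0_def)
  qed
  show "((\<lambda>t. l1 (U t - U t0)) \<longlongrightarrow> 0) (at t0 within {0..})"
    unfolding F_def[symmetric]
  proof (rule Lim_null_comparison)
    have "((\<lambda>t. sqrt (16 * Hs_norm 0 (U t - U t0) * (2 * B))) \<longlongrightarrow> sqrt (16 * 0 * (2 * B))) F"
      by (intro tendsto_intros lim[folded F_def])
    then show "((\<lambda>t. sqrt (16 * Hs_norm 0 (U t - U t0) * (2 * B))) \<longlongrightarrow> 0) F" by simp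
    show "\<forall>\<^sub>F t in F. norm (l1 (U t - U t0)) \<le> sqrt (16 * Hs_norm 0 (U t - U t0) * (2 * B))"
      using ev
    proof eventually_elim
      case (elim t)
      have "(l1 (U t - U t0))\<^sup>2 \<le> 16 * Hs_norm 0 (U t - U t0) * Hs_norm 1 (U t - U t0)"
        by (rule l1_sq_le[OF d(1)[OF elim]])
      also have "\<dots> \<le> 16 * Hs_norm 0 (U t - U t0) * (2 * B)"
        by (intro mult_left_mono d(2) elim) auto
      finally show ?case by (simp add: real_le_rsqrt)
    qed
  qed
qed

text \<open>Membership in \<open>H\<^sup>1\<close> is only assumed in the interior: at \<open>t = 0\<close> the sum may diverge, and then
  the norm has the junk value 0.\<close>
lemma H1_sq_integrable:
  fixes U :: "real \<Rightarrow> int \<Rightarrow> complex"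
  assumes modes: "\<And>n. continuous_on {0..T} (\<lambda>t. U t n)"
    and H1: "\<And>t. t \<in> {0<..<T} \<Longrightarrow> in_Hs 1 (U t)"
    and bd: "\<And>k. integral {0..T} (\<lambda>t. sum (Hs_weight 1 (U t)) {- int k..int k}) \<le> B"
  shows "(\<lambda>t. (Hs_norm 1 (U t))\<^sup>2) integrable_on {0..T}"
proof -
  define f where "f k t = sum (Hs_weight 1 (U t)) {- int k..int k}" for k t
  have fi: "f k integrable_on {0..T}" for k
    unfolding f_def Hs_weight_def by (intro integrable_continuous_real continuous_intros modes)
  have int: "integral {0<..<T} (f k) = integral {0..T} (f k)" for k
    by (rule integral_unique) (use integrable_integral[OF fi[of k]] in \<open>simp add: has_integral_Icc_iff_Ioo\<close>)
  have nn: "0 \<le> integral {0..T} (f k)" for k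
    by (intro integral_nonneg fi) (simp add: f_def sum_nonneg)
  have "(\<lambda>t. (Hs_norm 1 (U t))\<^sup>2) integrable_on {0<..<T} \<and> (\<lambda>k. integral {0<..<T} (f k)) \<longlonglongrightarrow> integral {0<..<T} (\<lambda>t. (Hs_norm 1 (U t))\<^sup>2)"
  proof (rule monotone_convergence_increasing)
    show "f k integrable_on {0<..<T}" for k using fi by (simp add: integrable_on_Icc_iff_Ioo)
    show "f k t \<le> f (Suc k) t" for k t unfolding f_def by (intro sum_mono2) auto
    show "(\<lambda>k. f k t) \<longlonglongrightarrow> (Hs_norm 1 (U t))\<^sup>2" if "t \<in> {0<..<T}" for t
      using sum_symmetric_tendsto_infsum[of "Hs_weight 1 (U t)"] H1[OF that] by (simp add: in_Hs_def Hs_norm_sq f_def)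
    have "norm (integral {0..T} (f k)) \<le> B" for k using bd[of k] nn[of k] by (simp add: f_def[abs_def])
    then show "bounded (range (\<lambda>k. integral {0<..<T} (f k)))"
      unfolding int bounded_iff by (intro exI[of _ B]) auto
  qed
  then show ?thesis by (simp add: integrable_on_Icc_iff_Ioo)
qed

section \<open>The cutoff of the cubic term\<close>

lemma cubic_scale: "cubic (\<lambda>n. complex_of_real r * v n) n = complex_of_real (r ^ 3) * cubic v n"
proof -
  have "(\<lambda>(b, c). complex_of_real r * v (n + b - c) * cnj (complex_of_real r * v b) * (complex_of_real r * v c))
      = (\<lambda>x. complex_of_real (r ^ 3) * (case x of (b, c) \<Rightarrow> v (n + b - c) * cnj (v b) * v c))"
    by (auto simp: fun_eq_iff power3_eq_cube)
  then show ?thesis unfolding cubic_def by (simp only: infsum_cmult_right')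
qed

lemma l1_scale:
  assumes "in_l1 v"
  shows "in_l1 (\<lambda>n. complex_of_real r * v n)" "l1 (\<lambda>n. complex_of_real r * v n) = \<bar>r\<bar> * l1 v"
  using assms unfolding in_l1_def l1_def norm_mult norm_of_real
  by (simp_all add: infsum_cmult_right' summable_on_cmult_right)

text \<open>The scalar of the radial retraction onto the l1 ball of radius \<open>r\<close>:
  multiplying \<open>v\<close> by it leaves the ball fixed and maps everything else to the
  sphere.\<close>

definition cut :: "real \<Rightarrow> (int \<Rightarrow> complex) \<Rightarrow> real" where
  "cut r v = 1 / max 1 (l1 v / r)"

lemma cut_bounds: "0 < cut r v" "cut r v \<le> 1"
  by (auto simp: cut_def)

lemma cut_mult_le: "0 < r \<Longrightarrow> cut r v * l1 v \<le> r"
  by (simp add: cut_def field_simps max_def)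

lemma cut_eq_1: "0 < r \<Longrightarrow> l1 v \<le> r \<Longrightarrow> cut r v = 1"
  by (simp add: cut_def)

text \<open>By homogeneity the cutoff cubic term is \<open>cubic\<close> of the retracted sequence.
  The retraction is Lipschitz with constant 2 in l1 and lands in the ball of radius
  \<open>r\<close>, where \<open>cubic\<close> has constant 3 r^2; so the cutoff term is globally
  Lipschitz.\<close>

lemma cut_cubic_lipschitz:
  assumes u: "in_l1 u" and v: "in_l1 v" and r: "0 < r"
  defines "f \<equiv> \<lambda>n. complex_of_real (cut r u ^ 3) * cubic u n - complex_of_real (cut r v ^ 3) * cubic v n"
  shows "in_l1 f" "l1 f \<le> 6 * r\<^sup>2 * l1 (u - v)"
proof -
  define a b where "a = cut r u" and "b = cut r v"
  have ab: "0 < a" "a \<le> 1" "0 < b" "b \<le> 1" using cut_bounds by (auto simp: a_def b_def)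
  define u' v' where "u' = (\<lambda>n. complex_of_real a * u n)" and "v' = (\<lambda>n. complex_of_real b * v n)"
  have l: "in_l1 u'" "in_l1 v'" "l1 u' \<le> r" "l1 v' \<le> r"
    using l1_scale[OF u, of a] l1_scale[OF v, of b] cut_mult_le[OF r] ab by (auto simp: u'_def v'_def a_def b_def)
  have fe: "f = cubic u' - cubic v'"
    by (auto simp: f_def u'_def v'_def a_def b_def cubic_scale fun_eq_iff)
  have d: "in_l1 (u - v)" by (rule l1_diff[OF u v])
  have "l1 (u' - v') \<le> l1 (\<lambda>n. complex_of_real a * (u - v) n) + l1 (\<lambda>n. complex_of_real (a - b) * v n)"
  proof (rule l1_dominated(2)[OF l1_scale(1)[OF d] l1_scale(1)[OF v]])
    fix n
    have "(u' - v') n = complex_of_real a * (u - v) n + complex_of_real (a - b) * v n"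
      by (simp add: u'_def v'_def algebra_simps)
    then show "cmod ((u' - v') n) \<le> cmod (complex_of_real a * (u - v) n) + cmod (complex_of_real (a - b) * v n)"
      by (simp only: norm_triangle_ineq)
  qed
  also have "\<dots> = a * l1 (u - v) + \<bar>a - b\<bar> * l1 v"
    using ab by (simp add: l1_scale[OF d] l1_scale[OF v] del: minus_apply of_real_diff)
  also have "\<dots> \<le> l1 (u - v) + l1 (u - v)"
  proof (rule add_mono)
    show "a * l1 (u - v) \<le> l1 (u - v)" using ab by (simp add: mult_left_le_one_le)
    define mu mv where "mu = max 1 (l1 u / r)" and "mv = max 1 (l1 v / r)"
    have m: "1 \<le> mu" "1 \<le> mv" by (auto simp: mu_def mv_def)
    have "a - b = (mv - mu) / (mu * mv)" using m by (simp add: a_def b_def cut_def mu_def[symmetric] mv_def[symmetric] field_simps)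
    then have e: "\<bar>a - b\<bar> = \<bar>mv - mu\<bar> / (mu * mv)" using m by (simp add: abs_mult)
    have "\<bar>mv - mu\<bar> \<le> l1 (u - v) / r"
    proof -
      have "\<bar>mv - mu\<bar> \<le> \<bar>l1 v / r - l1 u / r\<bar>" by (simp add: mu_def mv_def max_def)
      also have "\<dots> = \<bar>l1 u - l1 v\<bar> / r" using r by (simp add: abs_minus_commute flip: diff_divide_distrib)
      also have "\<dots> \<le> l1 (u - v) / r" using abs_l1_diff_le[OF u v] r by (intro divide_right_mono) auto
      finally show ?thesis .
    qed
    then have "\<bar>a - b\<bar> \<le> (l1 (u - v) / r) / (mu * mv)" unfolding e using m by (intro divide_right_mono) auto
    also have "\<dots> \<le> (l1 (u - v) / r) / (1 * mv)" using m r by (intro divide_left_mono mult_right_mono mult_pos_pos) auto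
    finally have "\<bar>a - b\<bar> * l1 v \<le> (l1 (u - v) / r) / mv * l1 v" by (intro mult_right_mono) auto
    also have "\<dots> = l1 (u - v) / r * (b * l1 v)" by (simp add: b_def cut_def mv_def)
    also have "\<dots> \<le> l1 (u - v) / r * r" using cut_mult_le[OF r, of v] r unfolding b_def by (intro mult_left_mono) auto
    finally show "\<bar>a - b\<bar> * l1 v \<le> l1 (u - v)" using r by simp
  qed
  finally have du: "l1 (u' - v') \<le> 2 * l1 (u - v)" by simp
  show "in_l1 f" unfolding fe by (rule cubic_diff_l1(1)[OF l])
  have "l1 f \<le> 3 * r\<^sup>2 * l1 (u' - v')" unfolding fe by (rule cubic_diff_l1(2)[OF l])
  also have "\<dots> \<le> 3 * r\<^sup>2 * (2 * l1 (u - v))" by (intro mult_left_mono du) auto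
  finally show "l1 f \<le> 6 * r\<^sup>2 * l1 (u - v)" by simp
qed

lemma continuous_on_atLeast_0I:
  fixes f :: "real \<Rightarrow> 'a :: topological_space"
  assumes "\<And>b. continuous_on {0..b} f"
  shows "continuous_on {0..} f"
  unfolding continuous_on_def
proof
  fix t :: real assume t: "t \<in> {0..}"
  have "(f \<longlongrightarrow> f t) (at t within {0..t + 1})"
    using assms[of "t + 1"] t by (simp add: continuous_on_def)
  moreover have "at t within {0..t + 1} = at t within {0..}"
    by (rule at_within_nhd[where S = "{t - 1<..<t + 1}"]) auto
  ultimately show "(f \<longlongrightarrow> f t) (at t within {0..})" by simp
qed

section \<open>The Duhamel map and its fixed point\<close>

definition l1_cont :: "(real \<Rightarrow> int \<Rightarrow> complex) \<Rightarrow> bool" where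
  "l1_cont V \<longleftrightarrow> (\<forall>t\<ge>0. in_l1 (V t)) \<and> (\<forall>t0\<ge>0. ((\<lambda>t. l1 (V t - V t0)) \<longlongrightarrow> 0) (at t0 within {0..}))"

lemma l1_cont_norm:
  assumes V: "l1_cont V"
  shows "continuous_on {0..} (\<lambda>t. l1 (V t))"
  unfolding continuous_on_def
proof
  fix t0 :: real assume t0: "t0 \<in> {0..}"
  have "((\<lambda>t. l1 (V t) - l1 (V t0)) \<longlongrightarrow> 0) (at t0 within {0..})"
  proof (rule Lim_null_comparison)
    show "((\<lambda>t. l1 (V t - V t0)) \<longlongrightarrow> 0) (at t0 within {0..})" using V t0 by (simp add: l1_cont_def)
    have "\<forall>\<^sub>F t in at t0 within {0..}. 0 \<le> t" by (simp add: eventually_at_filter)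
    then show "\<forall>\<^sub>F t in at t0 within {0..}. norm (l1 (V t) - l1 (V t0)) \<le> l1 (V t - V t0)"
    proof eventually_elim
      case (elim t)
      then show ?case using abs_l1_diff_le[of "V t" "V t0"] V t0 by (simp add: l1_cont_def)
    qed
  qed
  then show "((\<lambda>t. l1 (V t)) \<longlongrightarrow> l1 (V t0)) (at t0 within {0..})" by (rule LIM_zero_cancel)
qed

lemma l1_cont_cubic:
  assumes V: "l1_cont V"
  shows "continuous_on {0..} (\<lambda>t. cubic (V t) n)"
  unfolding continuous_on_def
proof
  fix t0 :: real assume t0: "t0 \<in> {0..}"
  have lim: "((\<lambda>t. l1 (V t - V t0)) \<longlongrightarrow> 0) (at t0 within {0..})" using V t0 by (simp add: l1_cont_def)
  have in1: "in_l1 (V t)" if "0 \<le> t" for t using V that by (simp add: l1_cont_def)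
  define R where "R = l1 (V t0) + 1"
  have "((\<lambda>t. cubic (V t) n - cubic (V t0) n) \<longlongrightarrow> 0) (at t0 within {0..})"
  proof (rule Lim_null_comparison)
    have "((\<lambda>t. 3 * R\<^sup>2 * l1 (V t - V t0)) \<longlongrightarrow> 3 * R\<^sup>2 * 0) (at t0 within {0..})" by (intro tendsto_intros lim)
    then show "((\<lambda>t. 3 * R\<^sup>2 * l1 (V t - V t0)) \<longlongrightarrow> 0) (at t0 within {0..})" by simp
    have "\<forall>\<^sub>F t in at t0 within {0..}. 0 \<le> t" by (simp add: eventually_at_filter)
    moreover have "\<forall>\<^sub>F t in at t0 within {0..}. l1 (V t - V t0) < 1" by (rule order_tendstoD(2)[OF lim]) simp
    ultimately show "\<forall>\<^sub>F t in at t0 within {0..}. norm (cubic (V t) n - cubic (V t0) n) \<le> 3 * R\<^sup>2 * l1 (V t - V t0)"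
    proof eventually_elim
      case (elim t)
      have i: "in_l1 (V t)" "in_l1 (V t0)" using in1 elim t0 by auto
      have b: "l1 (V t) \<le> R" "l1 (V t0) \<le> R" using l1_le_diff[OF i] elim by (auto simp: R_def)
      note c = cubic_diff_l1[OF i b]
      show ?case using cmod_le_l1[OF c(1), of n] c(2) by simp
    qed
  qed
  then show "((\<lambda>t. cubic (V t) n) \<longlongrightarrow> cubic (V t0) n) (at t0 within {0..})" by (rule LIM_zero_cancel)
qed

context
  fixes \<gamma> \<omega> :: real and \<beta> :: complex and L :: real and u0 :: "int \<Rightarrow> complex" and R :: "real \<Rightarrow> real"
  assumes u0: "in_Hs 1 u0" and Rc: "continuous_on {0..} R" and R1: "\<And>t. 0 \<le> t \<Longrightarrow> 1 \<le> R t"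
begin

text \<open>The cube reflects the homogeneity of \<open>cubic\<close>: multiplying the cubic term by
  it amounts to evaluating \<open>cubic\<close> at the retracted sequence.\<close>

definition cutoff :: "(real \<Rightarrow> int \<Rightarrow> complex) \<Rightarrow> real \<Rightarrow> real" where
  "cutoff V t = cut (R t) (V t) ^ 3"

text \<open>Duhamel's formula for one mode, with the propagator pulled out of the integral so that
  \<open>t\<close> enters the integral only as its upper limit and can be differentiated
  there.\<close>

definition picard :: "(real \<Rightarrow> int \<Rightarrow> complex) \<Rightarrow> real \<Rightarrow> int \<Rightarrow> complex" where
  "picard V t n = exp (symb \<gamma> \<beta> L n * complex_of_real t) *
     (u0 n + integral {0..t} (\<lambda>\<tau>. exp (- symb \<gamma> \<beta> L n * complex_of_real \<tau>) * nonlin \<omega> (cutoff V) V \<tau> n))"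

lemma cutoff_bounds: "0 \<le> cutoff V t" "cutoff V t \<le> 1"
  using cut_bounds[of "R t" "V t"] by (auto simp: cutoff_def intro!: power_le_one)

lemma nonlin_continuous:
  assumes V: "l1_cont V"
  shows "continuous_on {0..} (\<lambda>\<tau>. nonlin \<omega> (cutoff V) V \<tau> n)"
proof -
  have "R t \<noteq> 0" if "t \<in> {0..}" for t using R1[of t] that by auto
  then show ?thesis
    unfolding nonlin_def cutoff_def cut_def
    by (intro continuous_intros l1_cont_cubic[OF V] l1_cont_norm[OF V] Rc) (auto simp: max_def)
qed

lemma picard_0: "picard V 0 = u0"
  by (auto simp: picard_def)

lemma picard_modes:
  assumes V: "l1_cont V"
  shows "forced \<gamma> \<beta> L (picard V) (nonlin \<omega> (cutoff V) V) 0 T"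
    and "continuous_on {0..} (\<lambda>t. picard V t n)"
proof -
  define f where "f n \<tau> = exp (- symb \<gamma> \<beta> L n * complex_of_real \<tau>) * nonlin \<omega> (cutoff V) V \<tau> n" for n \<tau>
  have fc: "continuous_on {0..} (f n)" for n
    unfolding f_def by (intro continuous_intros nonlin_continuous V)
  have J: "((\<lambda>t. integral {0..t} (f n)) has_vector_derivative f n t) (at t within {0..b})" if "t \<in> {0..b}" for n t b
    using that by (intro integral_has_vector_derivative continuous_on_subset[OF fc]) auto
  have E: "((\<lambda>t. exp (symb \<gamma> \<beta> L n * complex_of_real t)) has_vector_derivative symb \<gamma> \<beta> L n * exp (symb \<gamma> \<beta> L n * complex_of_real t)) (at t within S)" for n t S
    by (rule has_vector_derivative_real_field) (auto intro!: derivative_eq_intros)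
  have P: "((\<lambda>t. picard V t n) has_vector_derivative symb \<gamma> \<beta> L n * picard V t n + nonlin \<omega> (cutoff V) V t n) (at t within {0..b})" if "t \<in> {0..b}" for n t b
  proof -
    have "((\<lambda>t. exp (symb \<gamma> \<beta> L n * complex_of_real t) * (u0 n + integral {0..t} (f n))) has_vector_derivative 
       exp (symb \<gamma> \<beta> L n * complex_of_real t) * (0 + f n t) + (symb \<gamma> \<beta> L n * exp (symb \<gamma> \<beta> L n * complex_of_real t)) * (u0 n + integral {0..t} (f n))) (at t within {0..b})"
      by (intro has_vector_derivative_mult E has_vector_derivative_add has_vector_derivative_const J that)
    moreover have "exp (symb \<gamma> \<beta> L n * complex_of_real t) * f n t = nonlin \<omega> (cutoff V) V t n"
      unfolding f_def mult.assoc[symmetric] exp_add[symmetric] by simp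
    ultimately show ?thesis
      unfolding picard_def f_def[symmetric] by (simp add: algebra_simps)
  qed
  have cont: "continuous_on {0..b} (\<lambda>t. picard V t n)" for n b
    by (rule continuous_on_vector_derivative, rule P)
  show "continuous_on {0..} (\<lambda>t. picard V t n)" by (rule continuous_on_atLeast_0I[OF cont])
  show "forced \<gamma> \<beta> L (picard V) (nonlin \<omega> (cutoff V) V) 0 T"
    unfolding forced_def
  proof (intro conjI allI ballI cont)
    fix n t assume t: "t \<in> {0<..<T}"
    then show "((\<lambda>t. picard V t n) has_vector_derivative symb \<gamma> \<beta> L n * picard V t n + nonlin \<omega> (cutoff V) V t n) (at t)"
      using P[of t T n] at_within_Icc_at[of 0 t T] by simp
  qed
qed

lemma nonlin_diff_bound:
  assumes V: "l1_cont V" and W: "l1_cont W" and \<tau>: "0 \<le> \<tau>"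
  shows "in_Hs 0 (\<lambda>n. nonlin \<omega> (cutoff V) V \<tau> n - nonlin \<omega> (cutoff W) W \<tau> n)"
    and "Hs_norm 0 (\<lambda>n. nonlin \<omega> (cutoff V) V \<tau> n - nonlin \<omega> (cutoff W) W \<tau> n)
      \<le> cmod (1 + \<i> * complex_of_real \<omega>) * (6 * (R \<tau>)\<^sup>2 * l1 (V \<tau> - W \<tau>))"
proof -
  define c where "c = 1 + \<i> * complex_of_real \<omega>"
  define f where "f = (\<lambda>n. complex_of_real (cut (R \<tau>) (V \<tau>) ^ 3) * cubic (V \<tau>) n - complex_of_real (cut (R \<tau>) (W \<tau>) ^ 3) * cubic (W \<tau>) n)"
  define g where "g = (\<lambda>n. nonlin \<omega> (cutoff V) V \<tau> n - nonlin \<omega> (cutoff W) W \<tau> n)"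
  have i: "in_l1 (V \<tau>)" "in_l1 (W \<tau>)" using V W \<tau> by (auto simp: l1_cont_def)
  have r: "0 < R \<tau>" using R1[OF \<tau>] by linarith
  have f: "in_l1 f" "l1 f \<le> 6 * (R \<tau>)\<^sup>2 * l1 (V \<tau> - W \<tau>)"
    using cut_cubic_lipschitz[OF i r] by (auto simp: f_def)
  have gf: "cmod (g n) = cmod c * cmod (f n)" for n
  proof -
    have "g n = - (c * f n)" by (simp add: g_def f_def nonlin_def c_def cutoff_def algebra_simps)
    then show ?thesis by (simp add: norm_mult)
  qed
  have g: "in_l1 g" "l1 g = cmod c * l1 f"
    using f(1) unfolding in_l1_def l1_def gf by (simp_all add: infsum_cmult_right' summable_on_cmult_right)
  show "in_Hs 0 g" by (rule in_l1_imp_Hs0[OF g(1)])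
  have "Hs_norm 0 g \<le> cmod c * l1 f" using in_l1_imp_Hs0(2)[OF g(1)] g(2) by simp
  also have "\<dots> \<le> cmod c * (6 * (R \<tau>)\<^sup>2 * l1 (V \<tau> - W \<tau>))" by (intro mult_left_mono f) auto
  finally show "Hs_norm 0 g \<le> cmod c * (6 * (R \<tau>)\<^sup>2 * l1 (V \<tau> - W \<tau>))" .
qed

lemma l1_cont_zero: "l1_cont (\<lambda>t n. 0)"
proof -
  have "l1 ((\<lambda>n. 0) - (\<lambda>n. 0)) = 0" by (simp add: l1_def)
  then show ?thesis by (simp add: l1_cont_def in_l1_def)
qed

lemma R_bounded: "\<exists>C\<ge>0. \<forall>t\<in>{0..T}. R t \<le> C"
proof -
  have "compact (R ` {0..T})"
    by (intro compact_continuous_image continuous_on_subset[OF Rc]) auto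
  then obtain B where "\<forall>x\<in>R ` {0..T}. norm x \<le> B"
    using compact_imp_bounded bounded_iff by blast
  then show ?thesis by (intro exI[of _ "max B 0"]) force
qed

lemma picard_H1:
  assumes V: "l1_cont V"
  shows picard_in_H1: "0 \<le> t \<Longrightarrow> in_Hs 1 (picard V t)"
    and picard_H1_bounded: "\<exists>B. \<forall>t\<in>{0..T}. Hs_norm 1 (picard V t) \<le> B"
    and picard_l1_cont: "l1_cont (picard V)"
    and picard_H0_cont: "0 \<le> t0 \<Longrightarrow> ((\<lambda>t. Hs_norm 0 (picard V t - picard V t0)) \<longlongrightarrow> 0) (at t0 within {0..})"
proof -
  have main: "\<exists>B. \<forall>t\<in>{0..T}. in_Hs 1 (picard V t) \<and> Hs_norm 1 (picard V t) \<le> B" for T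
  proof -
    define c where "c = cmod (1 + \<i> * complex_of_real \<omega>)"
    obtain C where C: "0 \<le> C" "\<And>t. t \<in> {0..T} \<Longrightarrow> R t \<le> C" using R_bounded by blast
    have "compact ((\<lambda>t. l1 (V t)) ` {0..T})"
      by (intro compact_continuous_image continuous_on_subset[OF l1_cont_norm[OF V]]) auto
    then obtain D where D: "\<forall>x\<in>(\<lambda>t. l1 (V t)) ` {0..T}. norm x \<le> D"
      using compact_imp_bounded bounded_iff by blast
    define h where "h = (c * (6 * C\<^sup>2 * D))\<^sup>2"
    define B where "B = sqrt (exp ((2 * \<bar>Re \<beta>\<bar> + 2) * T) * ((Hs_norm 1 u0)\<^sup>2 + h * T))"
    have "in_Hs 1 (picard V t) \<and> Hs_norm 1 (picard V t) \<le> B" if t: "t \<in> {0..T}" for t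
    proof -
      have F: "in_Hs 0 (nonlin \<omega> (cutoff V) V \<tau>) \<and> (Hs_norm 0 (nonlin \<omega> (cutoff V) V \<tau>))\<^sup>2 \<le> h" if \<tau>: "\<tau> \<in> {0<..<t}" for \<tau>
      proof -
        have z: "nonlin \<omega> (cutoff (\<lambda>t n. 0)) (\<lambda>t n. 0) \<tau> n = 0" for n by (simp add: nonlin_def cubic_def case_prod_unfold)
        have v0: "V \<tau> - (\<lambda>n. 0) = V \<tau>" by auto
        have p: "0 \<le> \<tau>" and pT: "\<tau> \<in> {0..T}" using \<tau> t by auto
        \<comment> \<open>The growth bound of the cutoff nonlinearity is its Lipschitz bound against
          the zero path.\<close>
        note nb = nonlin_diff_bound[OF V l1_cont_zero p, unfolded z v0 diff_0_right]
        have "Hs_norm 0 (nonlin \<omega> (cutoff V) V \<tau>) \<le> c * (6 * (R \<tau>)\<^sup>2 * l1 (V \<tau>))" using nb(2) by (simp add: c_def)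
        also have "\<dots> \<le> c * (6 * C\<^sup>2 * D)"
          using C(2)[OF pT] D pT R1[OF p] C(1) by (intro mult_left_mono mult_mono power_mono) (auto simp: c_def)
        finally have "(Hs_norm 0 (nonlin \<omega> (cutoff V) V \<tau>))\<^sup>2 \<le> h" unfolding h_def by (intro power_mono) auto
        then show ?thesis using nb(1) by simp
      qed
      have U0: "in_Hs 1 (picard V 0)" by (simp add: picard_0 u0)
      have t0: "0 \<le> t" using t by simp
      note fb = forced_H1_bound[OF picard_modes(1)[OF V] t0 U0 integrable_const_ivl F]
      have "(Hs_norm 1 (picard V t))\<^sup>2 \<le> exp ((2 * \<bar>Re \<beta>\<bar> + 2) * t) * ((Hs_norm 1 u0)\<^sup>2 + h * t)"
        using fb(2) t0 by (simp add: picard_0 mult.commute)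
      also have "\<dots> \<le> exp ((2 * \<bar>Re \<beta>\<bar> + 2) * T) * ((Hs_norm 1 u0)\<^sup>2 + h * T)"
        using t by (intro mult_mono add_left_mono mult_left_mono) (auto simp: h_def intro!: mult_left_mono add_nonneg_nonneg)
      finally show ?thesis using fb(1) by (auto simp: B_def intro: real_le_rsqrt)
    qed
    then show ?thesis by blast
  qed
  show H1: "in_Hs 1 (picard V t)" if "0 \<le> t" for t
    using main[of t] that by (meson atLeastAtMost_iff order_refl)
  show bd: "\<exists>B. \<forall>t\<in>{0..T}. Hs_norm 1 (picard V t) \<le> B" for T using main[of T] by blast
  note c = H1_bounded_imp_continuous[OF picard_modes(2)[OF V] H1 bd]
  show "((\<lambda>t. Hs_norm 0 (picard V t - picard V t0)) \<longlongrightarrow> 0) (at t0 within {0..})" if "0 \<le> t0" for t0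
    using c(1)[OF _ that] by blast
  show "l1_cont (picard V)" unfolding l1_cont_def using c(2) H1 in_Hs1_imp_l1 by blast
qed

text \<open>A Volterra estimate for the squared H^1 distance. The continuous majorant
  \<open>h\<close> stands in for that distance, which would otherwise have to be shown integrable in
  time.\<close>

lemma picard_diff:
  "\<exists>K>0. \<forall>V W h t. l1_cont V \<and> l1_cont W \<and> t \<in> {0..T} \<and> continuous_on {0..T} h \<and>
     (\<forall>\<tau>\<in>{0..T}. in_Hs 1 (V \<tau> - W \<tau>) \<and> (Hs_norm 1 (V \<tau> - W \<tau>))\<^sup>2 \<le> h \<tau>) \<longrightarrow>
     in_Hs 1 (picard V t - picard W t) \<and> (Hs_norm 1 (picard V t - picard W t))\<^sup>2 \<le> K * integral {0..t} h"
proof -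
  define c where "c = cmod (1 + \<i> * complex_of_real \<omega>)"
  obtain C where C: "0 \<le> C" "\<And>t. t \<in> {0..T} \<Longrightarrow> R t \<le> C" using R_bounded by blast
  \<comment> \<open>The factor 24 is 6 from \<open>cut_cubic_lipschitz\<close> times 4 from
    \<open>l1_le_Hs1\<close>.\<close>
  define K0 where "K0 = (c * (24 * C\<^sup>2))\<^sup>2"
  define K where "K = exp ((2 * \<bar>Re \<beta>\<bar> + 2) * T) * K0 + 1"
  have Kp: "0 < K" by (simp add: K_def K0_def add_nonneg_pos)
  have "in_Hs 1 (picard V t - picard W t) \<and> (Hs_norm 1 (picard V t - picard W t))\<^sup>2 \<le> K * integral {0..t} h"
    if V: "l1_cont V" and W: "l1_cont W" and t: "t \<in> {0..T}" and hc: "continuous_on {0..T} h"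
      and hb: "\<forall>\<tau>\<in>{0..T}. in_Hs 1 (V \<tau> - W \<tau>) \<and> (Hs_norm 1 (V \<tau> - W \<tau>))\<^sup>2 \<le> h \<tau>" for V W h t
  proof -
    define D where "D = (\<lambda>t. picard V t - picard W t)"
    define F where "F = (\<lambda>\<tau> n. nonlin \<omega> (cutoff V) V \<tau> n - nonlin \<omega> (cutoff W) W \<tau> n)"
    have fo: "forced \<gamma> \<beta> L D F 0 t"
      using picard_modes(1)[OF V, of t] picard_modes(1)[OF W, of t] unfolding forced_def D_def F_def
      by (auto intro!: continuous_intros derivative_eq_intros simp: algebra_simps)
    have t0: "0 \<le> t" using t by simp
    have D0: "D 0 = (\<lambda>n. 0)" by (auto simp: D_def picard_0)
    have D0': "in_Hs 1 (D 0)" "Hs_norm 1 (D 0) = 0" by (simp_all add: D0 in_Hs_def Hs_norm_def Hs_weight_def[abs_def])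
    have hi: "h integrable_on {0..t}"
      using t by (intro integrable_continuous_real continuous_on_subset[OF hc]) auto
    have hnn: "0 \<le> integral {0..t} h"
    proof (intro integral_nonneg hi)
      fix \<tau> assume "\<tau> \<in> {0..t}"
      then have "(Hs_norm 1 (V \<tau> - W \<tau>))\<^sup>2 \<le> h \<tau>" using hb t by auto
      then show "0 \<le> h \<tau>" by (rule order_trans[OF zero_le_power2])
    qed
    have F: "in_Hs 0 (F \<tau>) \<and> (Hs_norm 0 (F \<tau>))\<^sup>2 \<le> K0 *\<^sub>R h \<tau>" if \<tau>: "\<tau> \<in> {0<..<t}" for \<tau>
    proof -
      have p: "0 \<le> \<tau>" and pT: "\<tau> \<in> {0..T}" using \<tau> t by auto
      note nb = nonlin_diff_bound[OF V W p, folded F_def c_def]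
      have "Hs_norm 0 (F \<tau>) \<le> c * (6 * (R \<tau>)\<^sup>2 * l1 (V \<tau> - W \<tau>))" using nb(2) by (simp add: F_def c_def)
      also have "\<dots> \<le> c * (6 * C\<^sup>2 * (4 * Hs_norm 1 (V \<tau> - W \<tau>)))"
        using C(2)[OF pT] R1[OF p] C(1) hb pT
        by (intro mult_left_mono mult_mono power_mono l1_le_Hs1) (auto simp: c_def)
      finally have "(Hs_norm 0 (F \<tau>))\<^sup>2 \<le> (c * (6 * C\<^sup>2 * (4 * Hs_norm 1 (V \<tau> - W \<tau>))))\<^sup>2" by (intro power_mono) auto
      also have "\<dots> = K0 * (Hs_norm 1 (V \<tau> - W \<tau>))\<^sup>2" by (simp add: K0_def power_mult_distrib)
      also have "\<dots> \<le> K0 * h \<tau>" using hb pT by (intro mult_left_mono) (auto simp: K0_def)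
      finally show ?thesis using nb(1) by (simp add: F_def)
    qed
    note fb = forced_H1_bound[OF fo t0 D0'(1) integrable_cmul[OF hi, of K0] F]
    have "(Hs_norm 1 (D t))\<^sup>2 \<le> exp ((2 * \<bar>Re \<beta>\<bar> + 2) * t) * (K0 * integral {0..t} h)"
      using fb(2) by (simp add: D0'(2))
    also have "\<dots> \<le> exp ((2 * \<bar>Re \<beta>\<bar> + 2) * T) * (K0 * integral {0..t} h)"
      using t hnn by (intro mult_right_mono) (auto simp: K0_def intro!: mult_left_mono)
    also have "\<dots> \<le> K * integral {0..t} h" using hnn by (simp add: K_def distrib_right)
    finally show ?thesis using fb(1) unfolding D_def by blast
  qed
  then show ?thesis using Kp by blast
qed

text \<open>The global Lipschitz property lets the iterates converge in H^1 uniformly on each [0,T]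
  without a smallness condition on T; letting T vary gives one fixed point for all t \<ge>
  0.\<close>

lemma picard_fixpoint: "\<exists>U. l1_cont U \<and> (\<forall>t\<ge>0. picard U t = U t)"
proof -
  define V where "V k = (picard ^^ k) (\<lambda>t n. 0)" for k
  have V0: "V 0 = (\<lambda>t n. 0)" and VS: "V (Suc k) = picard (V k)" for k by (simp_all add: V_def)
  have Vc: "l1_cont (V k)" for k by (induction k) (auto simp: V0 VS l1_cont_zero picard_l1_cont)
  have Vm: "continuous_on {0..} (\<lambda>t. V k t n)" for k n
    by (cases k) (auto simp: V0 VS intro!: picard_modes(2) Vc)
  have geom: "\<exists>C\<ge>0. \<forall>k. \<forall>t\<in>{0..T}. in_Hs 1 (V (Suc k) t - V k t) \<and> Hs_norm 1 (V (Suc k) t - V k t) \<le> C * (1/2) ^ k" for T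
  proof -
    obtain K where K: "0 < K" "\<And>V W h t. l1_cont V \<Longrightarrow> l1_cont W \<Longrightarrow> t \<in> {0..T} \<Longrightarrow> continuous_on {0..T} h \<Longrightarrow>
       (\<forall>\<tau>\<in>{0..T}. in_Hs 1 (V \<tau> - W \<tau>) \<and> (Hs_norm 1 (V \<tau> - W \<tau>))\<^sup>2 \<le> h \<tau>) \<Longrightarrow>
       in_Hs 1 (picard V t - picard W t) \<and> (Hs_norm 1 (picard V t - picard W t))\<^sup>2 \<le> K * integral {0..t} h"
      using picard_diff[of T] by blast
    obtain B where B: "\<And>t. t \<in> {0..T} \<Longrightarrow> Hs_norm 1 (V 1 t) \<le> B" 
      using picard_H1_bounded[OF Vc[of 0], of T] unfolding One_nat_def VS by blast
    \<comment> \<open>An exponentially weighted norm: integrating exp(4 K t) costs a division by 4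
      K, so each application of \<open>picard_diff\<close> gains 1/4 in the square and 1/2 in the
      norm, whatever \<open>T\<close> is.\<close>
    have step: "\<forall>t\<in>{0..T}. in_Hs 1 (V (Suc k) t - V k t) \<and> (Hs_norm 1 (V (Suc k) t - V k t))\<^sup>2 \<le> B\<^sup>2 * exp (4 * K * t) * (1/4) ^ k" for k
    proof (induction k)
      case 0
      show ?case
      proof
        fix t assume t: "t \<in> {0..T}"
        have e: "V (Suc 0) t - V 0 t = V 1 t" by (auto simp: V0)
        have "(Hs_norm 1 (V 1 t))\<^sup>2 \<le> B\<^sup>2" by (intro power_mono B t) simp
        also have "\<dots> \<le> B\<^sup>2 * exp (4 * K * t)" using t K(1) by (simp add: mult_le_cancel_left1)
        finally show "in_Hs 1 (V (Suc 0) t - V 0 t) \<and> (Hs_norm 1 (V (Suc 0) t - V 0 t))\<^sup>2 \<le> B\<^sup>2 * exp (4 * K * t) * (1/4) ^ 0"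
          unfolding e using picard_in_H1[OF Vc[of 0], of t] VS[of 0] t by simp
      qed
    next
      case (Suc k)
      show ?case
      proof
        fix t assume t: "t \<in> {0..T}"
        define h where "h \<tau> = B\<^sup>2 * exp (4 * K * \<tau>) * (1/4) ^ k" for \<tau>
        have "(h has_integral (B\<^sup>2 * exp (4 * K * t) * (1/4) ^ k / (4 * K) - B\<^sup>2 * exp (4 * K * 0) * (1/4) ^ k / (4 * K))) {0..t}"
          unfolding h_def using t K(1)
          by (intro fundamental_theorem_of_calculus)
             (auto intro!: derivative_eq_intros simp flip: has_real_derivative_iff_has_vector_derivative)
        then have i: "integral {0..t} h = B\<^sup>2 * exp (4 * K * t) * (1/4) ^ k / (4 * K) - B\<^sup>2 * (1/4) ^ k / (4 * K)"
          by (simp add: integral_unique)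
        have "in_Hs 1 (V (Suc (Suc k)) t - V (Suc k) t) \<and> (Hs_norm 1 (V (Suc (Suc k)) t - V (Suc k) t))\<^sup>2 \<le> K * integral {0..t} h"
        proof -
          have hc: "continuous_on {0..T} h" unfolding h_def by (intro continuous_intros)
          show ?thesis unfolding VS[of "Suc k"] VS[of k]
            by (rule K(2)[OF picard_l1_cont[OF Vc] Vc t hc]) (use Suc in \<open>unfold h_def VS, blast\<close>)
        qed
        moreover have "K * integral {0..t} h \<le> B\<^sup>2 * exp (4 * K * t) * (1/4) ^ Suc k"
          using K(1) by (simp add: i field_simps)
        ultimately show "in_Hs 1 (V (Suc (Suc k)) t - V (Suc k) t) \<and> (Hs_norm 1 (V (Suc (Suc k)) t - V (Suc k) t))\<^sup>2 \<le> B\<^sup>2 * exp (4 * K * t) * (1/4) ^ Suc k"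
          by linarith
      qed
    qed
    define C where "C = \<bar>B\<bar> * exp (2 * K * T)"
    show ?thesis
    proof (intro exI[of _ C] conjI allI ballI)
      show "0 \<le> C" by (simp add: C_def)
      fix k t assume t: "t \<in> {0..T}"
      show "in_Hs 1 (V (Suc k) t - V k t)" using step t by blast
      have "(Hs_norm 1 (V (Suc k) t - V k t))\<^sup>2 \<le> B\<^sup>2 * exp (4 * K * t) * (1/4) ^ k" using step t by blast
      also have "\<dots> \<le> B\<^sup>2 * exp (4 * K * T) * (1/4) ^ k"
        using t K(1) by (intro mult_right_mono mult_left_mono) auto
      also have "\<dots> = (C * (1/2) ^ k)\<^sup>2"
      proof -
        have "exp (4 * K * T) = (exp (2 * K * T))\<^sup>2" by (simp add: power2_eq_square flip: exp_add)
        moreover have "(1/4 :: real) ^ k = ((1/2) ^ k)\<^sup>2" by (simp add: power2_eq_square flip: power_mult_distrib)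
        ultimately show ?thesis by (simp add: C_def power_mult_distrib)
      qed
      finally show "Hs_norm 1 (V (Suc k) t - V k t) \<le> C * (1/2) ^ k"
        by (rule power2_le_imp_le) (simp add: C_def)
    qed
  qed
  have cauchy: "\<exists>C\<ge>0. \<forall>k. \<forall>m\<ge>k. \<forall>t\<in>{0..T}. in_Hs 1 (V m t - V k t) \<and> Hs_norm 1 (V m t - V k t) \<le> 2 * C * (1/2) ^ k" for T
  proof -
    obtain C where C: "0 \<le> C" "\<And>k t. t \<in> {0..T} \<Longrightarrow> in_Hs 1 (V (Suc k) t - V k t) \<and> Hs_norm 1 (V (Suc k) t - V k t) \<le> C * (1/2) ^ k"
      using geom[of T] by blast
    \<comment> \<open>Keeping the subtracted power makes the induction on \<open>m\<close> exact:
      the increment C (1/2)^m is precisely what it releases.\<close>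
    have "in_Hs 1 (V m t - V k t) \<and> Hs_norm 1 (V m t - V k t) \<le> 2 * C * ((1/2) ^ k - (1/2) ^ m)" if "t \<in> {0..T}" "k \<le> m" for t k m
      using that(2)
    proof (induction m rule: dec_induct)
      case base
      have "V k t - V k t = (\<lambda>n. 0)" by auto
      then show ?case by (simp add: in_Hs_def Hs_norm_def Hs_weight_def[abs_def])
    next
      case (step m)
      have "in_Hs 1 (V (Suc m) t - V k t)"
        using step.IH C(2)[OF that(1), of m] by (blast intro: in_Hs_diff_trans)
      moreover have "Hs_norm 1 (V (Suc m) t - V k t) \<le> Hs_norm 1 (V (Suc m) t - V m t) + Hs_norm 1 (V m t - V k t)"
        using step.IH C(2)[OF that(1), of m] by (blast intro: Hs_norm_diff_triangle)
      moreover have "Hs_norm 1 (V (Suc m) t - V m t) \<le> C * (1/2) ^ m" using C(2)[OF that(1)] by blast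
      moreover have "Hs_norm 1 (V m t - V k t) \<le> 2 * C * ((1/2) ^ k - (1/2) ^ m)" using step.IH by blast
      moreover have "C * (1/2) ^ m + 2 * C * ((1/2) ^ k - (1/2) ^ m) = 2 * C * ((1/2) ^ k - (1/2) ^ Suc m)"
        by (simp add: algebra_simps)
      ultimately show ?case by (intro conjI) linarith+
    qed
    moreover have "2 * C * ((1/2) ^ k - (1/2) ^ m) \<le> 2 * C * (1/2) ^ k" for k m
      using C(1) by (intro mult_left_mono) auto
    ultimately show ?thesis using C(1) by (meson order_trans)
  qed
  define U where "U t n = lim (\<lambda>k. V k t n)" for t n
  have half0: "(\<lambda>k. D * (1/2) ^ k) \<longlonglongrightarrow> 0" for D :: real
    by (rule tendsto_mult_right_zero[OF LIMSEQ_power_zero]) simp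
  have lim: "(\<lambda>k. V k t n) \<longlonglongrightarrow> U t n" if t: "0 \<le> t" for t n
  proof -
    obtain C where C: "0 \<le> C" "\<And>k m s. k \<le> m \<Longrightarrow> s \<in> {0..t} \<Longrightarrow> in_Hs 1 (V m s - V k s) \<and> Hs_norm 1 (V m s - V k s) \<le> 2 * C * (1/2) ^ k"
      using cauchy[of t] by blast
    have "Cauchy (\<lambda>k. V k t n)"
    proof (rule CauchyI')
      fix e :: real assume e: "0 < e"
      have "\<forall>\<^sub>F k in sequentially. 2 * C * (1/2) ^ k < e" by (rule order_tendstoD(2)[OF half0 e])
      then obtain M where M: "\<And>k. M \<le> k \<Longrightarrow> 2 * C * (1/2) ^ k < e" unfolding eventually_sequentially by blast
      have "norm (V m t n - V k t n) < e" if "M \<le> m" "m < k" for m k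
      proof -
        have b: "in_Hs 1 (V k t - V m t)" "Hs_norm 1 (V k t - V m t) \<le> 2 * C * (1/2) ^ m"
          using C(2)[of m k t] that t by auto
        have "norm (V m t n - V k t n) = cmod ((V k t - V m t) n)" by (simp add: norm_minus_commute)
        also have "\<dots> \<le> 2 * C * (1/2) ^ m" using cmod_le_Hs_norm[OF b(1)] b(2) by (meson order_trans zero_le_one)
        also have "\<dots> < e" using M that by blast
        finally show ?thesis .
      qed
      then show "\<exists>M. \<forall>m\<ge>M. \<forall>k>m. dist (V m t n) (V k t n) < e" unfolding dist_norm by blast
    qed
    then show ?thesis unfolding U_def by (simp add: Cauchy_convergent_iff convergent_LIMSEQ_iff)
  qed
  have close: "\<exists>C\<ge>0. \<forall>k. \<forall>t\<in>{0..T}. in_Hs 1 (U t - V k t) \<and> Hs_norm 1 (U t - V k t) \<le> 2 * C * (1/2) ^ k" for T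
  proof -
    obtain C where C: "0 \<le> C" "\<And>k m s. k \<le> m \<Longrightarrow> s \<in> {0..T} \<Longrightarrow> in_Hs 1 (V m s - V k s) \<and> Hs_norm 1 (V m s - V k s) \<le> 2 * C * (1/2) ^ k"
      using cauchy[of T] by blast
    have "in_Hs 1 (U t - V k t) \<and> Hs_norm 1 (U t - V k t) \<le> 2 * C * (1/2) ^ k" if t: "t \<in> {0..T}" for k t
    proof -
      have l: "(\<lambda>m. (V m t - V k t) n) \<longlonglongrightarrow> (U t - V k t) n" for n
        using tendsto_diff[OF lim[of t n] tendsto_const[of "V k t n"]] t by simp
      have ev: "\<forall>\<^sub>F m in sequentially. in_Hs 1 (V m t - V k t) \<and> Hs_norm 1 (V m t - V k t) \<le> 2 * C * (1/2) ^ k"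
        unfolding eventually_sequentially using C(2) t by blast
      have "0 \<le> 2 * C * (1/2) ^ k" using C(1) by simp
      then show ?thesis using Hs_norm_limit_le[where w = "U t - V k t", OF l _ ev] by blast
    qed
    then show ?thesis using C(1) by blast
  qed
  have U0: "U t - V 0 t = U t" for t by (auto simp: V0)
  have UH1: "in_Hs 1 (U t)" if "0 \<le> t" for t
    using close[of t] that U0[of t] by (metis atLeastAtMost_iff order_refl)
  have Ubd: "\<exists>B. \<forall>t\<in>{0..T}. Hs_norm 1 (U t) \<le> B" for T
    using close[of T] U0 by metis
  have Um: "continuous_on {0..} (\<lambda>t. U t n)" for n
  proof (rule continuous_on_atLeast_0I)
    fix b :: real
    obtain C where C: "0 \<le> C" "\<And>k t. t \<in> {0..b} \<Longrightarrow> in_Hs 1 (U t - V k t) \<and> Hs_norm 1 (U t - V k t) \<le> 2 * C * (1/2) ^ k"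
      using close[of b] by blast
    show "continuous_on {0..b} (\<lambda>t. U t n)"
    proof (rule uniform_limit_theorem)
      show "\<forall>\<^sub>F k in sequentially. continuous_on {0..b} (\<lambda>t. V k t n)"
        by (intro always_eventually allI continuous_on_subset[OF Vm]) auto
      show "uniform_limit {0..b} (\<lambda>k t. V k t n) (\<lambda>t. U t n) sequentially"
      proof (rule uniform_limitI)
        fix e :: real assume "0 < e"
        then have "\<forall>\<^sub>F k in sequentially. 2 * C * (1/2) ^ k < e" by (rule order_tendstoD(2)[OF half0])
        then show "\<forall>\<^sub>F k in sequentially. \<forall>t\<in>{0..b}. dist (V k t n) (U t n) < e"
        proof eventually_elim
          case (elim k)
          show ?case
          proof
            fix t assume "t \<in> {0..b}"
            note c = C(2)[OF this, of k]
            have "dist (V k t n) (U t n) = cmod ((U t - V k t) n)" by (simp add: dist_norm norm_minus_commute)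
            also have "\<dots> \<le> Hs_norm 1 (U t - V k t)" by (rule cmod_le_Hs_norm[OF conjunct1[OF c]]) simp
            finally show "dist (V k t n) (U t n) < e" using c elim by linarith
          qed
        qed
      qed
    qed simp
  qed
  have Uc: "l1_cont U"
    unfolding l1_cont_def using H1_bounded_imp_continuous(2)[OF Um UH1 Ubd] UH1 in_Hs1_imp_l1 by blast
  have "picard U t = U t" if t: "0 \<le> t" for t
  proof
    fix n
    obtain C where C: "0 \<le> C" "\<And>k s. s \<in> {0..t} \<Longrightarrow> in_Hs 1 (U s - V k s) \<and> Hs_norm 1 (U s - V k s) \<le> 2 * C * (1/2) ^ k"
      using close[of t] by blast
    obtain K where K: "0 < K" "\<And>V W h s. l1_cont V \<Longrightarrow> l1_cont W \<Longrightarrow> s \<in> {0..t} \<Longrightarrow> continuous_on {0..t} h \<Longrightarrow>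
       (\<forall>\<tau>\<in>{0..t}. in_Hs 1 (V \<tau> - W \<tau>) \<and> (Hs_norm 1 (V \<tau> - W \<tau>))\<^sup>2 \<le> h \<tau>) \<Longrightarrow>
       in_Hs 1 (picard V s - picard W s) \<and> (Hs_norm 1 (picard V s - picard W s))\<^sup>2 \<le> K * integral {0..s} h"
      using picard_diff[of t] by blast
    have b: "norm (V (Suc k) t n - picard U t n) \<le> sqrt (K * t) * (2 * C) * (1/2) ^ k" for k
    proof -
      have "in_Hs 1 (picard U t - V (Suc k) t) \<and> (Hs_norm 1 (picard U t - V (Suc k) t))\<^sup>2 \<le> K * integral {0..t} (\<lambda>_. (2 * C * (1/2) ^ k)\<^sup>2)"
        unfolding VS by (rule K(2)[OF Uc Vc]) (use C t in \<open>auto intro!: power_mono\<close>)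
      moreover have "K * integral {0..t} (\<lambda>_. (2 * C * (1/2) ^ k)\<^sup>2) = (sqrt (K * t) * (2 * C) * (1/2) ^ k)\<^sup>2"
        using t K(1) by (simp add: power_mult_distrib)
      ultimately have i: "in_Hs 1 (picard U t - V (Suc k) t)" and "(Hs_norm 1 (picard U t - V (Suc k) t))\<^sup>2 \<le> (sqrt (K * t) * (2 * C) * (1/2) ^ k)\<^sup>2"
        by auto
      then have "Hs_norm 1 (picard U t - V (Suc k) t) \<le> sqrt (K * t) * (2 * C) * (1/2) ^ k"
        by (intro power2_le_imp_le[of "Hs_norm 1 (picard U t - V (Suc k) t)"]) (use C(1) K(1) t in auto)
      moreover have "norm (V (Suc k) t n - picard U t n) \<le> Hs_norm 1 (picard U t - V (Suc k) t)"
        using cmod_le_Hs_norm[OF i, of n] by (simp add: norm_minus_commute)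
      ultimately show ?thesis by simp
    qed
    have "(\<lambda>k. V (Suc k) t n - picard U t n) \<longlonglongrightarrow> 0"
      by (rule Lim_null_comparison[OF always_eventually[OF allI[OF b]] half0])
    then have "(\<lambda>k. V (Suc k) t n) \<longlonglongrightarrow> picard U t n" by (rule LIM_zero_cancel)
    moreover have "(\<lambda>k. V (Suc k) t n) \<longlonglongrightarrow> U t n" using lim[OF t, of n] by (rule LIMSEQ_Suc)
    ultimately show "picard U t n = U t n" by (rule LIMSEQ_unique)
  qed
  then show ?thesis using Uc by blast
qed

lemma cutoff_solution_exists:
  "\<exists>U. damped_solution \<gamma> \<omega> \<beta> L (cutoff U) U \<and> U 0 = u0"
proof -
  obtain U where U: "l1_cont U" "\<And>t. 0 \<le> t \<Longrightarrow> picard U t = U t" using picard_fixpoint by blast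
  \<comment> \<open>Equal to \<open>U\<close> for t \<ge> 0, but given by Duhamel's formula, so that
    the regularity and differentiability lemmas apply to it directly.\<close>
  define W where "W = picard U"
  have WU: "W t = U t" if "0 \<le> t" for t using U(2)[OF that] by (simp add: W_def)
  have nl: "nonlin \<omega> (cutoff U) U \<tau> n = nonlin \<omega> (cutoff W) W \<tau> n" if "0 \<le> \<tau>" for \<tau> n
    by (simp add: nonlin_def cutoff_def WU[OF that])
  have "damped_solution \<gamma> \<omega> \<beta> L (cutoff W) W"
    unfolding damped_solution_def
  proof (intro conjI allI impI)
    fix t show "0 \<le> cutoff W t" "cutoff W t \<le> 1" by (rule cutoff_bounds)+
  next
    fix t :: real assume "0 \<le> t"
    then have "in_Hs 1 (W t)" unfolding W_def by (rule picard_in_H1[OF U(1)])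
    then show "in_Hs 0 (W t)" by (rule in_Hs_mono) simp
  next
    fix t :: real assume "0 < t"
    then show "in_Hs 1 (W t)" unfolding W_def by (intro picard_in_H1[OF U(1)]) simp
  next
    fix t0 :: real assume "0 \<le> t0"
    then show "((\<lambda>t. Hs_norm 0 (W t - W t0)) \<longlongrightarrow> 0) (at t0 within {0..})"
      unfolding W_def by (rule picard_H0_cont[OF U(1)])
  next
    fix T :: real assume T: "0 \<le> T"
    obtain B where B: "\<And>t. t \<in> {0..T} \<Longrightarrow> Hs_norm 1 (W t) \<le> B"
      using picard_H1_bounded[OF U(1), of T] unfolding W_def by blast
    have m: "continuous_on {0..T} (\<lambda>t. W t n)" for n
      unfolding W_def by (rule continuous_on_subset[OF picard_modes(2)[OF U(1)]]) auto
    show "(\<lambda>t. (Hs_norm 1 (W t))\<^sup>2) integrable_on {0..T}"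
    proof (rule H1_sq_integrable[OF m])
      show "in_Hs 1 (W t)" if "t \<in> {0<..<T}" for t
        unfolding W_def using that by (intro picard_in_H1[OF U(1)]) auto
      fix k
      have "integral {0..T} (\<lambda>t. sum (Hs_weight 1 (W t)) {- int k..int k}) \<le> integral {0..T} (\<lambda>t. B\<^sup>2)"
      proof (rule integral_le)
        show "(\<lambda>t. sum (Hs_weight 1 (W t)) {- int k..int k}) integrable_on {0..T}"
          unfolding Hs_weight_def by (intro integrable_continuous_real continuous_intros m)
        fix t assume t: "t \<in> {0..T}"
        have "in_Hs 1 (W t)" unfolding W_def using t by (intro picard_in_H1[OF U(1)]) auto
        then show "sum (Hs_weight 1 (W t)) {- int k..int k} \<le> B\<^sup>2"
          by (intro order_trans[OF sum_Hs_weight_le] power_mono B t) auto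
      qed auto
      then show "integral {0..T} (\<lambda>t. sum (Hs_weight 1 (W t)) {- int k..int k}) \<le> integral {0..T} (\<lambda>t. B\<^sup>2)" .
    qed
  next
    fix n and t :: real assume t: "0 < t"
    have "((\<lambda>\<tau>. W \<tau> n) has_vector_derivative symb \<gamma> \<beta> L n * W t n + nonlin \<omega> (cutoff U) U t n) (at t)"
      using picard_modes(1)[OF U(1), of "t + 1"] t unfolding forced_def W_def by auto
    then show "((\<lambda>\<tau>. W \<tau> n) has_vector_derivative symb \<gamma> \<beta> L n * W t n - (1 + \<i> * complex_of_real \<omega>) * complex_of_real (cutoff W t) * cubic (W t) n) (at t)"
      unfolding nl[OF less_imp_le[OF t]] by (simp add: nonlin_def)
  qed
  moreover have "W 0 = u0" by (simp add: W_def picard_0)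
  ultimately show ?thesis by blast
qed

end

section \<open>Existence for data in H\<close>

text \<open>The radius has to be fixed before the cut-off solution exists. This is not circular
  because the bound is uniform in \<open>\<theta>\<close>: energy growth, the H^1 integral and
  persistence of order 1 use only that \<open>\<theta>\<close> lies in [0,1].\<close>

lemma damped_apriori:
  assumes u0: "in_Hs 1 u0"
  obtains R where "continuous_on {0..} R" "\<And>t. 0 \<le> t \<Longrightarrow> 1 \<le> R t"
    "\<And>L \<theta> U t. damped_solution \<gamma> \<omega> \<beta> L \<theta> U \<Longrightarrow> U 0 = u0 \<Longrightarrow> 0 \<le> t \<Longrightarrow> l1 (U t) \<le> R t"
proof -
  define M where "M t = exp (2 * \<bar>Re \<beta>\<bar> * t) * (Hs_norm 0 u0)\<^sup>2" for t
  define I where "I t = (1 + 2 * (\<bar>Re \<beta>\<bar> + 1) * exp (2 * \<bar>Re \<beta>\<bar> * t) * t) * (Hs_norm 0 u0)\<^sup>2" for t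
  \<comment> \<open>For order 1 the auxiliary space in \<open>damped_persistence\<close> is H
    itself, so \<open>M t\<close> serves both as the H bound and as the bound
    \<open>B\<close>.\<close>
  define G where "G t = exp ((2 * \<bar>Re \<beta>\<bar> + 2) * t) * ((Hs_norm 1 u0)\<^sup>2 + reg_const \<omega> 1 * M t * M t * I t)" for t
  define R where "R t = 1 + 4 * sqrt (G t)" for t
  have G0: "0 \<le> G t" if "0 \<le> t" for t
    using that by (auto simp: G_def M_def I_def reg_const_nonneg intro!: mult_nonneg_nonneg add_nonneg_nonneg)
  have "continuous_on {0..} R" unfolding R_def G_def M_def I_def by (intro continuous_intros)
  moreover have "1 \<le> R t" if "0 \<le> t" for t using G0[OF that] by (simp add: R_def)
  moreover have "l1 (U t) \<le> R t" if sol: "damped_solution \<gamma> \<omega> \<beta> L \<theta> U" and U0: "U 0 = u0" and t: "0 \<le> t" for L \<theta> U t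
  proof -
    have i: "in_Hs 1 (U 0)" by (simp add: U0 u0)
    have Mb: "(Hs_norm 0 (U \<tau>))\<^sup>2 \<le> M t" if \<tau>: "\<tau> \<in> {0<..<t}" for \<tau>
    proof -
      have "(Hs_norm 0 (U \<tau>))\<^sup>2 \<le> exp (2 * \<bar>Re \<beta>\<bar> * (\<tau> - 0)) * (Hs_norm 0 (U 0))\<^sup>2"
        using \<tau> by (intro damped_H_bound[OF sol]) auto
      also have "\<dots> \<le> M t" unfolding M_def U0 using \<tau> by (intro mult_right_mono) (auto intro!: mult_left_mono)
      finally show ?thesis .
    qed
    have H0: "in_Hs (max (1 - 1) 0) (U \<tau>)" if "\<tau> \<in> {0<..<t}" for \<tau> using damped_H0[OF sol, of \<tau>] that by simp
    have Mb': "(Hs_norm (max (1 - 1) 0) (U \<tau>))\<^sup>2 \<le> M t" if "\<tau> \<in> {0<..<t}" for \<tau> using Mb[OF that] by simp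
    note p = damped_persistence(2,3)[OF sol order_refl t H0 Mb' Mb i]
    have "(Hs_norm 1 (U t))\<^sup>2 \<le> exp ((2 * \<bar>Re \<beta>\<bar> + 2) * (t - 0)) * ((Hs_norm 1 (U 0))\<^sup>2 + reg_const \<omega> 1 * M t * M t * integral {0..t} (\<lambda>\<tau>. (Hs_norm 1 (U \<tau>))\<^sup>2))"
      using p(2) by simp
    also have "\<dots> \<le> exp ((2 * \<bar>Re \<beta>\<bar> + 2) * (t - 0)) * ((Hs_norm 1 (U 0))\<^sup>2 + reg_const \<omega> 1 * M t * M t * I t)"
    proof (intro mult_left_mono add_left_mono)
      show "integral {0..t} (\<lambda>\<tau>. (Hs_norm 1 (U \<tau>))\<^sup>2) \<le> I t"
        using damped_H1_integral[OF sol order_refl t] by (simp add: I_def U0)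
    qed (auto simp: reg_const_nonneg M_def)
    also have "\<dots> = G t" by (simp add: G_def U0)
    finally have "Hs_norm 1 (U t) \<le> sqrt (G t)" by (rule real_le_rsqrt)
    moreover have "l1 (U t) \<le> 4 * Hs_norm 1 (U t)" by (rule l1_le_Hs1[OF p(1)])
    ultimately show ?thesis by (simp add: R_def)
  qed
  ultimately show ?thesis using that by blast
qed

lemma H1_solution_exists:
  assumes u0: "in_Hs 1 u0"
  shows "\<exists>U. is_solution \<gamma> \<omega> \<beta> L U \<and> U 0 = u0"
proof -
  obtain R where R: "continuous_on {0..} R" "\<And>t. 0 \<le> t \<Longrightarrow> 1 \<le> R t"
    "\<And>L \<theta> U t. damped_solution \<gamma> \<omega> \<beta> L \<theta> U \<Longrightarrow> U 0 = u0 \<Longrightarrow> 0 \<le> t \<Longrightarrow> l1 (U t) \<le> R t"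
    using damped_apriori[OF u0, of \<gamma> \<omega> \<beta>] by metis
  obtain U where U: "damped_solution \<gamma> \<omega> \<beta> L (cutoff R U) U" "U 0 = u0"
    using cutoff_solution_exists[OF u0 R(1,2), of \<gamma> \<omega> \<beta> L] by auto
  have "cutoff R U t = 1" if "0 \<le> t" for t
  proof -
    have "0 < R t" using R(2)[OF that] by linarith
    moreover have "l1 (U t) \<le> R t" by (rule R(3)[OF U that])
    ultimately have "cut (R t) (U t) = 1" by (rule cut_eq_1)
    then show ?thesis by (simp add: cutoff_def[OF u0 R(1,2)])
  qed
  then have "is_solution \<gamma> \<omega> \<beta> L U" using U(1) unfolding is_solution_def damped_solution_def by simp
  then show ?thesis using U(2) by blast
qed

section \<open>Fourier truncations and passage to the limit\<close>

definition trunc :: "nat \<Rightarrow> (int \<Rightarrow> complex) \<Rightarrow> int \<Rightarrow> complex" where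
  "trunc k v n = (if \<bar>n\<bar> \<le> int k then v n else 0)"

lemma trunc_in_Hs: "in_Hs s (trunc k v)"
proof -
  have "finite {n. Hs_weight s (trunc k v) n \<noteq> 0}"
    by (rule finite_subset[of _ "{- int k..int k}"]) (auto simp: Hs_weight_def trunc_def)
  then show ?thesis unfolding in_Hs_def by (intro finite_nonzero_values_imp_summable_on) simp
qed

lemma trunc_Hs:
  assumes "in_Hs s v"
  shows trunc_norm_le: "Hs_norm s (trunc k v) \<le> Hs_norm s v"
    and trunc_diff_mono: "k \<le> m \<Longrightarrow> Hs_norm s (trunc m v - v) \<le> Hs_norm s (trunc k v - v)"
    and trunc_tendsto: "(\<lambda>k. Hs_norm s (trunc k v - v)) \<longlonglongrightarrow> 0"
proof -
  have dom: "Hs_norm s f \<le> Hs_norm s g" if g: "in_Hs s g" and le: "\<And>n. cmod (f n) \<le> cmod (g n)" for f g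
  proof (rule in_HsI(2))
    fix A :: "int set" assume A: "finite A"
    have "sum (Hs_weight s f) A \<le> sum (Hs_weight s g) A"
      unfolding Hs_weight_kap by (intro sum_mono mult_left_mono power_mono le) auto
    also have "\<dots> \<le> (Hs_norm s g)\<^sup>2" by (rule sum_Hs_weight_le[OF g A])
    finally show "sum (Hs_weight s f) A \<le> (Hs_norm s g)\<^sup>2" .
  qed simp
  show "Hs_norm s (trunc k v) \<le> Hs_norm s v" by (rule dom[OF assms]) (simp add: trunc_def)
  show "Hs_norm s (trunc m v - v) \<le> Hs_norm s (trunc k v - v)" if "k \<le> m"
    by (rule dom[OF Hs_diff(1)[OF trunc_in_Hs assms]]) (use that in \<open>auto simp: trunc_def\<close>)
  show "(\<lambda>k. Hs_norm s (trunc k v - v)) \<longlonglongrightarrow> 0"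
  proof (rule Hs_tendsto_0I)
    fix n
    have "\<forall>\<^sub>F k in sequentially. trunc k v n = v n"
      unfolding eventually_sequentially by (intro exI[of _ "nat \<bar>n\<bar>"]) (auto simp: trunc_def)
    then show "(\<lambda>k. trunc k v n) \<longlonglongrightarrow> v n" by (rule tendsto_eventually)
  next
    fix e :: real assume e: "0 < e"
    have "(\<lambda>k. sum (Hs_weight s v) {- int k..int k}) \<longlonglongrightarrow> (Hs_norm s v)\<^sup>2"
      using sum_symmetric_tendsto_infsum[of "Hs_weight s v"] assms by (simp add: in_Hs_def Hs_norm_sq)
    then have "\<forall>\<^sub>F k in sequentially. (Hs_norm s v)\<^sup>2 - e < sum (Hs_weight s v) {- int k..int k}"
      using e by (intro order_tendstoD) auto
    then obtain j where j: "(Hs_norm s v)\<^sup>2 - e < sum (Hs_weight s v) {- int j..int j}"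
      using eventually_happens'[OF sequentially_bot] by blast
    have "sum (Hs_weight s (trunc k v - v)) A \<le> e" if A: "finite A" "A \<inter> {- int j..int j} = {}" for k A
    proof -
      have "sum (Hs_weight s (trunc k v - v)) A \<le> sum (Hs_weight s v) A"
        unfolding Hs_weight_kap by (intro sum_mono mult_left_mono power_mono) (auto simp: trunc_def)
      moreover have "sum (Hs_weight s v) A + sum (Hs_weight s v) {- int j..int j} = sum (Hs_weight s v) (A \<union> {- int j..int j})"
        using A by (simp add: sum.union_disjoint)
      moreover have "\<dots> \<le> (Hs_norm s v)\<^sup>2" using A by (intro sum_Hs_weight_le assms) simp
      ultimately show ?thesis using j by linarith
    qed
    then show "\<exists>A0. finite A0 \<and> (\<forall>\<^sub>F k in sequentially. \<forall>A. finite A \<and> A \<inter> A0 = {} \<longrightarrow> sum (Hs_weight s (trunc k v - v)) A \<le> e)"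
      by (intro exI[of _ "{- int j..int j}"] conjI always_eventually) auto
  qed
qed

text \<open>The solutions with truncated data are Cauchy in H, uniformly on bounded time intervals,
  by the Lipschitz estimate. Smoothing bounds them in H^1 at positive times independently of
  \<open>k\<close>, so Agmon gives l1 convergence there and the cubic term passes to the limit. The
  integral of the squared H^1 norm is bounded by the energy estimate on finite sets of modes,
  uniformly in the set.\<close>

lemma solution_exists:
  assumes u0: "in_Hs 0 u0"
  shows "\<exists>U. is_solution \<gamma> \<omega> \<beta> L U \<and> U 0 = u0"
proof -
  define r where "r = Hs_norm 0 u0"
  define \<epsilon> where "\<epsilon> k = Hs_norm 0 (trunc k u0 - u0)" for k
  have \<epsilon>0: "0 \<le> \<epsilon> k" and \<epsilon>m: "k \<le> m \<Longrightarrow> \<epsilon> m \<le> \<epsilon> k" for k m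
    using trunc_diff_mono[OF u0] by (auto simp: \<epsilon>_def)
  have \<epsilon>lim: "\<epsilon> \<longlonglongrightarrow> 0" unfolding \<epsilon>_def by (rule trunc_tendsto[OF u0])
  have "\<forall>k. \<exists>U. is_solution \<gamma> \<omega> \<beta> L U \<and> U 0 = trunc k u0"
    by (intro allI H1_solution_exists trunc_in_Hs)
  then obtain W where W: "\<And>k. is_solution \<gamma> \<omega> \<beta> L (W k)" "\<And>k. W k 0 = trunc k u0" by metis
  note W' = W(1)[unfolded is_solution_damped]
  have Wr: "Hs_norm 0 (W k 0) \<le> r" for k by (simp add: W(2) r_def trunc_norm_le[OF u0])
  have Wr2: "(Hs_norm 0 (W k 0))\<^sup>2 \<le> r\<^sup>2" for k using Wr by (intro power_mono) auto
  \<comment> \<open>The absolute value makes exp(q t) increasing in t, so that its value at the end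
    of an interval bounds it throughout.\<close>
  define q where "q = \<bar>lip_rate \<omega> \<beta> (r\<^sup>2 + absorb \<beta>) / 2\<bar>"
  have q0: "0 \<le> q" by (simp add: q_def)
  have W0: "in_Hs 0 (W k t)" if "0 \<le> t" for k t by (rule damped_H0[OF W' that])
  have cauchy: "Hs_norm 0 (W m t - W k t) \<le> exp (q * t) * (2 * \<epsilon> k)" if t: "0 \<le> t" and km: "k \<le> m" for k m t
  proof -
    have "Hs_norm 0 (W m t - W k t) \<le> exp (lip_rate \<omega> \<beta> (r\<^sup>2 + absorb \<beta>) / 2 * t) * Hs_norm 0 (W m 0 - W k 0)"
      by (rule solution_lipschitz_uniform[OF W(1) W(1) t Wr2 Wr2])
    also have "\<dots> \<le> exp (q * t) * (2 * \<epsilon> k)"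
    proof (intro mult_mono)
      show "exp (lip_rate \<omega> \<beta> (r\<^sup>2 + absorb \<beta>) / 2 * t) \<le> exp (q * t)"
        unfolding exp_le_cancel_iff q_def using t by (intro mult_right_mono) auto
      have "Hs_norm 0 (W m 0 - W k 0) \<le> Hs_norm 0 (trunc m u0 - u0) + Hs_norm 0 (u0 - trunc k u0)"
        unfolding W(2) by (intro Hs_norm_diff_triangle Hs_diff trunc_in_Hs u0)
      also have "\<dots> = \<epsilon> m + \<epsilon> k" by (simp add: \<epsilon>_def Hs_norm_diff_commute[of 0 u0])
      finally show "Hs_norm 0 (W m 0 - W k 0) \<le> 2 * \<epsilon> k" using \<epsilon>m[OF km] by simp
    qed auto
    finally show ?thesis .
  qed
  define U where "U t n = lim (\<lambda>k. W k t n)" for t n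
  have scale0: "(\<lambda>k. C * (2 * \<epsilon> k)) \<longlonglongrightarrow> 0" for C
    by (intro tendsto_mult_right_zero \<epsilon>lim)
  have lim: "(\<lambda>k. W k t n) \<longlonglongrightarrow> U t n" if t: "0 \<le> t" for t n
  proof -
    have "Cauchy (\<lambda>k. W k t n)"
    proof (rule CauchyI')
      fix e :: real assume e: "0 < e"
      have "\<forall>\<^sub>F k in sequentially. exp (q * t) * (2 * \<epsilon> k) < e" by (rule order_tendstoD(2)[OF scale0 e])
      then obtain M where M: "\<And>k. M \<le> k \<Longrightarrow> exp (q * t) * (2 * \<epsilon> k) < e" unfolding eventually_sequentially by blast
      have "dist (W m t n) (W k t n) < e" if "M \<le> m" "m < k" for m k
      proof -
        have "dist (W m t n) (W k t n) = cmod ((W k t - W m t) n)" by (simp add: dist_norm norm_minus_commute)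
        also have "\<dots> \<le> Hs_norm 0 (W k t - W m t)"
          by (rule cmod_le_Hs_norm[OF Hs_diff(1)[OF W0 W0]]) (use t in auto)
        also have "\<dots> \<le> exp (q * t) * (2 * \<epsilon> m)" using that by (intro cauchy t) simp
        also have "\<dots> < e" using M that by blast
        finally show ?thesis .
      qed
      then show "\<exists>M. \<forall>m\<ge>M. \<forall>k>m. dist (W m t n) (W k t n) < e" by blast
    qed
    then show ?thesis unfolding U_def by (simp add: Cauchy_convergent_iff convergent_LIMSEQ_iff)
  qed
  have close: "in_Hs 0 (U t - W k t)" "Hs_norm 0 (U t - W k t) \<le> exp (q * t) * (2 * \<epsilon> k)" if t: "0 \<le> t" for t k
  proof -
    have l: "(\<lambda>m. (W m t - W k t) n) \<longlonglongrightarrow> (U t - W k t) n" for n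
      using tendsto_diff[OF lim[OF t, of n] tendsto_const[of "W k t n"]] by simp
    have ev: "\<forall>\<^sub>F m in sequentially. in_Hs 0 (W m t - W k t) \<and> Hs_norm 0 (W m t - W k t) \<le> exp (q * t) * (2 * \<epsilon> k)"
      unfolding eventually_sequentially using cauchy[OF t] Hs_diff(1)[OF W0[OF t] W0[OF t]] by blast
    have nn: "0 \<le> exp (q * t) * (2 * \<epsilon> k)" using \<epsilon>0 by simp
    show "in_Hs 0 (U t - W k t)" "Hs_norm 0 (U t - W k t) \<le> exp (q * t) * (2 * \<epsilon> k)"
      by (rule Hs_norm_limit_le[where w = "U t - W k t", OF l nn ev])+
  qed
  have U0: "in_Hs 0 (U t)" if t: "0 \<le> t" for t
  proof (rule Hs_dominated(1)[OF close(1)[OF t] W0[OF t]])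
    fix n show "cmod (U t n) \<le> cmod ((U t - W 0 t) n) + cmod (W 0 t n)"
      using norm_triangle_ineq[of "U t n - W 0 t n" "W 0 t n"] by simp
  qed
  have Uinit: "U 0 = u0"
  proof
    fix n
    have "\<forall>\<^sub>F k in sequentially. W k 0 n = u0 n"
      unfolding eventually_sequentially W(2) by (intro exI[of _ "nat \<bar>n\<bar>"]) (auto simp: trunc_def)
    then have "(\<lambda>k. W k 0 n) \<longlonglongrightarrow> u0 n" by (rule tendsto_eventually)
    then show "U 0 n = u0 n" using lim[OF order_refl, of n] LIMSEQ_unique by blast
  qed
  have Ucont: "((\<lambda>t. Hs_norm 0 (U t - U t0)) \<longlongrightarrow> 0) (at t0 within {0..})" if t0: "0 \<le> t0" for t0
  proof (rule order_tendstoI)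
    fix e :: real assume e: "0 < e"
    define C where "C = exp (q * (t0 + 1))"
    have "\<forall>\<^sub>F k in sequentially. C * (2 * \<epsilon> k) < e / 3" using e by (intro order_tendstoD(2)[OF scale0]) simp
    then obtain k where k: "C * (2 * \<epsilon> k) < e / 3" using eventually_happens'[OF sequentially_bot] by blast
    have cl: "Hs_norm 0 (U t - W k t) < e / 3" if "0 \<le> t" "t \<le> t0 + 1" for t
    proof -
      have "exp (q * t) * (2 * \<epsilon> k) \<le> C * (2 * \<epsilon> k)"
        unfolding C_def using that q0 \<epsilon>0 by (intro mult_right_mono) (auto intro!: mult_left_mono)
      then show ?thesis using close(2)[OF that(1), of k] k by linarith
    qed
    have "\<forall>\<^sub>F t in at t0 within {0..}. t < t0 + 1" using order_tendstoD(2)[OF tendsto_ident_at, of t0 "t0 + 1" "{0..}"] by simp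
    moreover have "\<forall>\<^sub>F t in at t0 within {0..}. 0 \<le> t" by (simp add: eventually_at_filter)
    moreover have "\<forall>\<^sub>F t in at t0 within {0..}. Hs_norm 0 (W k t - W k t0) < e / 3"
      using e by (intro order_tendstoD(2)[OF damped_cont0[OF W' t0]]) simp
    ultimately show "\<forall>\<^sub>F t in at t0 within {0..}. Hs_norm 0 (U t - U t0) < e"
    proof eventually_elim
      case (elim t)
      have "Hs_norm 0 (U t - U t0) \<le> Hs_norm 0 (U t - W k t) + Hs_norm 0 (W k t - U t0)"
        by (intro Hs_norm_diff_triangle Hs_diff U0 W0 t0 elim)
      moreover have "Hs_norm 0 (W k t - U t0) \<le> Hs_norm 0 (W k t - W k t0) + Hs_norm 0 (W k t0 - U t0)"
        by (intro Hs_norm_diff_triangle Hs_diff U0 W0 t0 elim)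
      moreover have "Hs_norm 0 (W k t0 - U t0) < e / 3"
        using cl[of t0] t0 by (simp add: Hs_norm_diff_commute[of 0 "W k t0"])
      moreover have "Hs_norm 0 (U t - W k t) < e / 3" using elim by (intro cl) auto
      ultimately show ?case using elim by linarith
    qed
  next
    fix e :: real assume "e < 0"
    then show "\<forall>\<^sub>F t in at t0 within {0..}. e < Hs_norm 0 (U t - U t0)"
      by (intro always_eventually allI) (rule less_le_trans[OF _ Hs_norm_nonneg])
  qed
  obtain B where B: "0 \<le> B" "\<And>L U a t. is_solution \<gamma> \<omega> \<beta> L U \<Longrightarrow> 0 \<le> a \<Longrightarrow> a < t \<Longrightarrow> Hs_norm 0 (U a) \<le> r \<Longrightarrow>
     in_Hs (real 1) (U t) \<and> (Hs_norm (real 1) (U t))\<^sup>2 \<le> B * (1 + (1 / (t - a)) ^ 1)"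
    using solution_smoothing[of \<gamma> \<omega> \<beta> r 1] by blast
  define D where "D t = sqrt (B * (1 + 1 / t))" for t
  have D0: "0 \<le> D t" if "0 < t" for t using that B(1) by (simp add: D_def)
  have WD: "in_Hs 1 (W k t)" "Hs_norm 1 (W k t) \<le> D t" if "0 < t" for k t
    using B(2)[OF W(1), of 0 t k] Wr that by (auto simp: D_def intro: real_le_rsqrt)
  have UD: "in_Hs 1 (U t)" "Hs_norm 1 (U t) \<le> D t" if t: "0 < t" for t
    using Hs_norm_limit_le[where w = "U t", OF lim[OF less_imp_le[OF t]] D0[OF t], of 1] WD[OF t] by auto
  have deriv: "((\<lambda>\<tau>. U \<tau> n) has_vector_derivative
         (symb \<gamma> \<beta> L n * U t n - (1 + \<i> * complex_of_real \<omega>) * cubic (U t) n)) (at t)" if t: "0 < t" for t n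
  proof -
    define c where "c = 1 + \<i> * complex_of_real \<omega>"
    \<comment> \<open>A neighbourhood of t away from 0, where the smoothing bound \<open>D\<close>
      blows up, and bounded above, where exp(q x) grows.\<close>
    define S where "S = {t / 2<..<2 * t}"
    have tS: "t \<in> S" using t by (simp add: S_def)
    define d where "d = D (t / 2)"
    define E where "E = exp (q * (2 * t))"
    have d0: "0 \<le> d" using D0[of "t / 2"] t by (simp add: d_def)
    have Sp: "0 < x" and SD: "D x \<le> d" and SE: "exp (q * x) \<le> E" if "x \<in> S" for x
    proof -
      show x: "0 < x" using that t by (auto simp: S_def)
      have "1 / x \<le> 1 / (t / 2)" using that t by (intro divide_left_mono) (auto simp: S_def)
      then show "D x \<le> d" unfolding D_def d_def using B(1) by (intro real_sqrt_le_mono mult_left_mono) auto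
      show "exp (q * x) \<le> E" unfolding E_def using that q0 by (auto simp: S_def intro!: mult_left_mono)
    qed
    define f' where "f' k x = symb \<gamma> \<beta> L n * W k x n - c * cubic (W k x) n" for k x
    define g' where "g' x = symb \<gamma> \<beta> L n * U x n - c * cubic (U x) n" for x
    \<comment> \<open>Uniform distance of the right-hand sides on \<open>S\<close>. The first
      summand is the linear part. In the second, 3 (4 d)^2 is the Lipschitz constant of
      \<open>cubic\<close> on the l1 ball of radius 4 d, and the root is Agmon's bound with an H
      norm tending to 0 and an H^1 norm at most d + d.\<close>
    define \<eta> where "\<eta> k = cmod (symb \<gamma> \<beta> L n) * (E * (2 * \<epsilon> k)) + cmod c * (3 * (4 * d)\<^sup>2 * sqrt (16 * (E * (2 * \<epsilon> k)) * (d + d)))" for k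
    have \<eta>lim: "\<eta> \<longlonglongrightarrow> 0"
    proof -
      have "(\<lambda>k. cmod (symb \<gamma> \<beta> L n) * (E * (2 * \<epsilon> k)) + cmod c * (3 * (4 * d)\<^sup>2 * sqrt (16 * (E * (2 * \<epsilon> k)) * (d + d))))
        \<longlonglongrightarrow> cmod (symb \<gamma> \<beta> L n) * (E * (2 * 0)) + cmod c * (3 * (4 * d)\<^sup>2 * sqrt (16 * (E * (2 * 0)) * (d + d)))"
        by (intro tendsto_intros \<epsilon>lim)
      then show ?thesis by (simp add: \<eta>_def[abs_def])
    qed
    have fg: "cmod (f' k x - g' x) \<le> \<eta> k" if x: "x \<in> S" for k x
    proof -
      note xp = Sp[OF x]
      have i: "in_l1 (W k x)" "in_l1 (U x)" using in_Hs1_imp_l1 WD(1)[OF xp] UD(1)[OF xp] by auto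
      have b: "l1 (W k x) \<le> 4 * d" "l1 (U x) \<le> 4 * d"
        using l1_le_Hs1[OF WD(1)[OF xp, of k]] l1_le_Hs1[OF UD(1)[OF xp]] WD(2)[OF xp, of k] UD(2)[OF xp] SD[OF x] by linarith+
      have c0: "Hs_norm 0 (W k x - U x) \<le> E * (2 * \<epsilon> k)"
      proof -
        have "Hs_norm 0 (W k x - U x) \<le> exp (q * x) * (2 * \<epsilon> k)"
          using close(2)[OF less_imp_le[OF xp], of k] by (simp add: Hs_norm_diff_commute[of 0 "W k x"])
        also have "\<dots> \<le> E * (2 * \<epsilon> k)" using \<epsilon>0 by (intro mult_right_mono SE x) simp
        finally show ?thesis .
      qed
      have i1: "in_Hs 1 (W k x - U x)" "Hs_norm 1 (W k x - U x) \<le> d + d"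
        using Hs_diff[OF WD(1)[OF xp, of k] UD(1)[OF xp]] WD(2)[OF xp, of k] UD(2)[OF xp] SD[OF x] by auto
      have "(l1 (W k x - U x))\<^sup>2 \<le> 16 * Hs_norm 0 (W k x - U x) * Hs_norm 1 (W k x - U x)"
        by (rule l1_sq_le[OF i1(1)])
      also have "\<dots> \<le> 16 * (E * (2 * \<epsilon> k)) * (d + d)"
        using c0 i1(2) d0 \<epsilon>0[of k] by (intro mult_mono mult_left_mono) (auto simp: E_def)
      finally have l: "l1 (W k x - U x) \<le> sqrt (16 * (E * (2 * \<epsilon> k)) * (d + d))" by (rule real_le_rsqrt)
      note cd = cubic_diff_l1[OF i b]
      have "cmod (cubic (W k x) n - cubic (U x) n) \<le> l1 (cubic (W k x) - cubic (U x))"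
        using cmod_le_l1[OF cd(1), of n] by simp
      also have "\<dots> \<le> 3 * (4 * d)\<^sup>2 * l1 (W k x - U x)" by (rule cd(2))
      also have "\<dots> \<le> 3 * (4 * d)\<^sup>2 * sqrt (16 * (E * (2 * \<epsilon> k)) * (d + d))" by (intro mult_left_mono l) auto
      finally have n3: "cmod (cubic (W k x) n - cubic (U x) n) \<le> 3 * (4 * d)\<^sup>2 * sqrt (16 * (E * (2 * \<epsilon> k)) * (d + d))" .
      have n1: "cmod (W k x n - U x n) \<le> E * (2 * \<epsilon> k)"
        using cmod_le_Hs_norm[OF Hs_diff(1)[OF W0 U0], of x x k n] c0 xp by simp
      have "f' k x - g' x = symb \<gamma> \<beta> L n * (W k x n - U x n) - c * (cubic (W k x) n - cubic (U x) n)"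
        by (simp add: f'_def g'_def algebra_simps)
      then have "cmod (f' k x - g' x) \<le> cmod (symb \<gamma> \<beta> L n) * cmod (W k x n - U x n) + cmod c * cmod (cubic (W k x) n - cubic (U x) n)"
        by (metis norm_mult norm_triangle_ineq4)
      also have "\<dots> \<le> \<eta> k" unfolding \<eta>_def by (intro add_mono mult_left_mono n1 n3) auto
      finally show ?thesis .
    qed
    \<comment> \<open>Pointwise convergence with uniformly convergent derivatives: the limit is
      differentiable with the limit derivative.\<close>
    have "\<exists>g. \<forall>x\<in>S. (\<lambda>k. W k x n) \<longlonglongrightarrow> g x \<and> (g has_derivative (\<lambda>h. h *\<^sub>R g' x)) (at x within S)"
    proof (rule has_derivative_sequence[where f' = "\<lambda>k x h. h *\<^sub>R f' k x" and ?x0.0 = t and l = "U t n"])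
      show "convex S" by (simp add: S_def)
      show "t \<in> S" by (rule tS)
      show "(\<lambda>k. W k t n) \<longlonglongrightarrow> U t n" using t by (intro lim) simp
      show "((\<lambda>x. W k x n) has_derivative (\<lambda>h. h *\<^sub>R f' k x)) (at x within S)" if x: "x \<in> S" for k x
      proof -
        have "((\<lambda>x. W k x n) has_vector_derivative f' k x) (at x)"
          using W(1)[of k] Sp[OF x] by (simp add: is_solution_def f'_def c_def)
        then show ?thesis unfolding has_vector_derivative_def by (rule has_derivative_at_withinI)
      qed
      fix e :: real assume "0 < e"
      then have "\<forall>\<^sub>F k in sequentially. \<eta> k < e" by (rule order_tendstoD(2)[OF \<eta>lim])
      then show "\<forall>\<^sub>F k in sequentially. \<forall>x\<in>S. \<forall>h. norm (h *\<^sub>R f' k x - h *\<^sub>R g' x) \<le> e * norm h"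
      proof eventually_elim
        case (elim k)
        show ?case
        proof (intro ballI allI)
          fix x h assume x: "x \<in> S"
          have "norm (h *\<^sub>R f' k x - h *\<^sub>R g' x) = \<bar>h\<bar> * cmod (f' k x - g' x)"
            by (simp flip: scaleR_right_diff_distrib)
          also have "\<dots> \<le> \<bar>h\<bar> * e" using fg[OF x, of k] elim by (intro mult_left_mono) auto
          finally show "norm (h *\<^sub>R f' k x - h *\<^sub>R g' x) \<le> e * norm h" by (simp add: mult.commute)
        qed
      qed
    qed
    then obtain g where g: "\<And>x. x \<in> S \<Longrightarrow> (\<lambda>k. W k x n) \<longlonglongrightarrow> g x" "\<And>x. x \<in> S \<Longrightarrow> (g has_derivative (\<lambda>h. h *\<^sub>R g' x)) (at x within S)"
      by blast
    have gU: "g x = U x n" if "x \<in> S" for x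
      using LIMSEQ_unique[OF g(1)[OF that] lim[OF less_imp_le[OF Sp[OF that]]]] .
    have "(g has_vector_derivative g' t) (at t)"
      using g(2)[OF tS] at_within_open[OF tS] by (simp add: has_vector_derivative_def S_def)
    then have "((\<lambda>x. U x n) has_vector_derivative g' t) (at t)"
      by (rule has_vector_derivative_transform_within_open[where S = S]) (use tS gU in \<open>auto simp: S_def\<close>)
    then show ?thesis by (simp add: g'_def c_def)
  qed
  have Um: "continuous_on {0..} (\<lambda>t. U t n)" for n by (rule H_cont_mode(1)[OF U0 Ucont])
  have int: "(\<lambda>t. (Hs_norm 1 (U t))\<^sup>2) integrable_on {0..T}" if T: "0 \<le> T" for T
  proof (rule H1_sq_integrable)
    define I where "I = (1 + 2 * (\<bar>Re \<beta>\<bar> + 1) * exp (2 * \<bar>Re \<beta>\<bar> * (T - 0)) * (T - 0)) * r\<^sup>2"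
    show "continuous_on {0..T} (\<lambda>t. U t n)" for n by (rule continuous_on_subset[OF Um]) auto
    show "in_Hs 1 (U t)" if "t \<in> {0<..<T}" for t using that by (intro UD) auto
    fix j
    define A where "A = {- int j..int j}"
    have A: "finite A" by (simp add: A_def)
    define f where "f k t = sum (Hs_weight 1 (W k t)) A" for k t
    have fi: "f k integrable_on {0..T}" for k
      unfolding f_def Hs_weight_def
      by (intro integrable_continuous_real continuous_intros continuous_on_subset[OF damped_cont_mode[OF W']]) auto
    have fI: "integral {0..T} (f k) \<le> I" for k
    proof -
      have "integral {0..T} (f k) \<le> integral {0..T} (\<lambda>t. (Hs_norm 1 (W k t))\<^sup>2)"
      proof (rule integral_le[OF fi damped_integrable[OF W' order_refl]])
        fix t assume "t \<in> {0..T}"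
        \<comment> \<open>At t = 0 smoothing says nothing, but the truncated initial value lies in
          every H^s.\<close>
        then have "in_Hs 1 (W k t)" using WD(1)[of t k] trunc_in_Hs[of 1 k u0] W(2)[of k] by (cases "t = 0") auto
        then show "f k t \<le> (Hs_norm 1 (W k t))\<^sup>2" unfolding f_def by (rule sum_Hs_weight_le[OF _ A])
      qed
      also have "\<dots> \<le> (1 + 2 * (\<bar>Re \<beta>\<bar> + 1) * exp (2 * \<bar>Re \<beta>\<bar> * (T - 0)) * (T - 0)) * (Hs_norm 0 (W k 0))\<^sup>2"
        by (rule damped_H1_integral[OF W' order_refl T])
      also have "\<dots> \<le> I" unfolding I_def using T by (intro mult_left_mono Wr2) (auto intro!: add_nonneg_nonneg mult_nonneg_nonneg)
      finally show ?thesis .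
    qed
    define h where "h = (\<Sum>n\<in>A. kap n * (r\<^sup>2 + absorb \<beta>))"
    have "(\<lambda>k. integral {0..T} (f k)) \<longlonglongrightarrow> integral {0..T} (\<lambda>t. sum (Hs_weight 1 (U t)) A)"
    proof (rule dominated_convergence(2)[OF fi, where h = "\<lambda>_. h"])
      fix k t assume t: "t \<in> {0..T}"
      have b1: "(Hs_norm 0 (W k t))\<^sup>2 \<le> r\<^sup>2 + absorb \<beta>"
        using solution_H_bound[OF W(1), of 0 t k] t Wr2[of k] by auto
      have b2: "(cmod (W k t n))\<^sup>2 \<le> (Hs_norm 0 (W k t))\<^sup>2" for n
        using Hs_weight_le[OF W0, of t k n] t by simp
      have "f k t \<le> h" unfolding f_def h_def Hs_weight_1
        by (intro sum_mono mult_left_mono order_trans[OF b2 b1]) simp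
      moreover have "0 \<le> f k t" by (simp add: f_def sum_nonneg)
      ultimately show "norm (f k t) \<le> h" by simp
    next
      fix t assume t: "t \<in> {0..T}"
      then show "(\<lambda>k. f k t) \<longlonglongrightarrow> sum (Hs_weight 1 (U t)) A"
        unfolding f_def Hs_weight_def by (intro tendsto_intros lim) auto
    qed auto
    then show "integral {0..T} (\<lambda>t. sum (Hs_weight 1 (U t)) {- int j..int j}) \<le> I"
      unfolding A_def[symmetric] by (rule LIMSEQ_le_const2) (use fI in blast)
  qed
  have "is_solution \<gamma> \<omega> \<beta> L U"
    unfolding is_solution_def using U0 Ucont UD(1) int deriv by blast
  then show ?thesis using Uinit by blast
qed

theorem theorem3p1:
  fixes \<gamma> \<omega> :: real and \<beta> :: complex
  shows
  \<comment> \<open>well-posedness in H^s: existence, continuity in H^s, uniqueness, continuous dependence\<close>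
  "(\<forall>L s u0. s \<ge> 0 \<and> in_Hs s u0 \<longrightarrow>
      (\<exists>U. is_solution \<gamma> \<omega> \<beta> L U \<and> U 0 = u0 \<and> (\<forall>t\<ge>0. in_Hs s (U t)) \<and>
           (\<forall>t0\<ge>0. ((\<lambda>t. Hs_norm s (U t - U t0)) \<longlongrightarrow> 0) (at t0 within {0..})))) \<and>
   (\<forall>L U V. is_solution \<gamma> \<omega> \<beta> L U \<and> is_solution \<gamma> \<omega> \<beta> L V \<and> U 0 = V 0 \<longrightarrow>
      (\<forall>t\<ge>0. U t = V t)) \<and>
   (\<forall>L s U W. s \<ge> 0 \<and> is_solution \<gamma> \<omega> \<beta> L U \<and> in_Hs s (U 0) \<and>
      (\<forall>k. is_solution \<gamma> \<omega> \<beta> L (W k) \<and> in_Hs s (W k 0)) \<and>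
      (\<lambda>k. Hs_norm s (W k 0 - U 0)) \<longlonglongrightarrow> 0 \<longrightarrow>
      (\<forall>t\<ge>0. (\<lambda>k. Hs_norm s (W k t - U t)) \<longlonglongrightarrow> 0)) \<and>
   \<comment> \<open>dissipative estimate, for each L and uniformly in L as L tends to infinity\<close>
   (\<forall>s\<ge>0. \<forall>L. \<exists>Q \<kappa> C. mono Q \<and> \<kappa> > 0 \<and> C > 0 \<and> dissipative_est \<gamma> \<omega> \<beta> L s Q \<kappa> C) \<and>
   (\<forall>s\<ge>0. \<exists>L0 Q \<kappa> C. mono Q \<and> \<kappa> > 0 \<and> C > 0 \<and>
      (\<forall>L\<ge>L0. dissipative_est \<gamma> \<omega> \<beta> L s Q \<kappa> C)) \<and>
   \<comment> \<open>smoothing, for each L and uniformly in L as L tends to infinity\<close>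
   (\<forall>s\<ge>0. \<forall>L. \<exists>Q N. mono Q \<and> smoothing_est \<gamma> \<omega> \<beta> L s Q N) \<and>
   (\<forall>s\<ge>0. \<exists>L0 Q N. mono Q \<and> (\<forall>L\<ge>L0. smoothing_est \<gamma> \<omega> \<beta> L s Q N)) \<and>
   \<comment> \<open>Lipschitz dependence in H, K depending only on the H-norms of the initial data\<close>
   (\<exists>K. \<forall>L U V t. is_solution \<gamma> \<omega> \<beta> L U \<and> is_solution \<gamma> \<omega> \<beta> L V \<and> t \<ge> 0 \<longrightarrow>
      Hs_norm 0 (U t - V t) \<le> exp (K (Hs_norm 0 (U 0)) (Hs_norm 0 (V 0)) * t) * Hs_norm 0 (U 0 - V 0))"
proof (intro conjI)
  show "\<forall>L s u0. s \<ge> 0 \<and> in_Hs s u0 \<longrightarrow>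
      (\<exists>U. is_solution \<gamma> \<omega> \<beta> L U \<and> U 0 = u0 \<and> (\<forall>t\<ge>0. in_Hs s (U t)) \<and>
           (\<forall>t0\<ge>0. ((\<lambda>t. Hs_norm s (U t - U t0)) \<longlongrightarrow> 0) (at t0 within {0..})))"
  proof (intro allI impI, elim conjE)
    fix L s u0 assume s: "0 \<le> s" and u0: "in_Hs s u0"
    obtain U where U: "is_solution \<gamma> \<omega> \<beta> L U" "U 0 = u0"
      using solution_exists[OF in_Hs_mono(1)[OF u0 s], of \<gamma> \<omega> \<beta> L] by blast
    have "in_Hs s (U t)" if "0 \<le> t" for t
      using solution_in_Hs[OF U(1) _ s, of t] u0 U(2) that by (cases "t = 0") auto
    moreover have "((\<lambda>t. Hs_norm s (U t - U t0)) \<longlongrightarrow> 0) (at t0 within {0..})" if "0 \<le> t0" for t0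
      by (rule solution_Hs_continuous[OF U(1) s _ that]) (simp add: U(2) u0)
    ultimately show "\<exists>U. is_solution \<gamma> \<omega> \<beta> L U \<and> U 0 = u0 \<and> (\<forall>t\<ge>0. in_Hs s (U t)) \<and>
           (\<forall>t0\<ge>0. ((\<lambda>t. Hs_norm s (U t - U t0)) \<longlongrightarrow> 0) (at t0 within {0..}))"
      using U by blast
  qed
  show "\<forall>L U V. is_solution \<gamma> \<omega> \<beta> L U \<and> is_solution \<gamma> \<omega> \<beta> L V \<and> U 0 = V 0 \<longrightarrow> (\<forall>t\<ge>0. U t = V t)"
    using solution_unique by blast
  show "\<forall>L s U W. s \<ge> 0 \<and> is_solution \<gamma> \<omega> \<beta> L U \<and> in_Hs s (U 0) \<and>
      (\<forall>k. is_solution \<gamma> \<omega> \<beta> L (W k) \<and> in_Hs s (W k 0)) \<and>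
      (\<lambda>k. Hs_norm s (W k 0 - U 0)) \<longlonglongrightarrow> 0 \<longrightarrow>
      (\<forall>t\<ge>0. (\<lambda>k. Hs_norm s (W k t - U t)) \<longlonglongrightarrow> 0)"
    using solution_continuous_dependence by blast
  show "\<forall>s\<ge>0. \<forall>L. \<exists>Q \<kappa> C. mono Q \<and> \<kappa> > 0 \<and> C > 0 \<and> dissipative_est \<gamma> \<omega> \<beta> L s Q \<kappa> C"
    "\<forall>s\<ge>0. \<exists>L0 Q \<kappa> C. mono Q \<and> \<kappa> > 0 \<and> C > 0 \<and> (\<forall>L\<ge>L0. dissipative_est \<gamma> \<omega> \<beta> L s Q \<kappa> C)"
    \<comment> \<open>The constants work for every real \<open>L\<close>, so any \<open>L0\<close>
      may be taken, and the statement for a single \<open>L\<close> follows as well.\<close>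
    using uniform_dissipative[of _ \<gamma> \<omega> \<beta>] by blast+
  show "\<forall>s\<ge>0. \<forall>L. \<exists>Q N. mono Q \<and> smoothing_est \<gamma> \<omega> \<beta> L s Q N"
    "\<forall>s\<ge>0. \<exists>L0 Q N. mono Q \<and> (\<forall>L\<ge>L0. smoothing_est \<gamma> \<omega> \<beta> L s Q N)"
    using uniform_smoothing[of _ \<gamma> \<omega> \<beta>] by blast+
  show "\<exists>K. \<forall>L U V t. is_solution \<gamma> \<omega> \<beta> L U \<and> is_solution \<gamma> \<omega> \<beta> L V \<and> t \<ge> 0 \<longrightarrow>
      Hs_norm 0 (U t - V t) \<le> exp (K (Hs_norm 0 (U 0)) (Hs_norm 0 (V 0)) * t) * Hs_norm 0 (U 0 - V 0)"
    \<comment> \<open>The sum of squares dominates each squared initial norm, as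
      \<open>solution_lipschitz_uniform\<close> requires of its radius.\<close>
    by (intro exI[of _ "\<lambda>x y. lip_rate \<omega> \<beta> (x\<^sup>2 + y\<^sup>2 + absorb \<beta>) / 2"] allI impI solution_lipschitz_uniform) auto
qed

end
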